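(* Let $a=\exp(T)$, where $T$ is a continuous isotropic Gaussian random field on $\mathbb{S}^2$ whose angular power spectrum $(A_\ell,\ell\in\mathbb{N}_0)$ satisfies $\sum_{\ell=0}^\infty A_\ell\,\ell^{1+\beta}<+\infty$ for some $\beta>0$, and let $f\in H^{-1}(\mathbb{S}^2)$ be deterministic with $f(1)=0$. Then there exists a unique (up to $\mathbb{P}$-null sets) strongly $H^1(\mathbb{S}^2)/\mathbb{R}$-measurable mapping $u:\Omega\to H^1(\mathbb{S}^2)/\mathbb{R}$ such that, $\mathbb{P}$-almost surely, $$(a\nabla_{\mathbb{S}^2}u,\nabla_{\mathbb{S}^2}v)=f(v)\qquad\forall v\in H^1(\mathbb{S}^2)/\mathbb{R},$$ and $u\in L^p(\Omega;H^1(\mathbb{S}^2)/\mathbb{R})$ for every $p\in[1,+\infty)$.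
   Context: $\mathbb{S}^2$ is the unit sphere in $\mathbb{R}^3$ with surface measure $\sigma$; $(\cdot,\cdot)$ is the $L^2(\mathbb{S}^2)$ inner product (of functions or tangential vector fields), $\nabla_{\mathbb{S}^2}$ the spherical gradient. $H^1(\mathbb{S}^2)$ is the usual Sobolev space, $H^{-1}(\mathbb{S}^2)$ its dual, and $f(v)$ denotes the dual pairing. $H^1(\mathbb{S}^2)/\mathbb{R}:=\{v\in H^1(\mathbb{S}^2):(v,1)=0\}$ with norm $\|v\|_{H^1(\mathbb{S}^2)/\mathbb{R}}:=\|\nabla_{\mathbb{S}^2}v\|_{L^2(\mathbb{S}^2)}$ (a Hilbert space). For a Banach space $B$, $L^p(\Omega;B)$ is the Bochner space over the probability space $(\Omega,\mathcal{A},\mathbb{P})$. An isotropic Gaussian random field $T$ on $\mathbb{S}^2$ is a real-valued Gaussian random field with finite second moments whose first and second moments are invariant under rotations. It has the Karhunen–Loève expansion $T=\sum_{\ell=0}^\infty\sum_{m=-\ell}^{\ell}a_{\ell m}Y_{\ell m}$ in $L^2(\Omega\times\mathbb{S}^2)$, with $Y_{\ell m}$ the orthonormal spherical harmonics ($-\Delta_{\mathbb{S}^2}Y_{\ell m}=\ell(\ell+1)Y_{\ell m}$, $Y_{\ell m}=(-1)^m\overline{Y_{\ell -m}}$), where the $a_{\ell m}$ with $m\ge0$ are independent Gaussian; for $m>0$, $\mathrm{Re}\,a_{\ell m}$ and $\mathrm{Im}\,a_{\ell m}$ are independent $\mathcal{N}(0,A_\ell/2)$; $a_{\ell 0}$ is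 real and $\mathcal{N}(0,A_\ell)$ for $\ell\ge1$, and $a_{00}$ is $\mathcal{N}(2\sqrt{\pi}\,\mathbb{E}(T),A_0)$; for $m<0$, $a_{\ell m}=(-1)^m\overline{a_{\ell -m}}$. $(A_\ell)$ is the angular power spectrum. $T$ is continuous if its sample paths are continuous on $\mathbb{S}^2$. *)

theory Defs
  imports "HOL-Probability.Probability" "HOL-Computational_Algebra.Polynomial"
begin

section \<open>The unit sphere and its surface measure\<close>

abbreviation S2 :: "(real^3) set" where
  "S2 \<equiv> sphere 0 1"

definition sph_coord :: "real \<times> real \<Rightarrow> real^3" where
  "sph_coord = (\<lambda>(\<theta>, \<phi>). vector [sin \<theta> * cos \<phi>, sin \<theta> * sin \<phi>, cos \<theta>])"

text \<open>The area element is \<open>sin \<theta> d\<theta> d\<phi>\<close> on \<open>[0,\<pi>] \<times> [0,2\<pi>)\<close>. The space of this measure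
  is the sphere itself, so the values that a function of type \<open>real^3 \<Rightarrow> 'b\<close> takes off the
  sphere are irrelevant below.\<close>

definition surf :: "(real^3) measure" where
  "surf = distr
     (density lborel
        (\<lambda>(\<theta>, \<phi>). ennreal (sin \<theta>) * indicator ({0..pi} \<times> {0..<2 * pi}) (\<theta>, \<phi>)))
     (restrict_space borel S2) sph_coord"

lemma space_surf [simp]: "space surf = S2"
  by (simp add: surf_def space_restrict_space)

lemma sets_surf [measurable_cong]: "sets surf = sets (restrict_space borel S2)"
  by (simp add: surf_def)


section \<open>The Sobolev space of order one on the sphere\<close>

text \<open>Elements of \<open>L\<^sup>2\<close> and of the Sobolev spaces are represented by functions; two of them
  are the same element iff they agree \<open>surf\<close>-almost everywhere.\<close>

definition L2 :: "(real^3 \<Rightarrow> 'b::{real_normed_vector, second_countable_topology}) set" where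
  "L2 = {v \<in> borel_measurable surf. integrable surf (\<lambda>x. (norm (v x))\<^sup>2)}"

primrec C_k :: "nat \<Rightarrow> (real^3 \<Rightarrow> real^3) \<Rightarrow> bool" where
  "C_k 0 \<Phi> \<longleftrightarrow> continuous_on UNIV \<Phi>"
| "C_k (Suc k) \<Phi> \<longleftrightarrow> \<Phi> differentiable_on UNIV \<and>
     (\<forall>i. C_k k (\<lambda>x. frechet_derivative \<Phi> (at x) (axis i 1)))"

text \<open>Smooth tangential vector fields, each given by a smooth extension to the whole space.\<close>

definition tangential_test_fields :: "(real^3 \<Rightarrow> real^3) set" where
  "tangential_test_fields = {\<Phi>. (\<forall>k. C_k k \<Phi>) \<and> (\<forall>x\<in>S2. \<Phi> x \<bullet> x = 0)}"

text \<open>The surface divergence is the trace of the derivative over the tangent plane at \<open>x\<close>,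
  i.e. the full trace minus the contribution of the unit normal \<open>x\<close>. It depends only on the
  restriction of \<open>\<Phi>\<close> to the sphere.\<close>

definition surf_div :: "(real^3 \<Rightarrow> real^3) \<Rightarrow> real^3 \<Rightarrow> real" where
  "surf_div \<Phi> x =
     (\<Sum>b\<in>Basis. frechet_derivative \<Phi> (at x) b \<bullet> b) - frechet_derivative \<Phi> (at x) x \<bullet> x"

definition is_weak_grad :: "(real^3 \<Rightarrow> real) \<Rightarrow> (real^3 \<Rightarrow> real^3) \<Rightarrow> bool" where
  "is_weak_grad v G \<longleftrightarrow>
     G \<in> L2 \<and> (AE x in surf. G x \<bullet> x = 0) \<and>
     (\<forall>\<Phi>\<in>tangential_test_fields.
        (LINT x|surf. G x \<bullet> \<Phi> x) = - (LINT x|surf. v x * surf_div \<Phi> x))"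

text \<open>Unique up to \<open>surf\<close>-null sets where it exists.\<close>

definition sph_grad :: "(real^3 \<Rightarrow> real) \<Rightarrow> real^3 \<Rightarrow> real^3" where
  "sph_grad v = (SOME G. is_weak_grad v G)"

definition H1 :: "(real^3 \<Rightarrow> real) set" where
  "H1 = {v \<in> L2. \<exists>G. is_weak_grad v G}"

definition H1_norm :: "(real^3 \<Rightarrow> real) \<Rightarrow> real" where
  "H1_norm v = sqrt ((LINT x|surf. (v x)\<^sup>2) + (LINT x|surf. (norm (sph_grad v x))\<^sup>2))"

definition H1_dual :: "((real^3 \<Rightarrow> real) \<Rightarrow> real) set" where
  "H1_dual = {f.
     (\<forall>v\<in>H1. \<forall>w\<in>H1. f (\<lambda>x. v x + w x) = f v + f w) \<and>
     (\<forall>c. \<forall>v\<in>H1. f (\<lambda>x. c * v x) = c * f v) \<and>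
     (\<exists>C. \<forall>v\<in>H1. \<bar>f v\<bar> \<le> C * H1_norm v)}"

definition H1R :: "(real^3 \<Rightarrow> real) set" where
  "H1R = {v \<in> H1. (LINT x|surf. v x * 1) = 0}"

definition H1R_norm :: "(real^3 \<Rightarrow> real) \<Rightarrow> real" where
  "H1R_norm v = sqrt (LINT x|surf. (norm (sph_grad v x))\<^sup>2)"


section \<open>Random elements of the Sobolev space\<close>

definition strongly_measurable_H1R :: "'w measure \<Rightarrow> ('w \<Rightarrow> real^3 \<Rightarrow> real) \<Rightarrow> bool" where
  "strongly_measurable_H1R M u \<longleftrightarrow>
     (\<forall>\<omega>\<in>space M. u \<omega> \<in> H1R) \<and>
     (\<exists>s :: nat \<Rightarrow> 'w \<Rightarrow> real^3 \<Rightarrow> real.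
        (\<forall>n. simple_function M (s n) \<and> (\<forall>\<omega>\<in>space M. s n \<omega> \<in> H1R)) \<and>
        (\<forall>\<omega>\<in>space M. (\<lambda>n. H1R_norm (\<lambda>x. s n \<omega> x - u \<omega> x)) \<longlonglongrightarrow> 0))"

definition Lp_H1R :: "real \<Rightarrow> 'w measure \<Rightarrow> ('w \<Rightarrow> real^3 \<Rightarrow> real) set" where
  "Lp_H1R p M =
     {u. strongly_measurable_H1R M u \<and> integrable M (\<lambda>\<omega>. H1R_norm (u \<omega>) powr p)}"


section \<open>Isotropic Gaussian random fields\<close>

text \<open>\<open>normal_law \<mu> v\<close> is the law \<open>N(\<mu>, v)\<close> with mean \<open>\<mu>\<close> and variance \<open>v \<ge> 0\<close>; the degenerate
  case \<open>v = 0\<close> is the point mass at \<open>\<mu>\<close>.\<close>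

definition normal_law :: "real \<Rightarrow> real \<Rightarrow> real measure" where
  "normal_law \<mu> v =
     (if v = 0 then return borel \<mu> else density lborel (normal_density \<mu> (sqrt v)))"

definition has_normal_law :: "'w measure \<Rightarrow> ('w \<Rightarrow> real) \<Rightarrow> real \<Rightarrow> real \<Rightarrow> bool" where
  "has_normal_law M X \<mu> v \<longleftrightarrow>
     X \<in> borel_measurable M \<and> v \<ge> 0 \<and> distr M borel X = normal_law \<mu> v"

definition gaussian_random_field :: "'w measure \<Rightarrow> ('w \<Rightarrow> real^3 \<Rightarrow> real) \<Rightarrow> bool" where
  "gaussian_random_field M T \<longleftrightarrow>
     (\<lambda>(\<omega>, x). T \<omega> x) \<in> borel_measurable (M \<Otimes>\<^sub>M surf) \<and>
     (\<forall>F c. finite F \<and> F \<subseteq> S2 \<longrightarrow>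
        (\<exists>\<mu> v. has_normal_law M (\<lambda>\<omega>. \<Sum>x\<in>F. c x * T \<omega> x) \<mu> v))"

definition isotropic_gaussian_random_field ::
    "'w measure \<Rightarrow> ('w \<Rightarrow> real^3 \<Rightarrow> real) \<Rightarrow> bool" where
  "isotropic_gaussian_random_field M T \<longleftrightarrow>
     gaussian_random_field M T \<and>
     (\<forall>x\<in>S2. integrable M (\<lambda>\<omega>. (T \<omega> x)\<^sup>2)) \<and>
     (\<forall>Q :: real^3^3. rotation_matrix Q \<longrightarrow>
        (\<forall>x\<in>S2. (LINT \<omega>|M. T \<omega> (Q *v x)) = (LINT \<omega>|M. T \<omega> x)) \<and>
        (\<forall>x\<in>S2. \<forall>y\<in>S2.
           (LINT \<omega>|M. T \<omega> (Q *v x) * T \<omega> (Q *v y)) = (LINT \<omega>|M. T \<omega> x * T \<omega> y)))"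

definition continuous_random_field :: "'w measure \<Rightarrow> ('w \<Rightarrow> real^3 \<Rightarrow> real) \<Rightarrow> bool" where
  "continuous_random_field M T \<longleftrightarrow> (\<forall>\<omega>\<in>space M. continuous_on S2 (T \<omega>))"


section \<open>Spherical harmonics and the angular power spectrum\<close>

definition legendre_poly :: "nat \<Rightarrow> real poly" where
  "legendre_poly l = smult (1 / (2 ^ l * fact l)) ((pderiv ^^ l) ([:-1, 0, 1:] ^ l))"

text \<open>For \<open>0 \<le> m \<le> l\<close> the harmonic is the usual
  \<open>sqrt ((2l+1)/(4\<pi>) (l-m)!/(l+m)!) P\<^bsub>lm\<^esub>(cos \<theta>) exp (im\<phi>)\<close> with the associated Legendre function
  \<open>P\<^bsub>lm\<^esub>(t) = (-1)\<^sup>m (1-t\<^sup>2)\<^bsup>m/2\<^esup> P\<^sub>l\<^bsup>(m)\<^esup>(t)\<close>, rewritten in Cartesian coordinates by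
  \<open>sin\<^sup>m \<theta> exp (im\<phi>) = (x\<^sub>1 + ix\<^sub>2)\<^sup>m\<close>.\<close>

definition sph_harm_nonneg :: "nat \<Rightarrow> nat \<Rightarrow> real^3 \<Rightarrow> complex" where
  "sph_harm_nonneg l m x =
     complex_of_real
       (sqrt ((2 * real l + 1) / (4 * pi) * (fact (l - m) / fact (l + m))) *
        (-1) ^ m * poly ((pderiv ^^ m) (legendre_poly l)) (x $ 3)) *
     (Complex (x $ 1) (x $ 2)) ^ m"

definition sph_harm :: "nat \<Rightarrow> int \<Rightarrow> real^3 \<Rightarrow> complex" where
  "sph_harm l m x =
     (if m \<ge> 0 then sph_harm_nonneg l (nat m) x
      else (-1) ^ nat (- m) * cnj (sph_harm_nonneg l (nat (- m)) x))"

text \<open>\<open>karhunen_loeve M T A a\<close>: \<open>T\<close> has the Karhunen--Loeve expansion with random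
  coefficients \<open>a l m\<close>, \<open>-l \<le> m \<le> l\<close>, whose variances are given by \<open>A\<close>. The mean of \<open>T\<close> is
  the same at every point, so the clause on \<open>a 0 0\<close> may quantify over all points.\<close>

definition karhunen_loeve ::
    "'w measure \<Rightarrow> ('w \<Rightarrow> real^3 \<Rightarrow> real) \<Rightarrow> (nat \<Rightarrow> real) \<Rightarrow> (nat \<Rightarrow> int \<Rightarrow> 'w \<Rightarrow> complex) \<Rightarrow> bool" where
  "karhunen_loeve M T A a \<longleftrightarrow>
     prob_space.indep_vars M (\<lambda>_. borel) (\<lambda>(l, m). a l (int m)) {(l, m). m \<le> l} \<and>
     (\<forall>l. \<forall>m\<in>{1..l}.
        prob_space.indep_var M borel (\<lambda>\<omega>. Re (a l (int m) \<omega>)) borel (\<lambda>\<omega>. Im (a l (int m) \<omega>)) \<and>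
        has_normal_law M (\<lambda>\<omega>. Re (a l (int m) \<omega>)) 0 (A l / 2) \<and>
        has_normal_law M (\<lambda>\<omega>. Im (a l (int m) \<omega>)) 0 (A l / 2)) \<and>
     (\<forall>l. \<forall>\<omega>\<in>space M. Im (a l 0 \<omega>) = 0) \<and>
     (\<forall>l\<ge>1. has_normal_law M (\<lambda>\<omega>. Re (a l 0 \<omega>)) 0 (A l)) \<and>
     (\<forall>x\<in>S2. has_normal_law M (\<lambda>\<omega>. Re (a 0 0 \<omega>)) (2 * sqrt pi * (LINT \<omega>|M. T \<omega> x)) (A 0)) \<and>
     (\<forall>l. \<forall>m\<in>{1..l}. \<forall>\<omega>\<in>space M. a l (- int m) \<omega> = (-1) ^ m * cnj (a l (int m) \<omega>)) \<and>
     (\<lambda>L. \<integral>\<^sup>+ (\<omega>, x). ennreal ((cmod (complex_of_real (T \<omega> x) -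
              (\<Sum>l\<le>L. \<Sum>m\<in>{- int l..int l}. a l m \<omega> * sph_harm l m x)))\<^sup>2) \<partial>(M \<Otimes>\<^sub>M surf))
       \<longlonglongrightarrow> 0"

definition angular_power_spectrum ::
    "'w measure \<Rightarrow> ('w \<Rightarrow> real^3 \<Rightarrow> real) \<Rightarrow> (nat \<Rightarrow> real) \<Rightarrow> bool" where
  "angular_power_spectrum M T A \<longleftrightarrow> (\<exists>a. karhunen_loeve M T A a)"


section \<open>The lognormal diffusion problem\<close>

definition weak_solution ::
    "(real^3 \<Rightarrow> real) \<Rightarrow> ((real^3 \<Rightarrow> real) \<Rightarrow> real) \<Rightarrow> (real^3 \<Rightarrow> real) \<Rightarrow> bool" where
  "weak_solution a f u \<longleftrightarrow>
     (\<forall>v\<in>H1R. (LINT x|surf. (a x *\<^sub>R sph_grad u x) \<bullet> sph_grad v x) = f v)"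

end

theory Submission
  imports Defs
begin

text \<open>For a fixed \<open>\<omega>\<close> the coefficient \<open>exp (T \<omega>)\<close> lies between \<open>exp (- s)\<close> and \<open>exp s\<close>, where \<open>s\<close> is
  the supremum of \<open>\<bar>T \<omega>\<bar>\<close> on the sphere, finite by continuity. The form
  \<open>\<integral> exp (T \<omega>) \<nabla>u \<bullet> \<nabla>v\<close> is therefore bounded and coercive for the gradient norm, so the Riesz
  representation theorem produces a solution, coercivity makes it unique, and its norm is at most
  \<open>F exp s\<close>, where \<open>F\<close> is the norm of the functional \<open>f\<close>. Three facts turn this into the theorem.

  First, the gradient norm has to be a complete norm on the functions of mean zero, which is the
  Poincare inequality for weak gradients (\<open>poincare_inequality\<close>). It is obtained by duality: up to its
  mean, a polynomial \<open>p\<close> is on the sphere the surface divergence of a polynomial tangential field whose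
  norm is controlled by that of \<open>p\<close>, so the definition of the weak gradient bounds \<open>\<integral> v p\<close>; the
  polynomials are dense in the square-integrable functions. The field is found in two steps. The
  derivative along rotations about the third axis accounts for everything except a function of the
  height \<open>x\<^sub>3\<close>, and such a function is the divergence of a multiple of the gradient of the height.

  Second, the solution has to depend measurably on \<open>\<omega>\<close>. It depends continuously on the coefficient in
  the supremum norm (\<open>weak_solution_perturbation\<close>). Replacing \<open>T \<omega>\<close> by its rounded values on a finite
  net gives coefficients that take finitely many values as \<open>\<omega>\<close> varies and converge uniformly to
  \<open>T \<omega>\<close> for each \<open>\<omega>\<close>; their solutions are the simple functions that strong measurability asks for.

  Third, \<open>exp (p s)\<close> has to be integrable for every \<open>p\<close>. This is Fernique's theorem (\<open>fernique\<close>).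
  For independent copies \<open>X\<close> and \<open>Y\<close> of the centred field, the pair \<open>(X - Y) / \<surd>2\<close>, \<open>(X + Y) / \<surd>2\<close>
  has the same law as the pair \<open>X\<close>, \<open>Y\<close>, and comparing the two pairs shows that the tail of the supremum
  is squared, up to a constant, each time the threshold grows by about the factor \<open>\<surd>2\<close>.\<close>

section \<open>Square-integrable functions\<close>

text \<open>Cauchy--Schwarz in the form in which it is used twice below, for square-integrable functions and
  for an abstract semidefinite form. If \<open>C = 0\<close>, the quadratic is affine and has no minimum to evaluate.\<close>

lemma quadratic_nonneg_discriminant:
  fixes A B C :: real
  assumes nn: "\<And>t. 0 \<le> A + 2 * t * B + t\<^sup>2 * C" and "0 \<le> C"
  shows "B\<^sup>2 \<le> A * C"
proof (cases "C = 0")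
  case True
  have "B = 0"
  proof (rule ccontr)
    assume "B \<noteq> 0"
    have "0 \<le> A + 2 * (- (A + 1) / (2 * B)) * B" using nn[of "- (A + 1) / (2 * B)"] True by simp
    also have "\<dots> = - 1" using \<open>B \<noteq> 0\<close> by (simp add: field_simps)
    finally show False by simp
  qed
  then show ?thesis using True by simp
next
  case False
  have "0 \<le> A + 2 * (- B / C) * B + (- B / C)\<^sup>2 * C" by (rule nn)
  also have "\<dots> = A - B\<^sup>2 / C" using False by (simp add: power2_eq_square field_simps)
  finally show ?thesis using False assms(2) by (simp add: field_simps)
qed

text \<open>The elements are functions rather than classes of functions, so that for the surface measure the
  set is literally the space \<open>L2\<close> of the statement.\<close>

definition sq_integrable ::
    "'a measure \<Rightarrow> ('a \<Rightarrow> 'b::{real_normed_vector, second_countable_topology}) set" where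
  "sq_integrable M = {f \<in> borel_measurable M. integrable M (\<lambda>x. (norm (f x))\<^sup>2)}"

definition l2_norm :: "'a measure \<Rightarrow> ('a \<Rightarrow> 'b::real_normed_vector) \<Rightarrow> real" where
  "l2_norm M f = sqrt (LINT x|M. (norm (f x))\<^sup>2)"

lemma l2_norm_nonneg [simp]: "0 \<le> l2_norm M f"
  by (simp add: l2_norm_def)

lemma l2_norm_power2: "(l2_norm M f)\<^sup>2 = (LINT x|M. (norm (f x))\<^sup>2)"
  by (simp add: l2_norm_def)

lemma sq_integrable_measurable [measurable_dest]: "f \<in> sq_integrable M \<Longrightarrow> f \<in> borel_measurable M"
  by (simp add: sq_integrable_def)

lemma sq_integrable_integrable: "f \<in> sq_integrable M \<Longrightarrow> integrable M (\<lambda>x. (norm (f x))\<^sup>2)"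
  by (simp add: sq_integrable_def)

lemma norm_add_power2_le:
  "(norm (a + b))\<^sup>2 \<le> 2 * (norm a)\<^sup>2 + 2 * (norm (b :: 'b::real_normed_vector))\<^sup>2"
proof -
  have "(norm (a + b))\<^sup>2 \<le> (norm a + norm b)\<^sup>2"
    by (intro power_mono norm_triangle_ineq) auto
  also have "\<dots> \<le> 2 * (norm a)\<^sup>2 + 2 * (norm b)\<^sup>2"
    using zero_le_power2[of "norm a - norm b"] by (simp add: power2_sum power2_diff)
  finally show ?thesis .
qed

lemma norm_add_scaleR_power2:
  "(norm (a + t *\<^sub>R b))\<^sup>2
     = (norm a)\<^sup>2 + 2 * t * (a \<bullet> b) + t\<^sup>2 * (norm (b :: 'b::real_inner))\<^sup>2"
  by (simp only: power2_norm_eq_inner inner_simps)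
    (simp add: inner_commute algebra_simps power2_eq_square)

lemma sq_integrable_add:
  assumes "f \<in> sq_integrable M" "g \<in> sq_integrable M"
  shows "(\<lambda>x. f x + g x) \<in> sq_integrable M"
proof -
  note [measurable] = assms[THEN sq_integrable_measurable]
  have "integrable M (\<lambda>x. 2 * (norm (f x))\<^sup>2 + 2 * (norm (g x))\<^sup>2)"
    using assms by (intro Bochner_Integration.integrable_add integrable_mult_right) (auto dest: sq_integrable_integrable)
  then have "integrable M (\<lambda>x. (norm (f x + g x))\<^sup>2)"
    by (rule Bochner_Integration.integrable_bound) (auto simp: norm_add_power2_le)
  then show ?thesis by (simp add: sq_integrable_def)
qed

lemma sq_integrable_scaleR:
  "f \<in> sq_integrable M \<Longrightarrow> (\<lambda>x. c *\<^sub>R f x) \<in> sq_integrable M"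
  by (auto simp: sq_integrable_def power_mult_distrib)

lemma sq_integrable_cmult:
  "(f :: 'a \<Rightarrow> real) \<in> sq_integrable M \<Longrightarrow> (\<lambda>x. c * f x) \<in> sq_integrable M"
  using sq_integrable_scaleR[of f M c] by simp

lemma sq_integrable_diff:
  assumes "f \<in> sq_integrable M" "g \<in> sq_integrable M"
  shows "(\<lambda>x. f x - g x) \<in> sq_integrable M"
  using sq_integrable_add[OF assms(1) sq_integrable_scaleR[OF assms(2), of "-1"]] by simp

lemma sq_integrable_zero [simp]: "(\<lambda>x. 0) \<in> sq_integrable M"
  by (simp add: sq_integrable_def)

lemma integrable_inner_sq_integrable:
  fixes f g :: "'a \<Rightarrow> 'b::{real_inner, second_countable_topology}"
  assumes "f \<in> sq_integrable M" "g \<in> sq_integrable M"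
  shows "integrable M (\<lambda>x. f x \<bullet> g x)"
proof -
  note [measurable] = assms[THEN sq_integrable_measurable]
  have "integrable M (\<lambda>x. (norm (f x))\<^sup>2 + (norm (g x))\<^sup>2)"
    using assms by (intro Bochner_Integration.integrable_add) (auto dest: sq_integrable_integrable)
  then show ?thesis
  proof (rule Bochner_Integration.integrable_bound)
    show "AE x in M. norm (f x \<bullet> g x) \<le> norm ((norm (f x))\<^sup>2 + (norm (g x))\<^sup>2)"
    proof (rule AE_I2)
      fix x
      have "norm (f x \<bullet> g x) \<le> norm (f x) * norm (g x)"
        using Cauchy_Schwarz_ineq2[of "f x" "g x"] by simp
      also have "\<dots> \<le> (norm (f x))\<^sup>2 + (norm (g x))\<^sup>2"
        using zero_le_power2[of "norm (f x) - norm (g x)"]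
          mult_nonneg_nonneg[OF norm_ge_zero norm_ge_zero, of "f x" "g x"]
        unfolding power2_diff by linarith
      finally show "norm (f x \<bullet> g x) \<le> norm ((norm (f x))\<^sup>2 + (norm (g x))\<^sup>2)" by simp
    qed
  qed simp
qed

lemma integrable_mult_sq_integrable:
  fixes f g :: "'a \<Rightarrow> real"
  assumes "f \<in> sq_integrable M" "g \<in> sq_integrable M"
  shows "integrable M (\<lambda>x. f x * g x)"
  using integrable_inner_sq_integrable[OF assms] by simp

lemma l2_norm_cauchy_schwarz:
  fixes f g :: "'a \<Rightarrow> 'b::{real_inner, second_countable_topology}"
  assumes f: "f \<in> sq_integrable M" and g: "g \<in> sq_integrable M"
  shows "\<bar>LINT x|M. f x \<bullet> g x\<bar> \<le> l2_norm M f * l2_norm M g"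
proof -
  note int = sq_integrable_integrable[OF f] sq_integrable_integrable[OF g]
    integrable_inner_sq_integrable[OF f g]
  have "(LINT x|M. f x \<bullet> g x)\<^sup>2 \<le> (LINT x|M. (norm (f x))\<^sup>2) * (LINT x|M. (norm (g x))\<^sup>2)"
  proof (rule quadratic_nonneg_discriminant)
    fix t
    have "0 \<le> (LINT x|M. (norm (f x + t *\<^sub>R g x))\<^sup>2)" by simp
    also have "\<dots> = (LINT x|M. (norm (f x))\<^sup>2 + 2 * t * (f x \<bullet> g x) + t\<^sup>2 * (norm (g x))\<^sup>2)"
      by (simp only: norm_add_scaleR_power2)
    also have "\<dots> = (LINT x|M. (norm (f x))\<^sup>2) + 2 * t * (LINT x|M. f x \<bullet> g x)
                   + t\<^sup>2 * (LINT x|M. (norm (g x))\<^sup>2)"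
      using int by simp
    finally show "0 \<le> \<dots>" .
  qed simp
  then have "(LINT x|M. f x \<bullet> g x)\<^sup>2 \<le> (l2_norm M f * l2_norm M g)\<^sup>2"
    by (simp add: power_mult_distrib l2_norm_power2)
  then show ?thesis
    by (metis abs_le_square_iff abs_of_nonneg l2_norm_nonneg mult_nonneg_nonneg)
qed

lemma l2_norm_cauchy_schwarz_real:
  fixes f g :: "'a \<Rightarrow> real"
  assumes "f \<in> sq_integrable M" "g \<in> sq_integrable M"
  shows "\<bar>LINT x|M. f x * g x\<bar> \<le> l2_norm M f * l2_norm M g"
  using l2_norm_cauchy_schwarz[OF assms] by simp

lemma l2_norm_triangle:
  fixes f g :: "'a \<Rightarrow> 'b::{real_inner, second_countable_topology}"
  assumes f: "f \<in> sq_integrable M" and g: "g \<in> sq_integrable M"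
  shows "l2_norm M (\<lambda>x. f x + g x) \<le> l2_norm M f + l2_norm M g"
proof -
  note int = sq_integrable_integrable[OF f] sq_integrable_integrable[OF g]
    integrable_inner_sq_integrable[OF f g]
  have "(l2_norm M (\<lambda>x. f x + g x))\<^sup>2
      = (LINT x|M. (norm (f x))\<^sup>2 + 2 * (f x \<bullet> g x) + (norm (g x))\<^sup>2)"
    using norm_add_scaleR_power2[of "f x" 1 "g x" for x] by (simp add: l2_norm_power2)
  also have "\<dots> = (l2_norm M f)\<^sup>2 + 2 * (LINT x|M. f x \<bullet> g x) + (l2_norm M g)\<^sup>2"
    using int by (simp add: l2_norm_power2)
  also have "\<dots> \<le> (l2_norm M f + l2_norm M g)\<^sup>2"
    using l2_norm_cauchy_schwarz[OF f g] by (simp add: power2_sum)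
  finally show ?thesis by (rule power2_le_imp_le) simp
qed

lemma l2_norm_scaleR: "l2_norm M (\<lambda>x. c *\<^sub>R f x) = \<bar>c\<bar> * l2_norm M f"
  by (simp add: l2_norm_def power_mult_distrib real_sqrt_mult)

lemma l2_norm_minus_commute: "l2_norm M (\<lambda>x. f x - g x) = l2_norm M (\<lambda>x. g x - f x)"
  by (simp add: l2_norm_def norm_minus_commute)

lemma l2_norm_zero [simp]: "l2_norm M (\<lambda>x. 0) = 0"
  by (simp add: l2_norm_def)

lemma l2_norm_triangle_diff:
  fixes f g :: "'a \<Rightarrow> 'b::{real_inner, second_countable_topology}"
  assumes f: "f \<in> sq_integrable M" and g: "g \<in> sq_integrable M"
  shows "\<bar>l2_norm M f - l2_norm M g\<bar> \<le> l2_norm M (\<lambda>x. f x - g x)"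
  using l2_norm_triangle[OF sq_integrable_diff[OF f g] g]
    l2_norm_triangle[OF sq_integrable_diff[OF g f] f]
  by (simp add: l2_norm_minus_commute[of M f g])

lemma l2_norm_cong_AE:
  assumes "AE x in M. f x = g x" "f \<in> borel_measurable M" "g \<in> borel_measurable M"
  shows "l2_norm M f = l2_norm M (g :: _ \<Rightarrow> 'b::{real_normed_vector, second_countable_topology})"
  unfolding l2_norm_def using assms by (intro arg_cong[where f = sqrt] integral_cong_AE) auto

lemma l2_norm_eq_0_AE:
  assumes f: "f \<in> sq_integrable M" and "l2_norm M f = 0"
  shows "AE x in M. f x = 0"
proof -
  have "(LINT x|M. (norm (f x))\<^sup>2) = 0" using assms(2) by (simp add: l2_norm_def)
  then have "AE x in M. (norm (f x))\<^sup>2 = 0"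
    using sq_integrable_integrable[OF f] by (subst (asm) integral_nonneg_eq_0_iff_AE) auto
  then show ?thesis by simp
qed

lemma sq_integrable_bounded:
  assumes "finite_measure M" "f \<in> borel_measurable M" "\<And>x. x \<in> space M \<Longrightarrow> norm (f x) \<le> B"
  shows "f \<in> sq_integrable M"
proof -
  interpret finite_measure M by fact
  have "integrable M (\<lambda>x. (norm (f x))\<^sup>2)"
    using assms(2,3) by (intro integrable_const_bound[of _ "B\<^sup>2"]) (auto intro!: power_mono)
  then show ?thesis using assms(2) by (simp add: sq_integrable_def)
qed

lemma sq_integrable_const: "finite_measure M \<Longrightarrow> (\<lambda>x. c) \<in> sq_integrable M"
  by (rule sq_integrable_bounded[of _ _ "norm c"]) auto

lemma integrable_sq_integrable:
  fixes f :: "'a \<Rightarrow> real"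
  assumes "finite_measure M" "f \<in> sq_integrable M"
  shows "integrable M f"
proof -
  interpret finite_measure M by fact
  show ?thesis
    using integrable_mult_sq_integrable[OF assms(2) sq_integrable_bounded[OF assms(1), of "\<lambda>_. 1" 1]]
    by simp
qed

text \<open>Riesz--Fischer. Along a subsequence whose increments have norm at most \<open>2\<^sup>-\<^sup>k\<close> the increments are
  summable in mean, because the measure is finite, so the subsequence converges almost everywhere;
  Fatou's lemma turns the pointwise limit into a limit in norm.\<close>

lemma L2_complete:
  fixes f :: "nat \<Rightarrow> 'a \<Rightarrow> 'b::euclidean_space"
  assumes "finite_measure M" and f: "\<And>n. f n \<in> sq_integrable M"
    and cauchy: "\<And>e. e > 0 \<Longrightarrow> \<exists>N. \<forall>m\<ge>N. \<forall>n\<ge>N. l2_norm M (\<lambda>x. f m x - f n x) < e"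
  shows "\<exists>g\<in>sq_integrable M. (\<lambda>n. l2_norm M (\<lambda>x. f n x - g x)) \<longlonglongrightarrow> 0"
proof -
  interpret finite_measure M by fact
  note [measurable] = f[THEN sq_integrable_measurable]
  have "\<exists>r. \<forall>k. (\<forall>m\<ge>r k. l2_norm M (\<lambda>x. f m x - f (r k) x) < (1/2)^k) \<and> r k < r (Suc k)"
  proof (rule dependent_nat_choice)
    show "\<exists>x. \<forall>m\<ge>x. l2_norm M (\<lambda>y. f m y - f x y) < (1/2)^0"
      using cauchy[of 1] by (metis power_0 zero_less_one order_refl)
  next
    fix x k
    obtain N where N: "\<forall>m\<ge>N. \<forall>n\<ge>N. l2_norm M (\<lambda>y. f m y - f n y) < (1/2)^Suc k"
      using cauchy[of "(1/2)^Suc k"] by auto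
    show "\<exists>y. (\<forall>m\<ge>y. l2_norm M (\<lambda>x. f m x - f y x) < (1/2)^Suc k) \<and> x < y"
      using N by (intro exI[of _ "max N (Suc x)"]) auto
  qed
  then obtain r where r: "\<And>k m. m \<ge> r k \<Longrightarrow> l2_norm M (\<lambda>x. f m x - f (r k) x) < (1/2)^k"
    and "\<And>k. r k < r (Suc k)" by blast
  then have "strict_mono r" by (simp add: strict_mono_Suc_iff)
  define d where "d k x = f (r (Suc k)) x - f (r k) x" for k x
  have d: "d k \<in> sq_integrable M" for k unfolding d_def by (intro sq_integrable_diff f)
  note [measurable] = d[THEN sq_integrable_measurable]
  have d_le: "l2_norm M (d k) \<le> (1/2)^k" for k
    unfolding d_def using r[of k "r (Suc k)"] \<open>\<And>k. r k < r (Suc k)\<close>[of k] by simp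
  have nd: "(\<lambda>x. norm (d k x)) \<in> sq_integrable M" for k using d[of k] by (simp add: sq_integrable_def)
  have one: "(\<lambda>x. 1::real) \<in> sq_integrable M"
    by (rule sq_integrable_bounded[of _ _ 1]) (auto intro: finite_measure_axioms)
  have int_d: "(LINT x|M. norm (d k x)) \<le> (1/2)^k * l2_norm M (\<lambda>x. 1::real)" for k
  proof -
    have "(LINT x|M. norm (d k x)) \<le> l2_norm M (\<lambda>x. norm (d k x)) * l2_norm M (\<lambda>x. 1::real)"
      using l2_norm_cauchy_schwarz_real[OF nd one, of k] by simp
    also have "l2_norm M (\<lambda>x. norm (d k x)) = l2_norm M (d k)" by (simp add: l2_norm_def)
    also have "\<dots> * l2_norm M (\<lambda>x. 1::real) \<le> (1/2)^k * l2_norm M (\<lambda>x. 1::real)"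
      by (intro mult_right_mono d_le) auto
    finally show ?thesis .
  qed
  have "(\<integral>\<^sup>+x. (\<Sum>k. ennreal (norm (d k x))) \<partial>M) = (\<Sum>k. ennreal (LINT x|M. norm (d k x)))"
    using integrable_sq_integrable[OF finite_measure_axioms nd]
    by (subst nn_integral_suminf) (auto simp: nn_integral_eq_integral)
  also have "\<dots> \<le> (\<Sum>k. ennreal ((1/2)^k * l2_norm M (\<lambda>x. 1::real)))"
    by (intro suminf_le ennreal_leI int_d) auto
  also have "\<dots> < \<infinity>"
    by (subst suminf_ennreal2) (auto intro!: summable_mult2 summable_geometric)
  finally have "(\<integral>\<^sup>+x. (\<Sum>k. ennreal (norm (d k x))) \<partial>M) \<noteq> \<infinity>" by simp
  then have "AE x in M. (\<Sum>k. ennreal (norm (d k x))) \<noteq> \<infinity>"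
    by (intro nn_integral_PInf_AE) auto
  then have "AE x in M. summable (\<lambda>k. norm (d k x))"
    by eventually_elim (auto intro: summable_suminf_not_top)
  then have conv: "AE x in M. convergent (\<lambda>k. f (r k) x)"
  proof eventually_elim
    fix x assume "summable (\<lambda>k. norm (d k x))"
    then have "summable (\<lambda>k. d k x)" by (rule summable_norm_cancel)
    then have "convergent (\<lambda>n. \<Sum>k<n. d k x)" by (simp add: summable_iff_convergent)
    moreover have "(\<Sum>k<n. d k x) = f (r n) x - f (r 0) x" for n
      unfolding d_def by (rule sum_lessThan_telescope)
    ultimately have "convergent (\<lambda>n. (f (r n) x - f (r 0) x) + f (r 0) x)"
      by (intro convergent_add convergent_const) simp
    then show "convergent (\<lambda>k. f (r k) x)" by simp
  qed
  define g where "g x = lim (\<lambda>k. f (r k) x)" for x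
  have [measurable]: "g \<in> borel_measurable M" unfolding g_def by measurable
  have lim: "AE x in M. (\<lambda>k. f (r k) x) \<longlonglongrightarrow> g x"
    using conv by eventually_elim (simp add: g_def convergent_LIMSEQ_iff)
  have fatou: "(\<integral>\<^sup>+x. ennreal ((norm (f n x - g x))\<^sup>2) \<partial>M) \<le> ennreal (e\<^sup>2)"
    if "\<And>m. m \<ge> N \<Longrightarrow> l2_norm M (\<lambda>x. f n x - f m x) \<le> e" "e \<ge> 0" for n N e
  proof -
    have "(\<integral>\<^sup>+x. ennreal ((norm (f n x - g x))\<^sup>2) \<partial>M)
        = (\<integral>\<^sup>+x. liminf (\<lambda>k. ennreal ((norm (f n x - f (r k) x))\<^sup>2)) \<partial>M)"
    proof (rule nn_integral_cong_AE)
      show "AE x in M. ennreal ((norm (f n x - g x))\<^sup>2)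
          = liminf (\<lambda>k. ennreal ((norm (f n x - f (r k) x))\<^sup>2))"
        using lim
      proof eventually_elim
        fix x assume "(\<lambda>k. f (r k) x) \<longlonglongrightarrow> g x"
        then have "(\<lambda>k. ennreal ((norm (f n x - f (r k) x))\<^sup>2)) \<longlonglongrightarrow> ennreal ((norm (f n x - g x))\<^sup>2)"
          by (intro tendsto_ennrealI tendsto_intros)
        then show "ennreal ((norm (f n x - g x))\<^sup>2)
            = liminf (\<lambda>k. ennreal ((norm (f n x - f (r k) x))\<^sup>2))"
          by (intro lim_imp_Liminf[symmetric]) simp_all
      qed
    qed
    also have "\<dots> \<le> liminf (\<lambda>k. \<integral>\<^sup>+x. ennreal ((norm (f n x - f (r k) x))\<^sup>2) \<partial>M)"
      by (rule nn_integral_liminf) measurable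
    also have "\<dots> \<le> ennreal (e\<^sup>2)"
    proof (subst Liminf_const[symmetric, of sequentially "ennreal (e\<^sup>2)"], simp,
        rule Liminf_mono, rule eventually_mono[OF eventually_ge_at_top[of N]])
      fix k assume "k \<ge> N"
      then have "r k \<ge> N" using seq_suble[OF \<open>strict_mono r\<close>, of k] by simp
      then have "(l2_norm M (\<lambda>x. f n x - f (r k) x))\<^sup>2 \<le> e\<^sup>2" by (intro power_mono that) auto
      then show "(\<integral>\<^sup>+x. ennreal ((norm (f n x - f (r k) x))\<^sup>2) \<partial>M) \<le> ennreal (e\<^sup>2)"
        using sq_integrable_integrable[OF sq_integrable_diff[OF f f], of n "r k"]
        by (simp add: nn_integral_eq_integral l2_norm_power2)
    qed
    finally show ?thesis .
  qed
  have close: "(\<lambda>x. f n x - g x) \<in> sq_integrable M \<and> l2_norm M (\<lambda>x. f n x - g x) \<le> e"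
    if "\<And>m. m \<ge> N \<Longrightarrow> l2_norm M (\<lambda>x. f n x - f m x) \<le> e" "e \<ge> 0" for n N e
  proof -
    have "(\<integral>\<^sup>+x. ennreal ((norm (f n x - g x))\<^sup>2) \<partial>M) < \<infinity>"
      by (rule le_less_trans[OF fatou[OF that]]) simp_all
    then have int: "integrable M (\<lambda>x. (norm (f n x - g x))\<^sup>2)"
      by (intro integrableI_bounded) simp_all
    have "ennreal (LINT x|M. (norm (f n x - g x))\<^sup>2) \<le> ennreal (e\<^sup>2)"
      using fatou[OF that] int by (simp add: nn_integral_eq_integral)
    then have "(l2_norm M (\<lambda>x. f n x - g x))\<^sup>2 \<le> e\<^sup>2" by (simp add: l2_norm_power2)
    then show ?thesis using int that(2) by (auto simp: sq_integrable_def intro!: power2_le_imp_le[of _ e])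
  qed
  obtain N where "\<forall>m\<ge>N. \<forall>n\<ge>N. l2_norm M (\<lambda>x. f m x - f n x) < 1" using cauchy[of 1] by auto
  then have "(\<lambda>x. f N x - g x) \<in> sq_integrable M" using close[of N N 1] by (auto simp: less_imp_le)
  from sq_integrable_diff[OF f[of N] this] have "g \<in> sq_integrable M" by simp
  moreover have "(\<lambda>n. l2_norm M (\<lambda>x. f n x - g x)) \<longlonglongrightarrow> 0"
  proof (rule LIMSEQ_I)
    fix e :: real assume "e > 0"
    then obtain N where N: "\<forall>m\<ge>N. \<forall>n\<ge>N. l2_norm M (\<lambda>x. f m x - f n x) < e/2"
      using cauchy[of "e/2"] by auto
    have "l2_norm M (\<lambda>x. f n x - g x) < e" if "n \<ge> N" for n
      using close[of N n "e/2"] N that \<open>e > 0\<close> by (force simp: less_imp_le)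
    then show "\<exists>no. \<forall>n\<ge>no. norm (l2_norm M (\<lambda>x. f n x - g x) - 0) < e" by auto
  qed
  ultimately show ?thesis by blast
qed

section \<open>Density of the polynomials\<close>

lemma l2_norm_dominated_convergence:
  fixes f w :: "'a \<Rightarrow> real" and s :: "nat \<Rightarrow> 'a \<Rightarrow> real"
  assumes w: "w \<in> sq_integrable M" and [measurable]: "f \<in> borel_measurable M" "\<And>n. s n \<in> borel_measurable M"
    and lim: "\<And>x. x \<in> space M \<Longrightarrow> (\<lambda>n. s n x) \<longlonglongrightarrow> f x"
    and bound: "\<And>n x. x \<in> space M \<Longrightarrow> \<bar>s n x\<bar> \<le> w x"
  shows "(\<lambda>n. l2_norm M (\<lambda>x. f x - s n x)) \<longlonglongrightarrow> 0"
proof -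
  have fw: "\<bar>f x\<bar> \<le> w x" if "x \<in> space M" for x
    by (rule LIMSEQ_le_const2[OF tendsto_rabs[OF lim[OF that]]]) (use bound[OF that] in auto)
  have "(\<lambda>n. LINT x|M. (norm (f x - s n x))\<^sup>2) \<longlonglongrightarrow> (LINT x|M. 0)"
  proof (rule integral_dominated_convergence)
    show "integrable M (\<lambda>x. 4 * (norm (w x))\<^sup>2)" using sq_integrable_integrable[OF w] by simp
    show "AE x in M. (\<lambda>n. (norm (f x - s n x))\<^sup>2) \<longlonglongrightarrow> 0"
    proof (rule AE_I2)
      fix x assume "x \<in> space M"
      from tendsto_power[OF tendsto_norm[OF tendsto_diff[OF tendsto_const[of "f x"] lim[OF this]]], of 2]
      show "(\<lambda>n. (norm (f x - s n x))\<^sup>2) \<longlonglongrightarrow> 0" by simp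
    qed
    show "AE x in M. norm ((norm (f x - s n x))\<^sup>2) \<le> 4 * (norm (w x))\<^sup>2" for n
    proof (rule AE_I2)
      fix x assume x: "x \<in> space M"
      have "\<bar>f x - s n x\<bar>\<^sup>2 \<le> (2 * w x)\<^sup>2"
        using fw[OF x] bound[OF x, of n] by (intro power_mono) auto
      then show "norm ((norm (f x - s n x))\<^sup>2) \<le> 4 * (norm (w x))\<^sup>2" by (simp add: power_mult_distrib)
    qed
  qed auto
  then have "(\<lambda>n. sqrt (LINT x|M. (norm (f x - s n x))\<^sup>2)) \<longlonglongrightarrow> sqrt 0"
    by (intro tendsto_real_sqrt) simp
  then show ?thesis by (simp add: l2_norm_def)
qed

definition poly_approximable :: "('a::euclidean_space) measure \<Rightarrow> ('a \<Rightarrow> real) \<Rightarrow> bool" where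
  "poly_approximable M f \<longleftrightarrow> f \<in> sq_integrable M \<and>
     (\<forall>e>0. \<exists>p. real_polynomial_function p \<and> p \<in> sq_integrable M \<and> l2_norm M (\<lambda>x. f x - p x) < e)"

lemma poly_approximable_add:
  assumes "poly_approximable M f" "poly_approximable M g"
  shows "poly_approximable M (\<lambda>x. f x + g x)"
  unfolding poly_approximable_def
proof (intro conjI allI impI)
  show "(\<lambda>x. f x + g x) \<in> sq_integrable M"
    using assms by (auto simp: poly_approximable_def intro: sq_integrable_add)
  fix e :: real assume "e > 0"
  then obtain p q where p: "real_polynomial_function p" "p \<in> sq_integrable M" "l2_norm M (\<lambda>x. f x - p x) < e/2"
    and q: "real_polynomial_function q" "q \<in> sq_integrable M" "l2_norm M (\<lambda>x. g x - q x) < e/2"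
    using assms unfolding poly_approximable_def by (meson half_gt_zero)
  have "l2_norm M (\<lambda>x. (f x - p x) + (g x - q x)) \<le> l2_norm M (\<lambda>x. f x - p x) + l2_norm M (\<lambda>x. g x - q x)"
    using assms p q by (intro l2_norm_triangle sq_integrable_diff) (auto simp: poly_approximable_def)
  then have "l2_norm M (\<lambda>x. (f x + g x) - (p x + q x)) < e"
    using p(3) q(3) by (simp add: algebra_simps)
  then show "\<exists>p. real_polynomial_function p \<and> p \<in> sq_integrable M \<and> l2_norm M (\<lambda>x. f x + g x - p x) < e"
    using p q by (intro exI[of _ "\<lambda>x. p x + q x"]) (auto intro: sq_integrable_add real_polynomial_function.intros)
qed

lemma poly_approximable_closed:
  assumes f: "f \<in> sq_integrable M"
    and ap: "\<And>e. e > 0 \<Longrightarrow> \<exists>g. poly_approximable M g \<and> l2_norm M (\<lambda>x. f x - g x) < e"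
  shows "poly_approximable M f"
  unfolding poly_approximable_def
proof (intro conjI allI impI f)
  fix e :: real assume "e > 0"
  then obtain g where g: "poly_approximable M g" "l2_norm M (\<lambda>x. f x - g x) < e/2"
    using ap by (meson half_gt_zero)
  then obtain p where p: "real_polynomial_function p" "p \<in> sq_integrable M" "l2_norm M (\<lambda>x. g x - p x) < e/2"
    using \<open>e > 0\<close> unfolding poly_approximable_def by (meson half_gt_zero)
  have "l2_norm M (\<lambda>x. (f x - g x) + (g x - p x)) \<le> l2_norm M (\<lambda>x. f x - g x) + l2_norm M (\<lambda>x. g x - p x)"
    using f g p by (intro l2_norm_triangle sq_integrable_diff) (auto simp: poly_approximable_def)
  then show "\<exists>p. real_polynomial_function p \<and> p \<in> sq_integrable M \<and> l2_norm M (\<lambda>x. f x - p x) < e"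
    using p g by (intro exI[of _ p]) auto
qed

lemma poly_approximable_limit:
  assumes "f \<in> sq_integrable M" "\<And>n::nat. poly_approximable M (s n)"
    and "(\<lambda>n. l2_norm M (\<lambda>x. f x - s n x)) \<longlonglongrightarrow> 0"
  shows "poly_approximable M f"
proof (rule poly_approximable_closed[OF assms(1)])
  fix e :: real assume "e > 0"
  then obtain n where "norm (l2_norm M (\<lambda>x. f x - s n x) - 0) < e"
    using LIMSEQ_D[OF assms(3)] by blast
  then show "\<exists>g. poly_approximable M g \<and> l2_norm M (\<lambda>x. f x - g x) < e" using assms(2) by auto
qed

lemma poly_approximable_cmult:
  assumes "poly_approximable M f"
  shows "poly_approximable M (\<lambda>x. c * f x)"
  unfolding poly_approximable_def
proof (intro conjI allI impI)
  show "(\<lambda>x. c * f x) \<in> sq_integrable M"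
    using assms by (auto simp: poly_approximable_def intro: sq_integrable_cmult)
  fix e :: real assume "e > 0"
  then have "e / (\<bar>c\<bar> + 1) > 0" by simp
  then obtain p where p: "real_polynomial_function p" "p \<in> sq_integrable M" "l2_norm M (\<lambda>x. f x - p x) < e / (\<bar>c\<bar> + 1)"
    using assms unfolding poly_approximable_def by meson
  have "l2_norm M (\<lambda>x. c * f x - c * p x) = \<bar>c\<bar> * l2_norm M (\<lambda>x. f x - p x)"
    using l2_norm_scaleR[of M c "\<lambda>x. f x - p x"] by (simp add: right_diff_distrib)
  also have "\<dots> \<le> (\<bar>c\<bar> + 1) * l2_norm M (\<lambda>x. f x - p x)" by (intro mult_right_mono) auto
  also have "\<dots> < e" using p(3) by (simp add: field_simps)
  finally show "\<exists>p. real_polynomial_function p \<and> p \<in> sq_integrable M \<and> l2_norm M (\<lambda>x. c * f x - p x) < e"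
    using p by (intro exI[of _ "\<lambda>x. c * p x"]) (auto intro: sq_integrable_cmult real_polynomial_function.intros)
qed

lemma poly_approximable_sum:
  assumes "finite I" "\<And>i. i \<in> I \<Longrightarrow> poly_approximable M (f i)"
  shows "poly_approximable M (\<lambda>x. \<Sum>i\<in>I. f i x)"
  using assms
proof (induction I rule: finite_induct)
  case empty
  have "poly_approximable M (\<lambda>x. 0)"
    unfolding poly_approximable_def
    by (auto intro!: exI[of _ "\<lambda>x. 0"] real_polynomial_function.intros)
  then show ?case by simp
next
  case (insert i I)
  then show ?case by (auto intro: poly_approximable_add)
qed

locale finite_measure_on_compact = finite_measure M
  for M :: "'a::euclidean_space measure" +
  fixes S :: "'a set"
  assumes sets_M: "sets M = sets (restrict_space borel S)"
    and compact_S: "compact S"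
begin

lemma space_M: "space M = S"
  using sets_eq_imp_space_eq[OF sets_M] by (simp add: space_restrict_space)

lemma borel_measurable_restrict: "f \<in> borel_measurable borel \<Longrightarrow> f \<in> borel_measurable M"
  by (subst measurable_cong_sets[OF sets_M refl]) (rule measurable_restrict_space1)

lemma sq_integrable_continuous:
  assumes "continuous_on UNIV (f :: 'a \<Rightarrow> 'b::{real_normed_vector, second_countable_topology})"
  shows "f \<in> sq_integrable M"
proof -
  have "compact (f ` S)"
    using assms compact_S by (intro compact_continuous_image) (auto intro: continuous_on_subset)
  then obtain B where "\<forall>y\<in>f ` S. norm y \<le> B" using compact_imp_bounded bounded_iff by blast
  then show ?thesis
    using assms finite_measure_axioms
    by (intro sq_integrable_bounded[of _ _ B] borel_measurable_restrict borel_measurable_continuous_onI)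
      (auto simp: space_M)
qed

lemma sq_integrable_polynomial: "real_polynomial_function p \<Longrightarrow> p \<in> sq_integrable M"
  by (intro sq_integrable_continuous) (simp add: continuous_on_polymonial_function real_polynomial_function_eq)

lemma poly_approximable_continuous:
  assumes f: "continuous_on UNIV f"
  shows "poly_approximable M f"
  unfolding poly_approximable_def
proof (intro conjI allI impI sq_integrable_continuous f)
  fix e :: real assume "e > 0"
  \<comment> \<open>The summand \<open>1\<close> keeps the denominator positive if the measure is zero.\<close>
  define d where "d = e / (sqrt (measure M (space M)) + 1)"
  have "d > 0" unfolding d_def using \<open>e > 0\<close> by (intro divide_pos_pos add_nonneg_pos) auto
  then obtain p where p: "real_polynomial_function p" and pd: "\<And>x. x \<in> S \<Longrightarrow> \<bar>f x - p x\<bar> < d"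
    using Stone_Weierstrass_real_polynomial_function[OF compact_S continuous_on_subset[OF f]] by blast
  have "(l2_norm M (\<lambda>x. f x - p x))\<^sup>2 = (LINT x|M. (norm (f x - p x))\<^sup>2)" by (simp add: l2_norm_power2)
  also have "\<dots> \<le> (LINT x|M. d\<^sup>2)"
  proof (rule integral_mono)
    show "integrable M (\<lambda>x. (norm (f x - p x))\<^sup>2)"
      using sq_integrable_diff[OF sq_integrable_continuous[OF f] sq_integrable_polynomial[OF p]]
      by (rule sq_integrable_integrable)
    show "(norm (f x - p x))\<^sup>2 \<le> d\<^sup>2" if "x \<in> space M" for x
      using pd[of x] that by (intro power_mono) (auto simp: space_M)
  qed simp
  also have "\<dots> = (d * sqrt (measure M (space M)))\<^sup>2" by (simp add: power_mult_distrib)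
  finally have "l2_norm M (\<lambda>x. f x - p x) \<le> d * sqrt (measure M (space M))"
    by (rule power2_le_imp_le) (use \<open>d > 0\<close> in simp)
  also have "\<dots> < d * (sqrt (measure M (space M)) + 1)" using \<open>d > 0\<close> by simp
  also have "\<dots> = e" unfolding d_def
    using add_nonneg_pos[of "sqrt (measure M (space M))" 1] by (simp add: field_simps)
  finally show "\<exists>p. real_polynomial_function p \<and> p \<in> sq_integrable M \<and> l2_norm M (\<lambda>x. f x - p x) < e"
    using p sq_integrable_polynomial by blast
qed

lemma sq_integrable_indicator: "A \<in> sets borel \<Longrightarrow> indicat_real A \<in> sq_integrable M"
  by (rule sq_integrable_bounded[of _ _ 1])
    (auto intro!: borel_measurable_restrict finite_measure_axioms simp: indicator_def)

text \<open>The indicator of a closed set is a bounded pointwise limit of continuous functions, and continuous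
  functions are uniform limits of polynomials by Stone--Weierstrass.\<close>

lemma poly_approximable_closed_set:
  assumes "closed F"
  shows "poly_approximable M (indicat_real F)"
proof (cases "F = {}")
  case True
  have "poly_approximable M (\<lambda>x. 0)" by (rule poly_approximable_continuous) auto
  also have "(\<lambda>x. 0) = indicat_real F" using True by (auto simp: indicator_def)
  finally show ?thesis .
next
  case False
  define s where "s n x = max 0 (1 - real n * setdist {x} F)" for n :: nat and x
  have cont: "continuous_on UNIV (s n)" for n
    unfolding s_def by (intro continuous_intros continuous_on_setdist)
  have lim: "(\<lambda>n. s n x) \<longlonglongrightarrow> indicat_real F x" for x
  proof (cases "x \<in> F")
    case True
    then show ?thesis by (simp add: s_def setdist_sing_in_set)
  next
    case False
    then have pos: "setdist {x} F > 0"
      using setdist_pos_le[of "{x}" F] setdist_eq_0_sing_1[of x F] \<open>F \<noteq> {}\<close> assms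
      by (simp add: order_less_le) 
    obtain N :: nat where N: "real N * setdist {x} F \<ge> 1"
      using reals_Archimedean3[OF pos] less_imp_le by blast
    have "s n x = 0" if "n \<ge> N" for n
    proof -
      have "real N * setdist {x} F \<le> real n * setdist {x} F" using that pos by (intro mult_right_mono) auto
      then show ?thesis using N by (simp add: s_def)
    qed
    then have "\<forall>\<^sub>F n in sequentially. s n x = 0" by (auto simp: eventually_sequentially)
    then show ?thesis using False by (simp add: tendsto_eventually)
  qed
  have bound: "\<bar>s n x\<bar> \<le> 1" for n x
    using setdist_pos_le[of "{x}" F] by (simp add: s_def)
  show ?thesis
  proof (rule poly_approximable_limit[where s = s])
    show "indicat_real F \<in> sq_integrable M" using assms by (intro sq_integrable_indicator) auto
    show "poly_approximable M (s n)" for n by (intro poly_approximable_continuous cont)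
    show "(\<lambda>n. l2_norm M (\<lambda>x. indicat_real F x - s n x)) \<longlonglongrightarrow> 0"
    proof (rule l2_norm_dominated_convergence[where w = "\<lambda>_. 1"])
      show "indicat_real F \<in> borel_measurable M"
        using assms by (intro borel_measurable_restrict) auto
    qed (use bound lim in \<open>auto intro!: sq_integrable_continuous borel_measurable_restrict borel_measurable_continuous_onI cont\<close>)
  qed
qed

text \<open>The closed sets generate the Borel sets and are stable under intersection, so it suffices to pass to
  complements and to countable disjoint unions.\<close>

lemma poly_approximable_borel_set:
  assumes "A \<in> sets borel"
  shows "poly_approximable M (indicat_real A)"
proof -
  have "Int_stable (Collect (closed :: 'a set \<Rightarrow> bool))" "Collect closed \<subseteq> Pow UNIV"
    by (auto simp: Int_stable_def intro: closed_Int)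
  moreover have "A \<in> sigma_sets UNIV (Collect closed)"
    using assms unfolding borel_eq_closed by simp
  ultimately show ?thesis
  proof (induction rule: sigma_sets_induct_disjoint)
    case (basic A) then show ?case by (simp add: poly_approximable_closed_set)
  next
    case empty show ?case by (rule poly_approximable_closed_set[OF closed_empty])
  next
    case (compl A)
    have "poly_approximable M (\<lambda>x. 1 + (-1) * indicat_real A x)"
      by (rule poly_approximable_add[OF poly_approximable_continuous
            poly_approximable_cmult[OF compl(2)]]) simp
    also have "(\<lambda>x. 1 + (-1) * indicat_real A x) = indicat_real (UNIV - A)" by (auto simp: indicator_def)
    finally show ?case .
  next
    case (union A)
    have A: "A i \<in> sets borel" for i using union(2) by (auto simp: borel_eq_closed)
    define s where "s n x = (\<Sum>i<n. indicat_real (A i) x)" for n x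
    have s_eq: "s n x = indicat_real (\<Union>i<n. A i) x" for n x
      unfolding s_def using union(1)
      by (intro indicator_UN_disjoint[symmetric]) (auto simp: disjoint_family_on_def)
    show ?case
    proof (rule poly_approximable_limit[where s = s])
      show "indicat_real (\<Union> (range A)) \<in> sq_integrable M" using A by (intro sq_integrable_indicator) auto
      show "poly_approximable M (s n)" for n
        unfolding s_def using union(3) by (intro poly_approximable_sum) auto
      show "(\<lambda>n. l2_norm M (\<lambda>x. indicat_real (\<Union> (range A)) x - s n x)) \<longlonglongrightarrow> 0"
      proof (rule l2_norm_dominated_convergence[where w = "\<lambda>_. 1"])
        show "(\<lambda>n. s n x) \<longlonglongrightarrow> indicat_real (\<Union> (range A)) x" for x
          unfolding s_eq by (rule LIMSEQ_indicator_UN)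
        show "indicat_real (\<Union> (range A)) \<in> borel_measurable M" "s n \<in> borel_measurable M" for n
          using A unfolding s_def
          by (auto intro!: borel_measurable_restrict)
      qed (auto intro!: sq_integrable_continuous simp: s_eq indicator_def)
    qed
  qed
qed

theorem poly_approximable_sq_integrable:
  assumes f: "f \<in> sq_integrable M"
  shows "poly_approximable M f"
proof -
  note [measurable] = sq_integrable_measurable[OF f]
  obtain s where s: "\<And>i. simple_function M (s i)"
    and lim: "\<And>x. x \<in> space M \<Longrightarrow> (\<lambda>i. s i x) \<longlonglongrightarrow> f x"
    and bound: "\<And>i x. x \<in> space M \<Longrightarrow> \<bar>s i x\<bar> \<le> 2 * \<bar>f x\<bar>"
    using borel_measurable_implies_sequence_metric[of f M 0, OF sq_integrable_measurable[OF f]]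
    by (simp add: dist_real_def) metis
  note [measurable] = borel_measurable_simple_function[OF s]
  have f2: "(\<lambda>x. 2 * \<bar>f x\<bar>) \<in> sq_integrable M"
    using f sq_integrable_integrable[OF f] by (simp add: sq_integrable_def power_mult_distrib)
  have "poly_approximable M (s n)" for n
  proof -
    have fin: "finite (s n ` space M)" using s[of n] by (auto simp: simple_function_def)
    have "poly_approximable M (\<lambda>x. \<Sum>y\<in>s n ` space M. y * indicat_real (s n -` {y} \<inter> space M) x)"
    proof (intro poly_approximable_sum fin poly_approximable_cmult)
      fix y
      have "s n -` {y} \<inter> space M \<in> sets M" using s[of n] by (auto simp: simple_function_def)
      then have "s n -` {y} \<inter> space M \<in> sets (restrict_space borel S)" by (simp add: sets_M)
      then have "s n -` {y} \<inter> space M \<in> sets borel"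
        using compact_imp_closed[OF compact_S] by (subst (asm) sets_restrict_space_iff) auto
      then show "poly_approximable M (indicat_real (s n -` {y} \<inter> space M))"
        by (rule poly_approximable_borel_set)
    qed
    moreover have "(\<Sum>y\<in>s n ` space M. y * indicat_real (s n -` {y} \<inter> space M) x) = s n x"
      if "x \<in> space M" for x
    proof -
      have "(\<Sum>y\<in>s n ` space M. y * indicat_real (s n -` {y} \<inter> space M) x)
          = (\<Sum>y\<in>{s n x}. y * indicat_real (s n -` {y} \<inter> space M) x)"
        using that fin by (intro sum.mono_neutral_right) (auto simp: indicator_def)
      then show ?thesis using that by simp
    qed
    ultimately show ?thesis
      unfolding poly_approximable_def sq_integrable_def l2_norm_def
      by (simp cong: measurable_cong Bochner_Integration.integral_cong Bochner_Integration.integrable_cong)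
  qed
  moreover have "(\<lambda>n. l2_norm M (\<lambda>x. f x - s n x)) \<longlonglongrightarrow> 0"
    using lim bound by (intro l2_norm_dominated_convergence[OF f2]) auto
  ultimately show ?thesis using poly_approximable_limit[OF f] by blast
qed

text \<open>Testing \<open>f\<close> against a polynomial close to \<open>f\<close> itself bounds the norm of that polynomial and hence of
  \<open>f\<close>. The Poincare inequality and the uniqueness of weak gradients are thereby reduced to test
  functions that are polynomials.\<close>

lemma l2_norm_le_by_polynomials:
  fixes f :: "'a \<Rightarrow> real"
  assumes f: "f \<in> sq_integrable M" and "K \<ge> 0"
    and K: "\<And>p. real_polynomial_function p \<Longrightarrow> (LINT x|M. f x * p x) \<le> K * l2_norm M p"
  shows "l2_norm M f \<le> K"
proof (rule field_le_epsilon)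
  fix e :: real assume "e > 0"
  then obtain p where p: "real_polynomial_function p" and pe: "l2_norm M (\<lambda>x. f x - p x) < e / 2"
    using poly_approximable_sq_integrable[OF f] unfolding poly_approximable_def by (meson half_gt_zero)
  note p_sq = sq_integrable_polynomial[OF p]
  define n where "n = l2_norm M p"
  have fp: "l2_norm M f \<le> n + e / 2"
    using l2_norm_triangle_diff[OF f p_sq] pe unfolding n_def by linarith
  have "n\<^sup>2 = (LINT x|M. p x * p x)"
    unfolding n_def l2_norm_power2 by (simp add: power2_eq_square)
  also have "\<dots> = (LINT x|M. f x * p x - (f x - p x) * p x)" by (simp add: algebra_simps)
  also have "\<dots> = (LINT x|M. f x * p x) - (LINT x|M. (f x - p x) * p x)"
    using f p_sq by (intro Bochner_Integration.integral_diff integrable_mult_sq_integrable sq_integrable_diff)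
  also have "\<dots> \<le> K * n + e / 2 * n"
  proof -
    have "\<bar>LINT x|M. (f x - p x) * p x\<bar> \<le> l2_norm M (\<lambda>x. f x - p x) * n"
      unfolding n_def using f p_sq by (intro l2_norm_cauchy_schwarz_real sq_integrable_diff)
    also have "\<dots> \<le> e / 2 * n" using pe by (intro mult_right_mono) (auto simp: n_def)
    finally show ?thesis using K[OF p] by (simp add: n_def)
  qed
  finally have "n * n \<le> (K + e / 2) * n" by (simp add: power2_eq_square algebra_simps)
  then have "n \<le> K + e / 2"
    using \<open>K \<ge> 0\<close> \<open>e > 0\<close> by (cases "n = 0") (auto simp: n_def order_less_le)
  then show "l2_norm M f \<le> K + e" using fp by simp
qed

lemma AE_zero_by_polynomials:
  fixes f :: "'a \<Rightarrow> real"
  assumes f: "f \<in> sq_integrable M"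
    and K: "\<And>p. real_polynomial_function p \<Longrightarrow> (LINT x|M. f x * p x) = 0"
  shows "AE x in M. f x = 0"
proof (rule l2_norm_eq_0_AE[OF f])
  have "l2_norm M f \<le> 0" by (rule l2_norm_le_by_polynomials[OF f]) (simp_all add: K)
  then show "l2_norm M f = 0" using l2_norm_nonneg[of M f] by linarith
qed

end

section \<open>Riesz representation by minimisation\<close>

text \<open>A Hilbert space carried by a set of functions. The form is only semidefinite: two functions that agree
  almost everywhere are not equal, so the kernel of the form need not be trivial.\<close>

locale complete_form =
  fixes V :: "('a \<Rightarrow> real) set" and B :: "('a \<Rightarrow> real) \<Rightarrow> ('a \<Rightarrow> real) \<Rightarrow> real"
  assumes zero_mem: "(\<lambda>_. 0) \<in> V"
    and combination_mem: "\<And>v w c. v \<in> V \<Longrightarrow> w \<in> V \<Longrightarrow> (\<lambda>x. v x + c * w x) \<in> V"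
    and form_commute: "\<And>v w. v \<in> V \<Longrightarrow> w \<in> V \<Longrightarrow> B v w = B w v"
    and form_combination: "\<And>u v w c. u \<in> V \<Longrightarrow> v \<in> V \<Longrightarrow> w \<in> V \<Longrightarrow>
          B (\<lambda>x. v x + c * w x) u = B v u + c * B w u"
    and form_nonneg: "\<And>v. v \<in> V \<Longrightarrow> 0 \<le> B v v"
    and form_complete: "\<And>s. (\<And>n::nat. s n \<in> V) \<Longrightarrow>
          (\<And>e. e > 0 \<Longrightarrow> \<exists>N. \<forall>m\<ge>N. \<forall>n\<ge>N. B (\<lambda>x. s m x - s n x) (\<lambda>x. s m x - s n x) < e) \<Longrightarrow>
          \<exists>u\<in>V. (\<lambda>n. B (\<lambda>x. s n x - u x) (\<lambda>x. s n x - u x)) \<longlonglongrightarrow> 0"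
begin

lemma diff_mem: "v \<in> V \<Longrightarrow> w \<in> V \<Longrightarrow> (\<lambda>x. v x - w x) \<in> V"
  using combination_mem[of v w "-1"] by simp

lemma form_quadratic:
  assumes "v \<in> V" "w \<in> V"
  shows "B (\<lambda>x. v x + c * w x) (\<lambda>x. v x + c * w x) = B v v + 2 * c * B v w + c\<^sup>2 * B w w"
proof -
  let ?z = "\<lambda>x. v x + c * w x"
  have z: "?z \<in> V" using assms by (rule combination_mem)
  have "B ?z ?z = B v ?z + c * B w ?z" using assms z by (intro form_combination)
  also have "B v ?z = B v v + c * B w v"
    using assms z form_commute[of v ?z] form_combination[of v v w c] by simp
  also have "B w ?z = B v w + c * B w w"
    using assms z form_commute[of w ?z] form_combination[of w v w c] by simp
  finally show ?thesis
    using form_commute[OF assms] by (simp add: algebra_simps power2_eq_square)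
qed

lemma form_cauchy_schwarz:
  assumes "v \<in> V" "w \<in> V"
  shows "(B v w)\<^sup>2 \<le> B v v * B w w"
proof (rule quadratic_nonneg_discriminant)
  show "0 \<le> B v v + 2 * t * B v w + t\<^sup>2 * B w w" for t
    using form_nonneg[OF combination_mem[OF assms, of t]] by (simp add: form_quadratic[OF assms])
qed (use assms form_nonneg in simp)

text \<open>By the parallelogram law a minimising sequence of \<open>B v v - 2 L v\<close> is a Cauchy sequence. Since its
  members are almost minimal, \<open>(B (s n) v - L v)\<^sup>2 \<le> B v v / (n + 1)\<close> for every \<open>v\<close>, and the limit represents \<open>L\<close>.\<close>

theorem riesz_representation:
  assumes L_lin: "\<And>v w c. v \<in> V \<Longrightarrow> w \<in> V \<Longrightarrow> L (\<lambda>x. v x + c * w x) = L v + c * L w"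
    and L_bound: "\<And>v. v \<in> V \<Longrightarrow> \<bar>L v\<bar> \<le> C * sqrt (B v v)"
  shows "\<exists>u\<in>V. \<forall>v\<in>V. B u v = L v"
proof -
  define J where "J v = B v v - 2 * L v" for v
  define j where "j = Inf (J ` V)"
  have J_ge: "J v \<ge> - C\<^sup>2" if "v \<in> V" for v
  proof -
    have "(sqrt (B v v))\<^sup>2 = B v v" using form_nonneg[OF that] by simp
    then have "0 \<le> B v v - 2 * (C * sqrt (B v v)) + C\<^sup>2"
      using zero_le_power2[of "sqrt (B v v) - C"] by (simp add: power2_diff algebra_simps)
    then show ?thesis using L_bound[OF that] by (simp add: J_def)
  qed
  have bdd: "bdd_below (J ` V)" using J_ge by (auto intro: bdd_belowI[of _ "- C\<^sup>2"])
  have j_le: "j \<le> J v" if "v \<in> V" for v unfolding j_def using bdd that by (intro cInf_lower) auto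
  have "\<exists>v\<in>V. J v < j + 1 / real (Suc n)" for n
  proof -
    have "Inf (J ` V) < j + 1 / real (Suc n)" by (simp add: j_def)
    then show ?thesis
      using cInf_lessD[of "J ` V" "j + 1 / real (Suc n)"] zero_mem by auto
  qed
  then obtain s where sV: "\<And>n. s n \<in> V" and sJ: "\<And>n. J (s n) < j + 1 / real (Suc n)" by metis
  have J_comb: "J (\<lambda>x. v x + c * w x) = J v + 2 * c * (B v w - L w) + c\<^sup>2 * B w w"
    if "v \<in> V" "w \<in> V" for v w c
    using that by (simp add: J_def form_quadratic L_lin algebra_simps)
  have diff_small: "B (\<lambda>x. s m x - s n x) (\<lambda>x. s m x - s n x) \<le> 2 / real (Suc m) + 2 / real (Suc n)"
    for m n
  proof -
    let ?d = "\<lambda>x. s m x - s n x"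
    have d: "?d \<in> V" using sV by (intro diff_mem)
    have 1: "J (s m) = J (s n) + 2 * (B (s n) ?d - L ?d) + B ?d ?d"
      using J_comb[OF sV[of n] d, of 1] by simp
    have "j \<le> J (\<lambda>x. s n x + 1/2 * ?d x)" using sV d by (intro j_le combination_mem)
    also have "\<dots> = J (s n) + (B (s n) ?d - L ?d) + B ?d ?d / 4"
      by (simp only: J_comb[OF sV d]) (simp add: power2_eq_square)
    finally have "j \<le> (J (s n) + J (s m)) / 2 - B ?d ?d / 4" using 1 by (simp add: field_simps)
    moreover have "b \<le> 2 * p + 2 * q"
      if "j \<le> (y + x) / 2 - b / 4" "x < j + p" "y < j + q" for b p q x y
      using that by argo
    ultimately have "B ?d ?d \<le> 2 * (1 / real (Suc m)) + 2 * (1 / real (Suc n))"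
      using sJ[of m] sJ[of n] by blast
    then show ?thesis by simp
  qed
  have cauchy: "\<exists>N. \<forall>m\<ge>N. \<forall>n\<ge>N. B (\<lambda>x. s m x - s n x) (\<lambda>x. s m x - s n x) < e" if "e > 0" for e
  proof -
    obtain N where N: "1 / real (Suc N) < e / 4" using reals_Archimedean[of "e/4"] \<open>e > 0\<close> by (auto simp: inverse_eq_divide)
    have le: "2 / real (Suc m) < e / 2" if "m \<ge> N" for m
    proof -
      have "1 / real (Suc m) \<le> 1 / real (Suc N)" using that by (intro divide_left_mono) auto
      then have "1 / real (Suc m) < e / 4" using N by linarith
      then show ?thesis by simp
    qed
    have "2 / real (Suc m) + 2 / real (Suc n) < e" if "m \<ge> N" "n \<ge> N" for m n
      using add_strict_mono[OF le[OF that(1)] le[OF that(2)]] by simp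
    then have "\<forall>m\<ge>N. \<forall>n\<ge>N. B (\<lambda>x. s m x - s n x) (\<lambda>x. s m x - s n x) < e"
      using le_less_trans[OF diff_small] by simp
    then show ?thesis ..
  qed
  have "\<exists>u\<in>V. (\<lambda>n. B (\<lambda>x. s n x - u x) (\<lambda>x. s n x - u x)) \<longlonglongrightarrow> 0"
  proof (rule form_complete)
    show "s n \<in> V" for n by (rule sV)
    show "\<exists>N. \<forall>m\<ge>N. \<forall>n\<ge>N. B (\<lambda>x. s m x - s n x) (\<lambda>x. s m x - s n x) < e" if "e > 0" for e
      using that by (rule cauchy)
  qed
  then obtain u where u: "u \<in> V" and lim: "(\<lambda>n. B (\<lambda>x. s n x - u x) (\<lambda>x. s n x - u x)) \<longlonglongrightarrow> 0"
    by (elim bexE)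
  have "B u v = L v" if v: "v \<in> V" for v
  proof -
    have 1: "(\<lambda>n. (B (s n) v - L v)\<^sup>2) \<longlonglongrightarrow> 0"
    proof (rule tendsto_sandwich[OF always_eventually always_eventually tendsto_const], safe)
      show "0 \<le> (B (s n) v - L v)\<^sup>2" for n by simp
      show "(B (s n) v - L v)\<^sup>2 \<le> 1 / real (Suc n) * B v v" for n
      proof (rule quadratic_nonneg_discriminant)
        fix t
        have "j \<le> J (\<lambda>x. s n x + t * v x)" using sV v by (intro j_le combination_mem)
        then show "0 \<le> 1 / real (Suc n) + 2 * t * (B (s n) v - L v) + t\<^sup>2 * B v v"
          using sJ[of n] by (simp add: J_comb[OF sV v])
      qed (rule form_nonneg[OF v])
      show "(\<lambda>n. 1 / real (Suc n) * B v v) \<longlonglongrightarrow> 0"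
        using tendsto_mult[OF LIMSEQ_inverse_real_of_nat tendsto_const[of "B v v"]]
        by (simp add: inverse_eq_divide)
    qed
    have 2: "(\<lambda>n. (B (s n) v - B u v)\<^sup>2) \<longlonglongrightarrow> 0"
    proof (rule tendsto_sandwich[OF always_eventually always_eventually tendsto_const], safe)
      show "0 \<le> (B (s n) v - B u v)\<^sup>2" for n by simp
      show "(B (s n) v - B u v)\<^sup>2 \<le> B (\<lambda>x. s n x - u x) (\<lambda>x. s n x - u x) * B v v" for n
        using form_cauchy_schwarz[OF diff_mem[OF sV u] v, of n] form_combination[OF v sV u, of n "-1"]
        by simp
      show "(\<lambda>n. B (\<lambda>x. s n x - u x) (\<lambda>x. s n x - u x) * B v v) \<longlonglongrightarrow> 0"
        using tendsto_mult[OF lim tendsto_const[of "B v v"]] by simp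
    qed
    have "(\<lambda>n. B (s n) v - L v) \<longlonglongrightarrow> 0" "(\<lambda>n. B (s n) v - B u v) \<longlonglongrightarrow> 0"
      using 1 2 by (auto simp: tendsto_null_power)
    from tendsto_diff[OF this] show ?thesis by (simp add: LIMSEQ_const_iff)
  qed
  then show ?thesis using u by blast
qed

end

section \<open>Joint laws from linear combinations\<close>

text \<open>After normalisation the weights are densities of probability measures whose images on the line have
  the same characteristic function; the phase \<open>\<theta>\<close> supplies both its real and its imaginary part.\<close>

lemma weighted_law_unique:
  fixes X :: "'a \<Rightarrow> real" and Y :: "'b \<Rightarrow> real"
  assumes "prob_space M" "prob_space N"
    and [measurable]: "X \<in> borel_measurable M" "W \<in> borel_measurable M"
      "Y \<in> borel_measurable N" "W' \<in> borel_measurable N"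
    and W: "\<And>x. 0 \<le> W x" "\<And>x. W x \<le> K" and W': "\<And>x. 0 \<le> W' x" "\<And>x. W' x \<le> K"
    and eq: "\<And>t \<theta>. (LINT x|M. W x * cos (t * X x + \<theta>)) = (LINT x|N. W' x * cos (t * Y x + \<theta>))"
    and B: "B \<in> sets borel"
  shows "(LINT x|M. W x * indicator B (X x)) = (LINT x|N. W' x * indicator B (Y x))"
proof -
  interpret M: prob_space M by fact
  interpret N: prob_space N by fact
  have intW: "integrable M W"
    using W by (intro M.integrable_const_bound[of _ K]) auto
  have intW': "integrable N W'"
    using W' by (intro N.integrable_const_bound[of _ K]) auto
  define m where "m = (LINT x|M. W x)"
  have m': "m = (LINT x|N. W' x)" using eq[of 0 0] by (simp add: m_def)
  show ?thesis
  proof (cases "m = 0")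
    case True
    have "AE x in M. W x = 0"
      using True integral_nonneg_eq_0_iff_AE[OF intW] W by (simp add: m_def)
    then have "(LINT x|M. W x * indicator B (X x)) = (LINT x|M. 0)"
      by (intro integral_cong_AE) (use B in auto)
    moreover have "AE x in N. W' x = 0"
      using True m' integral_nonneg_eq_0_iff_AE[OF intW'] W' by simp
    then have "(LINT x|N. W' x * indicator B (Y x)) = (LINT x|N. 0)"
      by (intro integral_cong_AE) (use B in auto)
    ultimately show ?thesis by simp
  next
    case False
    have "m > 0" using False W by (simp add: m_def order_less_le)
    define D where "D = density M (\<lambda>x. ennreal (W x / m))"
    define E where "E = density N (\<lambda>x. ennreal (W' x / m))"
    have "emeasure D (space D) = ennreal (LINT x|M. W x / m)"
      unfolding D_def using W \<open>m > 0\<close> intW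
      by (subst emeasure_density) (auto simp: nn_integral_eq_integral cong: nn_integral_cong)
    then have "prob_space D" using \<open>m > 0\<close> by (intro prob_spaceI) (simp add: m_def)
    have "emeasure E (space E) = ennreal (LINT x|N. W' x / m)"
      unfolding E_def using W' \<open>m > 0\<close> intW'
      by (subst emeasure_density) (auto simp: nn_integral_eq_integral cong: nn_integral_cong)
    then have "prob_space E" using \<open>m > 0\<close> by (intro prob_spaceI) (simp add: m')
    interpret D: prob_space D by fact
    interpret E: prob_space E by fact
    have [measurable]: "X \<in> borel_measurable D" "Y \<in> borel_measurable E" by (auto simp: D_def E_def)
    have intD: "(LINT x|D. f (X x)) = (LINT x|M. W x * f (X x)) / m"
      and intE: "(LINT x|E. f (Y x)) = (LINT x|N. W' x * f (Y x)) / m"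
      if [measurable]: "f \<in> borel_measurable borel" for f :: "real \<Rightarrow> real"
      unfolding D_def E_def using W W' \<open>m > 0\<close> by (subst integral_density; simp)+
    have char_eq: "char (distr D borel X) t = char (distr E borel Y) t" for t
    proof -
      have int: "integrable D (\<lambda>x. iexp (t * X x))" "integrable E (\<lambda>x. iexp (t * Y x))"
        using D.integrable_iexp[of "\<lambda>x. complex_of_real (t * X x)"]
          E.integrable_iexp[of "\<lambda>x. complex_of_real (t * Y x)"] by simp_all
      have Re: "Re (char (distr D borel X) t) = (LINT x|D. cos (t * X x))"
         "Re (char (distr E borel Y) t) = (LINT x|E. cos (t * Y x))"
        using int by (simp_all add: char_def integral_distr integral_Re[symmetric] Re_exp
            del: integral_Re)
      have Im: "Im (char (distr D borel X) t) = (LINT x|D. sin (t * X x))"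
         "Im (char (distr E borel Y) t) = (LINT x|E. sin (t * Y x))"
        using int by (simp_all add: char_def integral_distr integral_Im[symmetric] Im_exp
            del: integral_Im)
      have "sin z = cos (z + - (pi / 2))" for z :: real
        by (simp add: cos_diff)
      then have "Im (char (distr D borel X) t) = Im (char (distr E borel Y) t)"
        using Im intD[of "\<lambda>x. sin (t * x)"] intE[of "\<lambda>x. sin (t * x)"] eq[of t "- (pi / 2)"] by simp
      moreover have "Re (char (distr D borel X) t) = Re (char (distr E borel Y) t)"
        using Re intD[of "\<lambda>x. cos (t * x)"] intE[of "\<lambda>x. cos (t * x)"] eq[of t 0] by simp
      ultimately show ?thesis by (simp add: complex_eq_iff)
    qed
    have "distr D borel X = distr E borel Y"
      using char_eq by (intro Levy_uniqueness D.real_distribution_distr E.real_distribution_distr ext) auto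
    then have "(LINT x|distr D borel X. indicat_real B x) = (LINT x|distr E borel Y. indicat_real B x)"
      by simp
    then have "(LINT x|D. indicat_real B (X x)) = (LINT x|E. indicat_real B (Y x))"
      using B by (subst (asm) (1 2) integral_distr) auto
    then show ?thesis using intD[of "indicator B"] intE[of "indicator B"] B \<open>m > 0\<close> by simp
  qed
qed

lemma cos_one_plus_cos:
  "(1 + cos (s + \<theta>)) * cos (u + \<phi>)
     = cos (u + \<phi>) + cos (s + u + (\<theta> + \<phi>)) / 2 + cos (- s + u + (\<phi> - \<theta>)) / (2::real)"
proof -
  have "cos (s + \<theta>) * cos (u + \<phi>) = (cos ((s + \<theta>) - (u + \<phi>)) + cos ((s + \<theta>) + (u + \<phi>))) / 2"
    by (rule cos_times_cos)
  moreover have "cos ((s + \<theta>) - (u + \<phi>)) = cos (- s + u + (\<phi> - \<theta>))"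
    using cos_minus[of "(s + \<theta>) - (u + \<phi>)"] by (simp add: algebra_simps)
  ultimately show ?thesis by (simp add: algebra_simps)
qed

text \<open>The Cramer--Wold device. The coordinates are confined to their Borel sets one at a time. If those in
  \<open>G\<close> are confined, the product of their indicators with \<open>1 + cos (S + \<theta>)\<close>, where \<open>S\<close> is a linear
  combination of all coordinates, is a nonnegative weight. By the product-to-sum formula its
  characteristic function with respect to another coordinate \<open>j\<close> consists of expectations that the
  induction hypothesis covers, so uniqueness on the line confines the coordinate \<open>j\<close> as well. Positivity
  of the weight is the reason for the summand \<open>1\<close>, whose contribution is subtracted at the end.\<close>

theorem cramer_wold_rectangles:
  fixes X :: "'i \<Rightarrow> 'a \<Rightarrow> real" and Y :: "'i \<Rightarrow> 'b \<Rightarrow> real"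
  assumes "prob_space M" "prob_space N" and "finite I"
    and [measurable]: "\<And>i. i \<in> I \<Longrightarrow> X i \<in> borel_measurable M" "\<And>i. i \<in> I \<Longrightarrow> Y i \<in> borel_measurable N"
    and eq: "\<And>c \<theta>. (LINT x|M. cos ((\<Sum>i\<in>I. c i * X i x) + \<theta>))
                = (LINT x|N. cos ((\<Sum>i\<in>I. c i * Y i x) + \<theta>))"
    and [measurable]: "\<And>i. i \<in> I \<Longrightarrow> B i \<in> sets borel"
  shows "measure M {x \<in> space M. \<forall>i\<in>I. X i x \<in> B i} = measure N {x \<in> space N. \<forall>i\<in>I. Y i x \<in> B i}"
proof -
  interpret M: prob_space M by fact
  interpret N: prob_space N by fact
  have main: "(LINT x|M. (\<Prod>i\<in>G. indicat_real (B i) (X i x)) * cos ((\<Sum>i\<in>I. c i * X i x) + \<theta>))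
            = (LINT x|N. (\<Prod>i\<in>G. indicat_real (B i) (Y i x)) * cos ((\<Sum>i\<in>I. c i * Y i x) + \<theta>))"
    if "finite G" "G \<subseteq> I" for G c \<theta>
    using that
  proof (induction G arbitrary: c \<theta> rule: finite_induct)
    case empty
    then show ?case using eq by simp
  next
    case (insert j G)
    then have "j \<in> I" "G \<subseteq> I" by auto
    define f where "f x = (\<Prod>i\<in>G. indicat_real (B i) (X i x))" for x
    define g where "g x = (\<Prod>i\<in>G. indicat_real (B i) (Y i x))" for x
    define S where "S c x = (\<Sum>i\<in>I. c i * X i x)" for c x
    define R where "R c x = (\<Sum>i\<in>I. c i * Y i x)" for c x
    have [measurable]: "f \<in> borel_measurable M" "g \<in> borel_measurable N"
      using \<open>G \<subseteq> I\<close> unfolding f_def g_def by (auto intro!: borel_measurable_prod)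
    have [measurable]: "S c \<in> borel_measurable M" "R c \<in> borel_measurable N" for c
      unfolding S_def R_def by (auto intro!: borel_measurable_sum)
    have [measurable]: "X j \<in> borel_measurable M" "Y j \<in> borel_measurable N" "B j \<in> sets borel"
      using \<open>j \<in> I\<close> by auto
    have f01: "0 \<le> f x" "f x \<le> 1" and g01: "0 \<le> g y" "g y \<le> 1" for x y
      unfolding f_def g_def by (auto intro!: prod_nonneg prod_le_1 simp: indicator_def)
    have int: "integrable M (\<lambda>x. f x * cos (h x))" if "h \<in> borel_measurable M" for h
      using that f01 by (intro M.integrable_const_bound[of _ 1]) (auto simp: abs_mult intro!: mult_le_one)
    have int': "integrable N (\<lambda>x. g x * cos (h x))" if "h \<in> borel_measurable N" for h
      using that g01 by (intro N.integrable_const_bound[of _ 1]) (auto simp: abs_mult intro!: mult_le_one)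
    have IH: "(LINT x|M. f x * cos (S c x + \<theta>)) = (LINT x|N. g x * cos (R c x + \<theta>))" for c \<theta>
      using insert.IH[OF \<open>G \<subseteq> I\<close>] by (simp add: f_def g_def S_def R_def)
    have S_upd: "S (\<lambda>i. a * c i + (if i = j then t else 0)) x = a * S c x + t * X j x"
      and R_upd: "R (\<lambda>i. a * c i + (if i = j then t else 0)) y = a * R c y + t * Y j y" for a c t x y
      using \<open>j \<in> I\<close> \<open>finite I\<close>
      by (simp_all add: S_def R_def distrib_right sum.distrib sum_distrib_left mult.assoc if_distrib[of "\<lambda>z. z * _"]
          sum.delta cong: if_cong)
    have step: "(LINT x|M. f x * (1 + cos (S c x + \<theta>)) * indicator (B j) (X j x))
        = (LINT x|N. g x * (1 + cos (R c x + \<theta>)) * indicator (B j) (Y j x))" for c \<theta>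
    proof (rule weighted_law_unique[OF \<open>prob_space M\<close> \<open>prob_space N\<close>, where K = 2])
      have cos1: "0 \<le> 1 + cos z" "1 + cos z \<le> 2" for z :: real
        using cos_ge_minus_one[of z] cos_le_one[of z] by linarith+
      show "0 \<le> f x * (1 + cos (S c x + \<theta>))" "0 \<le> g y * (1 + cos (R c y + \<theta>))" for x y
        using f01 g01 cos1 by simp_all
      show "f x * (1 + cos (S c x + \<theta>)) \<le> 2" "g y * (1 + cos (R c y + \<theta>)) \<le> 2" for x y
        using mult_mono[OF f01(2) cos1(2)] mult_mono[OF g01(2) cos1(2)] cos1 by simp_all
      fix t \<phi>
      have "(LINT x|M. f x * (1 + cos (S c x + \<theta>)) * cos (t * X j x + \<phi>))
         = (LINT x|M. f x * cos (0 * S c x + t * X j x + \<phi>)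
              + (f x * cos (1 * S c x + t * X j x + (\<theta> + \<phi>))) / 2
              + (f x * cos ((-1) * S c x + t * X j x + (\<phi> - \<theta>))) / 2)"
        by (intro Bochner_Integration.integral_cong refl)
          (simp only: mult.assoc cos_one_plus_cos, simp add: distrib_left)
      also have "\<dots> = (LINT x|M. f x * cos (0 * S c x + t * X j x + \<phi>))
              + (LINT x|M. f x * cos (1 * S c x + t * X j x + (\<theta> + \<phi>))) / 2
              + (LINT x|M. f x * cos ((-1) * S c x + t * X j x + (\<phi> - \<theta>))) / 2"
        by (simp add: int)
      also have "\<dots> = (LINT x|N. g x * cos (0 * R c x + t * Y j x + \<phi>))
              + (LINT x|N. g x * cos (1 * R c x + t * Y j x + (\<theta> + \<phi>))) / 2
              + (LINT x|N. g x * cos ((-1) * R c x + t * Y j x + (\<phi> - \<theta>))) / 2"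
        unfolding S_upd[symmetric] R_upd[symmetric] IH ..
      also have "\<dots> = (LINT x|N. g x * cos (0 * R c x + t * Y j x + \<phi>)
              + (g x * cos (1 * R c x + t * Y j x + (\<theta> + \<phi>))) / 2
              + (g x * cos ((-1) * R c x + t * Y j x + (\<phi> - \<theta>))) / 2)"
        by (simp add: int')
      also have "\<dots> = (LINT x|N. g x * (1 + cos (R c x + \<theta>)) * cos (t * Y j x + \<phi>))"
        by (intro Bochner_Integration.integral_cong refl)
          (simp only: mult.assoc cos_one_plus_cos, simp add: distrib_left)
      finally show "(LINT x|M. f x * (1 + cos (S c x + \<theta>)) * cos (t * X j x + \<phi>))
          = (LINT x|N. g x * (1 + cos (R c x + \<theta>)) * cos (t * Y j x + \<phi>))" .
    qed (simp_all)
    let ?f = "\<lambda>x. f x * indicat_real (B j) (X j x)" and ?g = "\<lambda>x. g x * indicat_real (B j) (Y j x)"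
    have f01': "0 \<le> ?f x" "?f x \<le> 1" and g01': "0 \<le> ?g y" "?g y \<le> 1" for x y
      using f01 g01 by (auto simp: indicator_def)
    have bound: "norm (?f x * cos z) \<le> 1" "norm (?g y * cos z) \<le> 1" for x y z
      using mult_mono[OF f01'(2)[of x] abs_cos_le_one[of z]] mult_mono[OF g01'(2)[of y] abs_cos_le_one[of z]]
        f01'(1)[of x] g01'(1)[of y] f01(1)[of x] g01(1)[of y]
      by (simp_all add: abs_mult)
    have intf: "integrable M ?f" using f01' by (intro M.integrable_const_bound[of _ 1]) auto
    have intg: "integrable N ?g" using g01' by (intro N.integrable_const_bound[of _ 1]) auto
    have intfc: "integrable M (\<lambda>x. ?f x * cos (S c x + \<theta>))"
      by (intro M.integrable_const_bound[of _ 1] AE_I2 bound) measurable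
    have intgc: "integrable N (\<lambda>x. ?g x * cos (R c x + \<theta>))"
      by (intro N.integrable_const_bound[of _ 1] AE_I2 bound) measurable
    have "(LINT x|M. ?f x) = (LINT x|N. ?g x)"
      using step[of "\<lambda>_. 0" 0] by (simp add: S_def R_def mult.commute[of _ 2] mult.assoc)
    moreover have "(LINT x|M. ?f x + ?f x * cos (S c x + \<theta>)) = (LINT x|N. ?g x + ?g x * cos (R c x + \<theta>))"
      using step[of c \<theta>] by (simp add: algebra_simps)
    ultimately have "(LINT x|M. ?f x * cos (S c x + \<theta>)) = (LINT x|N. ?g x * cos (R c x + \<theta>))"
      using intf intg intfc intgc by simp
    then show ?case
      using insert.hyps by (simp add: f_def g_def S_def R_def mult.commute mult.left_commute)
  qed
  have prod_ind: "(\<Prod>i\<in>I. indicat_real (B i) (Z i)) = (if \<forall>i\<in>I. Z i \<in> B i then 1 else 0)" for Z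
    using \<open>finite I\<close> by (auto simp: indicator_def intro!: prod.neutral)
  have "measure M {x \<in> space M. \<forall>i\<in>I. X i x \<in> B i} = (LINT x|M. (\<Prod>i\<in>I. indicat_real (B i) (X i x)))"
    using \<open>finite I\<close>
    by (subst Bochner_Integration.integral_cong[OF refl, of _ _ "indicat_real {x \<in> space M. \<forall>i\<in>I. X i x \<in> B i}"])
       (auto simp: prod_ind indicator_def)
  moreover have "measure N {x \<in> space N. \<forall>i\<in>I. Y i x \<in> B i} = (LINT x|N. (\<Prod>i\<in>I. indicat_real (B i) (Y i x)))"
    using \<open>finite I\<close>
    by (subst Bochner_Integration.integral_cong[OF refl, of _ _ "indicat_real {x \<in> space N. \<forall>i\<in>I. Y i x \<in> B i}"])
       (auto simp: prod_ind indicator_def)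
  ultimately show ?thesis using main[OF \<open>finite I\<close> order_refl, of "\<lambda>_. 0" 0] by simp
qed

section \<open>Fernique's theorem\<close>

lemma expectation_cos_std_normal:
  assumes "prob_space M" and [measurable]: "Z \<in> borel_measurable M"
    and Z: "distr M borel Z = std_normal_distribution"
  shows "(LINT x|M. cos (t * Z x)) = exp (- t\<^sup>2 / 2)" "(LINT x|M. sin (t * Z x)) = 0"
proof -
  interpret prob_space M by fact
  have int: "integrable M (\<lambda>x. iexp (t * Z x))"
    using integrable_iexp[of "\<lambda>x. complex_of_real (t * Z x)"] by simp
  have "char std_normal_distribution t = (CLINT x|M. iexp (t * Z x))"
    unfolding Z[symmetric] char_def by (subst integral_distr) auto
  then have eq: "(CLINT x|M. iexp (t * Z x)) = complex_of_real (exp (- (t\<^sup>2) / 2))"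
    by (simp add: char_std_normal_distribution)
  show "(LINT x|M. cos (t * Z x)) = exp (- t\<^sup>2 / 2)"
    using arg_cong[OF eq, of Re] int
    by (simp add: integral_Re[symmetric] Re_exp del: integral_Re)
  show "(LINT x|M. sin (t * Z x)) = 0"
    using arg_cong[OF eq, of Im] int
    by (simp add: integral_Im[symmetric] Im_exp del: integral_Im)
qed

lemma has_normal_law_cos:
  assumes "prob_space M" and law: "has_normal_law M X \<mu> v"
  shows "X \<in> sq_integrable M" "(LINT x|M. X x) = \<mu>" "(LINT x|M. (X x - \<mu>)\<^sup>2) = v"
    "(LINT x|M. cos (X x - \<mu> + \<theta>)) = cos \<theta> * exp (- v / 2)"
proof -
  interpret prob_space M by fact
  have [measurable]: "X \<in> borel_measurable M" and "v \<ge> 0"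
    and distr: "distr M borel X = normal_law \<mu> v"
    using law by (auto simp: has_normal_law_def)
  have "X \<in> sq_integrable M \<and> (LINT x|M. X x) = \<mu> \<and> (LINT x|M. (X x - \<mu>)\<^sup>2) = v \<and>
    (LINT x|M. cos (X x - \<mu> + \<theta>)) = cos \<theta> * exp (- v / 2)"
  proof (cases "v = 0")
    case True
    have "distr M borel X = return borel \<mu>" using distr True by (simp add: normal_law_def)
    then have "AE x in distr M borel X. x = \<mu>"
      by (simp only:) (subst AE_return, auto)
    then have AE: "AE x in M. X x = \<mu>" by (subst (asm) AE_distr_iff) auto
    have "integrable M (\<lambda>x. (norm (X x))\<^sup>2) = integrable M (\<lambda>x. (norm \<mu>)\<^sup>2)"
      using AE by (intro integrable_cong_AE) auto
    moreover have "(LINT x|M. X x) = (LINT x|M. \<mu>)" using AE by (intro integral_cong_AE) auto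
    moreover have "(LINT x|M. (X x - \<mu>)\<^sup>2) = (LINT x|M. 0)" using AE by (intro integral_cong_AE) auto
    moreover have "(LINT x|M. cos (X x - \<mu> + \<theta>)) = (LINT x|M. cos \<theta>)" using AE by (intro integral_cong_AE) auto
    ultimately show ?thesis using True by (simp add: sq_integrable_def prob_space)
  next
    case False
    define \<sigma> where "\<sigma> = sqrt v"
    have "\<sigma> > 0" using False \<open>v \<ge> 0\<close> by (simp add: \<sigma>_def)
    have "distributed M lborel X (normal_density \<mu> \<sigma>)"
      using distr False unfolding distributed_def normal_law_def \<sigma>_def
      by (simp cong: distr_cong)
    then have "distributed M lborel (\<lambda>x. (X x - \<mu>) / \<sigma>) std_normal_density"
      using normal_standard_normal_convert[OF \<open>\<sigma> > 0\<close>] by simp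
    then have Z: "distr M borel (\<lambda>x. (X x - \<mu>) / \<sigma>) = std_normal_distribution"
      by (simp add: distributed_def cong: distr_cong)
    define Z where "Z x = (X x - \<mu>) / \<sigma>" for x
    have [measurable]: "Z \<in> borel_measurable M" unfolding Z_def by measurable
    have X: "X x = \<mu> + \<sigma> * Z x" for x using \<open>\<sigma> > 0\<close> by (simp add: Z_def)
    have distr_Z: "distr M borel Z = std_normal_distribution" using Z by (simp add: Z_def[abs_def])
    have moment: "integrable M (\<lambda>x. Z x ^ k)" "(LINT x|M. Z x ^ k) = (LINT x|std_normal_distribution. x ^ k)" for k
      using integrable_std_normal_distribution_moment[of k] unfolding distr_Z[symmetric]
      by (simp_all add: integrable_distr_eq integral_distr)
    have Z1: "integrable M Z" "(LINT x|M. Z x) = 0"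
      using moment[of 1] integral_std_normal_distribution_moment_odd[of 1] by simp_all
    have Z2: "integrable M (\<lambda>x. (Z x)\<^sup>2)" "(LINT x|M. (Z x)\<^sup>2) = 1"
      using moment[of 2] std_normal_distribution_even_moments[of 1] by simp_all
    have "Z \<in> sq_integrable M" using Z2 by (simp add: sq_integrable_def)
    then have "(\<lambda>x. \<mu> + \<sigma> * Z x) \<in> sq_integrable M"
      by (intro sq_integrable_add sq_integrable_cmult sq_integrable_const finite_measure_axioms)
    moreover have "(LINT x|M. \<mu> + \<sigma> * Z x) = \<mu>" using Z1 by (simp add: prob_space)
    moreover have "(LINT x|M. (\<sigma> * Z x)\<^sup>2) = v"
      using Z2 \<open>v \<ge> 0\<close> by (simp add: power_mult_distrib \<sigma>_def)
    moreover have "(LINT x|M. cos (\<sigma> * Z x + \<theta>)) = cos \<theta> * exp (- v / 2)"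
    proof -
      have int: "integrable M (\<lambda>x. cos (\<sigma> * Z x))" "integrable M (\<lambda>x. sin (\<sigma> * Z x))"
        by (intro integrable_const_bound[of _ 1]; simp)+
      have "(LINT x|M. cos (\<sigma> * Z x + \<theta>))
          = (LINT x|M. cos \<theta> * cos (\<sigma> * Z x) - sin \<theta> * sin (\<sigma> * Z x))"
        by (simp add: cos_add mult.commute)
      also have "\<dots> = cos \<theta> * (LINT x|M. cos (\<sigma> * Z x)) - sin \<theta> * (LINT x|M. sin (\<sigma> * Z x))"
        using int by simp
      also have "\<dots> = cos \<theta> * exp (- v / 2)"
        using expectation_cos_std_normal[OF \<open>prob_space M\<close> _ distr_Z] \<open>v \<ge> 0\<close> by (simp add: \<sigma>_def)
      finally show ?thesis .
    qed
    ultimately show ?thesis unfolding X[abs_def] by simp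
  qed
  then show "X \<in> sq_integrable M" "(LINT x|M. X x) = \<mu>" "(LINT x|M. (X x - \<mu>)\<^sup>2) = v"
    "(LINT x|M. cos (X x - \<mu> + \<theta>)) = cos \<theta> * exp (- v / 2)"
    by blast+
qed

text \<open>The thresholds satisfy \<open>(level s (n + 1) - s) / \<surd>2 = level s n\<close>, which is the relation between the two
  thresholds in Fernique's inequality. They grow like \<open>\<surd>2\<^sup>n\<close>, while the tails beyond them decay like
  \<open>3\<close> to the power \<open>- 2\<^sup>n\<close>, which is a Gaussian tail.\<close>

primrec level :: "real \<Rightarrow> nat \<Rightarrow> real" where
  "level s 0 = s"
| "level s (Suc n) = s + sqrt 2 * level s n"

text \<open>The bound is reproduced by the recursion because \<open>3 \<surd>2 \<ge> 4\<close>.\<close>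

lemma level_bound: "0 \<le> s \<Longrightarrow> level s n \<le> s * (4 * sqrt 2 ^ n - 3)"
proof (induction n)
  case (Suc n)
  have "4 / 3 \<le> sqrt 2" by (rule real_le_rsqrt) (simp add: power2_eq_square)
  have "level s (Suc n) \<le> s + sqrt 2 * (s * (4 * sqrt 2 ^ n - 3))"
    using Suc by (simp add: mult_left_mono)
  also have "\<dots> = s * (4 * sqrt 2 ^ Suc n + (1 - 3 * sqrt 2))" by (simp add: algebra_simps)
  also have "\<dots> \<le> s * (4 * sqrt 2 ^ Suc n - 3)"
    using \<open>4 / 3 \<le> sqrt 2\<close> Suc.prems by (intro mult_left_mono) auto
  finally show ?case .
qed simp

lemma level_ge: "0 \<le> s \<Longrightarrow> level s n \<ge> s * (1 + real n)"
proof (induction n)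
  case (Suc n)
  have "1 * (s * (1 + real n)) \<le> sqrt 2 * level s n"
    using Suc by (intro mult_mono) auto
  then show ?case by (simp add: algebra_simps)
qed simp

text \<open>The elementary inequality \<open>c x \<le> c\<^sup>2 + x\<^sup>2 / 4\<close> with \<open>x = \<surd>2\<^sup>n\<close> absorbs the growing exponential into
  the factor \<open>3\<close> to the power \<open>- 2\<^sup>n\<close>.\<close>

lemma summable_level: 
  assumes "0 \<le> s" "0 \<le> p"
  shows "summable (\<lambda>n. exp (p * level s (Suc n)) * (1 / 3) ^ (2 ^ n))"
proof (rule summable_comparison_test')
  define c where "c = p * s * 4 * sqrt 2"
  show "summable (\<lambda>n. exp (c\<^sup>2) * exp (- 3 / 4) ^ n)"
    by (intro summable_mult summable_geometric) simp
  fix n :: nat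
  have "p * level s (Suc n) \<le> p * (s * (4 * sqrt 2 ^ Suc n - 3))"
    using assms level_bound[of s "Suc n"] by (intro mult_left_mono) auto
  also have "\<dots> \<le> p * (s * (4 * sqrt 2 ^ Suc n))"
    using assms by (intro mult_left_mono) auto
  also have "\<dots> = c * sqrt 2 ^ n" by (simp add: c_def)
  also have "\<dots> \<le> c\<^sup>2 + (sqrt 2 ^ n)\<^sup>2 / 4"
    using zero_le_power2[of "c - sqrt 2 ^ n / 2"] by (simp add: power2_diff power_divide)
  also have "(sqrt 2 ^ n)\<^sup>2 = 2 ^ n" by (simp add: power_mult[symmetric] mult.commute[of n] power_mult)
  finally have 1: "p * level s (Suc n) \<le> c\<^sup>2 + 2 ^ n / 4" .
  have "exp (1::real) \<le> 3" by (rule exp_le)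
  then have "1 / 3 \<le> exp (- 1 :: real)" by (simp add: exp_minus field_simps)
  then have 2: "(1 / 3) ^ (2 ^ n) \<le> exp (- 1 :: real) ^ (2 ^ n)" by (intro power_mono) auto
  have "exp (p * level s (Suc n)) * (1 / 3) ^ (2 ^ n) \<le> exp (c\<^sup>2 + 2 ^ n / 4) * exp (- 1) ^ (2 ^ n)"
    using 1 2 by (intro mult_mono) auto
  also have "\<dots> = exp (c\<^sup>2) * exp (- (3 / 4) * 2 ^ n)"
    by (simp add: exp_of_nat_mult[symmetric] exp_add[symmetric])
  also have "\<dots> \<le> exp (c\<^sup>2) * exp (- (3 / 4) * real n)"
    using of_nat_less_two_power[of n, where 'a=real] by (intro mult_left_mono) auto
  also have "\<dots> = exp (c\<^sup>2) * exp (- 3 / 4) ^ n" by (simp add: exp_of_nat_mult[symmetric])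
  finally show "norm (exp (p * level s (Suc n)) * (1 / 3) ^ (2 ^ n)) \<le> exp (c\<^sup>2) * exp (- 3 / 4) ^ n"
    by simp
qed

text \<open>Gaussianity is expressed by the characteristic function of the finite linear combinations, with the
  variance written as a second moment, so that no covariance matrix has to be introduced.\<close>

locale centred_gaussian_family = prob_space M
  for M :: "'w measure" +
  fixes X :: "'i \<Rightarrow> 'w \<Rightarrow> real" and I :: "'i set"
  assumes X_sq: "\<And>i. i \<in> I \<Longrightarrow> X i \<in> sq_integrable M"
    and X_cos: "\<And>F c \<theta>. finite F \<Longrightarrow> F \<subseteq> I \<Longrightarrow>
      (LINT \<omega>|M. cos ((\<Sum>i\<in>F. c i * X i \<omega>) + \<theta>))
        = cos \<theta> * exp (- (LINT \<omega>|M. (\<Sum>i\<in>F. c i * X i \<omega>)\<^sup>2) / 2)"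
begin

lemma X_measurable [measurable]: "i \<in> I \<Longrightarrow> X i \<in> borel_measurable M"
  using X_sq by (auto dest: sq_integrable_measurable)

lemma sum_sq_integrable:
  "finite F \<Longrightarrow> F \<subseteq> I \<Longrightarrow> (\<lambda>\<omega>. \<Sum>i\<in>F. c i * X i \<omega>) \<in> sq_integrable M"
  by (induction F rule: finite_induct) (auto intro!: sq_integrable_add sq_integrable_cmult X_sq)

lemma cos_pair:
  assumes F: "finite F" "F \<subseteq> I"
  shows "(LINT z|(M \<Otimes>\<^sub>M M). cos ((\<Sum>i\<in>F. c i * X i (fst z)) + (\<Sum>i\<in>F. d i * X i (snd z)) + \<theta>))
    = cos \<theta> * exp (- ((LINT \<omega>|M. (\<Sum>i\<in>F. c i * X i \<omega>)\<^sup>2) + (LINT \<omega>|M. (\<Sum>i\<in>F. d i * X i \<omega>)\<^sup>2)) / 2)"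
proof -
  interpret P: pair_prob_space M M ..
  define R where "R c \<omega> = (\<Sum>i\<in>F. c i * X i \<omega>)" for c \<omega>
  have [measurable]: "R c \<in> borel_measurable M" for c
    unfolding R_def using sum_sq_integrable[OF F] by (rule sq_integrable_measurable)
  have "(LINT z|(M \<Otimes>\<^sub>M M). cos (R c (fst z) + R d (snd z) + \<theta>))
      = (LINT \<omega>'|M. LINT \<omega>|M. cos (R c \<omega> + R d \<omega>' + \<theta>))"
    using P.integral_snd[of "\<lambda>\<omega> \<omega>'. cos (R c \<omega> + R d \<omega>' + \<theta>)"]
    by (simp add: split_beta' P.P.integrable_const_bound[of _ 1])
  also have "\<dots> = (LINT \<omega>'|M. cos (R d \<omega>' + \<theta>) * exp (- (LINT \<omega>|M. (R c \<omega>)\<^sup>2) / 2))"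
    using X_cos[OF F] by (simp add: R_def add.assoc)
  also have "\<dots> = cos \<theta> * exp (- (LINT \<omega>|M. (R d \<omega>)\<^sup>2) / 2) * exp (- (LINT \<omega>|M. (R c \<omega>)\<^sup>2) / 2)"
    using X_cos[OF F] by (simp add: R_def)
  also have "\<dots> = cos \<theta> * exp (- ((LINT \<omega>|M. (R c \<omega>)\<^sup>2) + (LINT \<omega>|M. (R d \<omega>)\<^sup>2)) / 2)"
    by (simp add: exp_add[symmetric] add_divide_distrib mult.assoc)
  finally show ?thesis by (simp add: R_def)
qed

text \<open>A linear combination of the rotated pair splits into one combination of each copy; by the
  parallelogram law their second moments add up to those of the unrotated pair.\<close>

lemma rotation_invariance:
  assumes F: "finite F" "F \<subseteq> I"
    and B: "\<And>i. i \<in> F \<Longrightarrow> A i \<in> sets borel" "\<And>i. i \<in> F \<Longrightarrow> B i \<in> sets borel"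
  shows "measure (M \<Otimes>\<^sub>M M) {z \<in> space (M \<Otimes>\<^sub>M M). \<forall>i\<in>F.
            (X i (fst z) - X i (snd z)) / sqrt 2 \<in> A i \<and> (X i (fst z) + X i (snd z)) / sqrt 2 \<in> B i}
       = measure (M \<Otimes>\<^sub>M M) {z \<in> space (M \<Otimes>\<^sub>M M). \<forall>i\<in>F. X i (fst z) \<in> A i \<and> X i (snd z) \<in> B i}"
proof -
  interpret P: pair_prob_space M M ..
  have [measurable]: "i \<in> F \<Longrightarrow> X i \<in> borel_measurable M" for i using F by auto
  define U where "U k z = (if snd k then (X (fst k) (fst z) - X (fst k) (snd z)) / sqrt 2
      else (X (fst k) (fst z) + X (fst k) (snd z)) / sqrt 2)" for k :: "'i \<times> bool" and z
  define V where "V k z = (if snd k then X (fst k) (fst z) else X (fst k) (snd z))" for k :: "'i \<times> bool" and z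
  define C where "C k = (if snd k then A (fst k) else B (fst k))" for k :: "'i \<times> bool"
  let ?I = "F \<times> (UNIV :: bool set)"
  have sum_I: "(\<Sum>k\<in>?I. h k) = (\<Sum>i\<in>F. h (i, True) + h (i, False))" for h :: "'i \<times> bool \<Rightarrow> real"
    using sum.cartesian_product[of "\<lambda>i b. h (i, b)" UNIV F] by (simp add: UNIV_bool add.commute)
  have "measure (M \<Otimes>\<^sub>M M) {z \<in> space (M \<Otimes>\<^sub>M M). \<forall>k\<in>?I. U k z \<in> C k}
      = measure (M \<Otimes>\<^sub>M M) {z \<in> space (M \<Otimes>\<^sub>M M). \<forall>k\<in>?I. V k z \<in> C k}"
  proof (rule cramer_wold_rectangles)
    show "prob_space (M \<Otimes>\<^sub>M M)" "prob_space (M \<Otimes>\<^sub>M M)" by unfold_locales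
    show "finite ?I" using F by simp
    show "U k \<in> borel_measurable (M \<Otimes>\<^sub>M M)" if "k \<in> ?I" for k
      using that unfolding U_def by auto
    show "V k \<in> borel_measurable (M \<Otimes>\<^sub>M M)" if "k \<in> ?I" for k
      using that unfolding V_def by auto
    show "C k \<in> sets borel" if "k \<in> ?I" for k
      using that B unfolding C_def by auto
    fix c :: "'i \<times> bool \<Rightarrow> real" and \<theta>
    define a where "a i = c (i, True)" for i
    define b where "b i = c (i, False)" for i
    define S where "S \<omega> = (\<Sum>i\<in>F. a i * X i \<omega>)" for \<omega>
    define T where "T \<omega> = (\<Sum>i\<in>F. b i * X i \<omega>)" for \<omega>
    have S: "S \<in> sq_integrable M" and T: "T \<in> sq_integrable M"
      unfolding S_def T_def using sum_sq_integrable[OF F] by auto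
    have V_sum: "(\<Sum>k\<in>?I. c k * V k z) = (\<Sum>i\<in>F. a i * X i (fst z)) + (\<Sum>i\<in>F. b i * X i (snd z))" for z
      unfolding sum_I by (simp add: V_def a_def b_def sum.distrib)
    have U_sum: "(\<Sum>k\<in>?I. c k * U k z) = (\<Sum>i\<in>F. ((b i + a i) / sqrt 2) * X i (fst z))
        + (\<Sum>i\<in>F. ((b i - a i) / sqrt 2) * X i (snd z))" for z
      unfolding sum_I sum.distrib[symmetric]
      by (intro sum.cong refl) (simp add: U_def a_def b_def field_simps)
    have comb: "(\<Sum>i\<in>F. ((b i + a i) / sqrt 2) * X i \<omega>) = (T \<omega> + S \<omega>) / sqrt 2"
        "(\<Sum>i\<in>F. ((b i - a i) / sqrt 2) * X i \<omega>) = (T \<omega> - S \<omega>) / sqrt 2" for \<omega>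
      unfolding S_def T_def sum.distrib[symmetric] sum_subtractf[symmetric] sum_divide_distrib
      by (intro sum.cong refl; simp add: field_simps)+
    have int: "integrable M (\<lambda>\<omega>. (S \<omega>)\<^sup>2)" "integrable M (\<lambda>\<omega>. (T \<omega>)\<^sup>2)" "integrable M (\<lambda>\<omega>. T \<omega> * S \<omega>)"
      using sq_integrable_integrable[OF S] sq_integrable_integrable[OF T] integrable_mult_sq_integrable[OF T S]
      by simp_all
    have "(LINT \<omega>|M. ((T \<omega> + S \<omega>) / sqrt 2)\<^sup>2) + (LINT \<omega>|M. ((T \<omega> - S \<omega>) / sqrt 2)\<^sup>2)
        = (LINT \<omega>|M. (S \<omega>)\<^sup>2) + (LINT \<omega>|M. (T \<omega>)\<^sup>2)"
      using int by (simp add: power_divide power2_sum power2_diff mult.assoc) (simp add: field_simps)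
    then show "(LINT z|(M \<Otimes>\<^sub>M M). cos ((\<Sum>k\<in>?I. c k * U k z) + \<theta>))
        = (LINT z|(M \<Otimes>\<^sub>M M). cos ((\<Sum>k\<in>?I. c k * V k z) + \<theta>))"
      unfolding U_sum V_sum cos_pair[OF F]
      unfolding comb S_def[symmetric] T_def[symmetric] by (simp only:)
  qed
  moreover have ball_I: "(\<forall>k\<in>?I. P k) \<longleftrightarrow> (\<forall>i\<in>F. P (i, True) \<and> P (i, False))" for P
    by (auto simp: all_bool_eq)
  ultimately show ?thesis unfolding ball_I by (simp add: U_def V_def C_def)
qed

definition below :: "'i set \<Rightarrow> real \<Rightarrow> 'w set" where
  "below F t = {\<omega> \<in> space M. \<forall>i\<in>F. \<bar>X i \<omega>\<bar> \<le> t}"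

lemma below_sets [measurable]:
  assumes "countable F" "F \<subseteq> I"
  shows "below F t \<in> sets M"
proof -
  have [measurable]: "i \<in> F \<Longrightarrow> X i \<in> borel_measurable M" for i using assms by auto
  have "Measurable.pred M (\<lambda>\<omega>. \<forall>i\<in>F. \<bar>X i \<omega>\<bar> \<le> t)"
    using assms(1) by (intro measurable_pred_countable) auto
  then show ?thesis unfolding below_def pred_def .
qed

text \<open>By rotation invariance the left side is the probability that all \<open>\<bar>X - Y\<bar> \<le> s \<surd>2\<close> while some
  \<open>\<bar>X + Y\<bar> > t \<surd>2\<close>. At such an index both \<open>\<bar>X\<bar>\<close> and \<open>\<bar>Y\<bar>\<close> exceed \<open>(t - s) / \<surd>2\<close>, and the copies are
  independent.\<close>

lemma fernique_inequality:
  assumes F: "finite F" "F \<subseteq> I"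
  shows "prob (below F s) * prob (space M - below F t) \<le> (prob (space M - below F ((t - s) / sqrt 2)))\<^sup>2"
proof -
  interpret P: pair_prob_space M M ..
  let ?A = "\<lambda>r. {- r..r} :: real set"
  have [measurable]: "i \<in> F \<Longrightarrow> X i \<in> borel_measurable M" for i using F by auto
  have in_A: "x \<in> ?A r \<longleftrightarrow> \<bar>x\<bar> \<le> r" for x r by auto
  have [measurable]: "below F r \<in> sets M" for r using F by (intro below_sets) (auto intro: countable_finite)
  have times: "P.prob (C \<times> D) = prob C * prob D" if "C \<in> sets M" "D \<in> sets M" for C D
    using that by (simp add: measure_def emeasure_pair_measure_Times enn2real_mult)
  define W where "W S T = {z \<in> space (M \<Otimes>\<^sub>M M). \<forall>i\<in>F. (X i (fst z) - X i (snd z)) / sqrt 2 \<in> S i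
      \<and> (X i (fst z) + X i (snd z)) / sqrt 2 \<in> T i}" for S T :: "'i \<Rightarrow> real set"
  have [measurable]: "W S T \<in> sets (M \<Otimes>\<^sub>M M)" if "\<And>i. S i \<in> sets borel" "\<And>i. T i \<in> sets borel" for S T
    using that F unfolding W_def by (intro sets.sets_Collect_finite_All) auto
  have rot: "P.prob (W S T) = P.prob {z \<in> space (M \<Otimes>\<^sub>M M). \<forall>i\<in>F. X i (fst z) \<in> S i \<and> X i (snd z) \<in> T i}"
    if "\<And>i. S i \<in> sets borel" "\<And>i. T i \<in> sets borel" for S T
    unfolding W_def using that by (intro rotation_invariance F)
  have 1: "P.prob (W (\<lambda>_. ?A s) (\<lambda>_. UNIV)) = prob (below F s)"
  proof -
    have "{z \<in> space (M \<Otimes>\<^sub>M M). \<forall>i\<in>F. X i (fst z) \<in> ?A s \<and> X i (snd z) \<in> UNIV} = below F s \<times> space M"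
      unfolding below_def in_A by (auto simp: space_pair_measure)
    then show ?thesis using rot[of "\<lambda>_. ?A s" "\<lambda>_. UNIV"] by (simp add: times prob_space)
  qed
  have 2: "P.prob (W (\<lambda>_. ?A s) (\<lambda>_. ?A t)) = prob (below F s) * prob (below F t)"
  proof -
    have "{z \<in> space (M \<Otimes>\<^sub>M M). \<forall>i\<in>F. X i (fst z) \<in> ?A s \<and> X i (snd z) \<in> ?A t} = below F s \<times> below F t"
      unfolding below_def in_A by (auto simp: space_pair_measure)
    then show ?thesis using rot[of "\<lambda>_. ?A s" "\<lambda>_. ?A t"] by (simp add: times)
  qed
  have "prob (below F s) * prob (space M - below F t)
      = P.prob (W (\<lambda>_. ?A s) (\<lambda>_. UNIV)) - P.prob (W (\<lambda>_. ?A s) (\<lambda>_. ?A t))"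
    unfolding 1 2 by (simp add: prob_compl algebra_simps)
  also have "\<dots> = P.prob (W (\<lambda>_. ?A s) (\<lambda>_. UNIV) - W (\<lambda>_. ?A s) (\<lambda>_. ?A t))"
  proof (rule P.finite_measure_Diff[symmetric])
    show "W (\<lambda>_. ?A s) (\<lambda>_. ?A t) \<subseteq> W (\<lambda>_. ?A s) (\<lambda>_. UNIV)" by (auto simp: W_def)
  qed simp_all
  also have "\<dots> \<le> P.prob ((space M - below F ((t - s) / sqrt 2)) \<times> (space M - below F ((t - s) / sqrt 2)))"
  proof (rule P.finite_measure_mono)
    show "W (\<lambda>_. ?A s) (\<lambda>_. UNIV) - W (\<lambda>_. ?A s) (\<lambda>_. ?A t)
        \<subseteq> (space M - below F ((t - s) / sqrt 2)) \<times> (space M - below F ((t - s) / sqrt 2))"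
    proof
      fix z assume z: "z \<in> W (\<lambda>_. ?A s) (\<lambda>_. UNIV) - W (\<lambda>_. ?A s) (\<lambda>_. ?A t)"
      then have sp: "fst z \<in> space M" "snd z \<in> space M" by (auto simp: W_def space_pair_measure)
      obtain i where i: "i \<in> F" and "\<not> \<bar>(X i (fst z) + X i (snd z)) / sqrt 2\<bar> \<le> t"
        and "\<bar>(X i (fst z) - X i (snd z)) / sqrt 2\<bar> \<le> s"
        using z unfolding W_def in_A by blast
      then have "t * sqrt 2 < \<bar>X i (fst z) + X i (snd z)\<bar>" "\<bar>X i (fst z) - X i (snd z)\<bar> \<le> s * sqrt 2"
        by (simp_all add: abs_divide divide_le_eq not_le)
      then have "(t - s) * sqrt 2 < 2 * \<bar>X i (fst z)\<bar>" "(t - s) * sqrt 2 < 2 * \<bar>X i (snd z)\<bar>"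
        unfolding left_diff_distrib by linarith+
      moreover have "(t - s) / sqrt 2 = (t - s) * sqrt 2 / 2"
        by (simp add: real_div_sqrt field_simps)
      ultimately have "(t - s) / sqrt 2 < \<bar>X i (fst z)\<bar>" "(t - s) / sqrt 2 < \<bar>X i (snd z)\<bar>"
        by linarith+
      then have "fst z \<notin> below F ((t - s) / sqrt 2)" "snd z \<notin> below F ((t - s) / sqrt 2)"
        using i unfolding below_def by (auto simp: not_le)
      then show "z \<in> (space M - below F ((t - s) / sqrt 2)) \<times> (space M - below F ((t - s) / sqrt 2))"
        using sp by (simp add: mem_Times_iff)
    qed
  qed auto
  also have "\<dots> = (prob (space M - below F ((t - s) / sqrt 2)))\<^sup>2"
    by (simp add: times power2_eq_square)
  finally show ?thesis .
qed

text \<open>The quotient of the tail by the probability \<open>p\<close> of staying below \<open>s\<close> is at most \<open>1 / 3\<close> initially, because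
  \<open>p \<ge> 3 / 4\<close>, and is squared in each step.\<close>

lemma level_tail_finite:
  assumes F: "finite F" "F \<subseteq> I" and s: "prob (below F s) \<ge> 3 / 4"
  shows "prob (space M - below F (level s n)) \<le> (1 / 3) ^ (2 ^ n)"
proof -
  define p where "p = prob (below F s)"
  have p: "3 / 4 \<le> p" "p \<le> 1" using s by (auto simp: p_def)
  have [measurable]: "below F r \<in> sets M" for r using F by (intro below_sets) (auto intro: countable_finite)
  have "prob (space M - below F (level s n)) \<le> p * (1 / 3) ^ (2 ^ n)"
  proof (induction n)
    case 0
    then show ?case using p by (simp add: prob_compl p_def)
  next
    case (Suc n)
    let ?q = "\<lambda>n. prob (space M - below F (level s n))"
    have "p * ?q (Suc n) \<le> (?q n)\<^sup>2"
      using fernique_inequality[OF F, of s "level s (Suc n)"] by (simp add: p_def)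
    also have "\<dots> \<le> (p * (1 / 3) ^ (2 ^ n))\<^sup>2" using Suc.IH by (intro power_mono) auto
    also have "\<dots> = p * (p * (1 / 3) ^ (2 ^ Suc n))"
      by (simp add: power_mult_distrib power2_eq_square power_add[symmetric] mult_2 mult.assoc)
    finally show ?case using p by simp
  qed
  also have "\<dots> \<le> 1 * (1 / 3) ^ (2 ^ n)" using p by (intro mult_right_mono) auto
  finally show ?thesis by simp
qed

text \<open>A starting threshold for \<open>D\<close> serves every finite subset of \<open>D\<close> as well, and the bound does not depend on
  the subset.\<close>

lemma level_tail:
  assumes D: "countable D" "D \<subseteq> I" and s: "prob (below D s) \<ge> 3 / 4"
  shows "prob (space M - below D (level s n)) \<le> (1 / 3) ^ (2 ^ n)"
proof (cases "D = {}")
  case True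
  then show ?thesis by (simp add: below_def)
next
  case False
  define F where "F k = from_nat_into D ` {..k}" for k
  have F: "finite (F k)" "F k \<subseteq> D" for k
    using from_nat_into[OF False] by (auto simp: F_def)
  have D_eq: "D = (\<Union>k. F k)"
  proof
    show "D \<subseteq> (\<Union>k. F k)"
    proof
      fix x assume "x \<in> D"
      then obtain n where "x = from_nat_into D n"
        using range_from_nat_into[OF False D(1)] by (metis rangeE)
      then have "x \<in> F n" by (auto simp: F_def)
      then show "x \<in> (\<Union>k. F k)" by blast
    qed
  qed (use F in blast)
  have below_D: "below D t = (\<Inter>k. below (F k) t)" for t
    unfolding below_def by (auto simp: D_eq)
  have [measurable]: "below (F k) t \<in> sets M" for k t
    using F D by (intro below_sets) (auto intro: countable_finite)
  have tail: "prob (space M - below (F k) (level s n)) \<le> (1 / 3) ^ (2 ^ n)" for k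
  proof (rule level_tail_finite)
    have "below D s \<subseteq> below (F k) s" by (auto simp: below_D)
    then have "prob (below D s) \<le> prob (below (F k) s)" by (intro finite_measure_mono) auto
    then show "prob (below (F k) s) \<ge> 3 / 4" using s by simp
  qed (use F D in auto)
  have inc: "incseq (\<lambda>k. space M - below (F k) (level s n))"
    by (rule incseq_SucI) (auto simp: below_def F_def)
  have "(\<lambda>k. prob (space M - below (F k) (level s n))) \<longlonglongrightarrow> prob (\<Union>k. space M - below (F k) (level s n))"
    by (rule finite_Lim_measure_incseq[OF _ inc]) auto
  moreover have "(\<Union>k. space M - below (F k) (level s n)) = space M - below D (level s n)"
    by (auto simp: below_D)
  ultimately show ?thesis using tail by (intro LIMSEQ_le_const2) auto
qed

text \<open>The space is cut according to the first threshold that \<open>Z\<close> does not exceed.\<close>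

theorem fernique:
  assumes D: "countable D" "D \<subseteq> I"
    and [measurable]: "Z \<in> borel_measurable M"
    and Z: "\<And>\<omega> t. \<omega> \<in> space M \<Longrightarrow> Z \<omega> \<le> t \<longleftrightarrow> (\<forall>i\<in>D. \<bar>X i \<omega>\<bar> \<le> t)"
    and "0 \<le> p"
  shows "integrable M (\<lambda>\<omega>. exp (p * Z \<omega>))"
proof -
  have below_Z: "below D t = {\<omega> \<in> space M. Z \<omega> \<le> t}" for t
    unfolding below_def using Z by auto
  have "(\<lambda>n. prob (below D (real n))) \<longlonglongrightarrow> prob (\<Union>n. below D (real n))"
    by (rule finite_Lim_measure_incseq) (auto simp: below_Z incseq_def)
  moreover have "(\<Union>n. below D (real n)) = space M"
    using real_arch_simple by (auto simp: below_Z)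
  ultimately have "(\<lambda>n. prob (below D (real n))) \<longlonglongrightarrow> 1" by (simp add: prob_space)
  then have "\<forall>\<^sub>F n in sequentially. prob (below D (real n)) > 3 / 4" by (rule order_tendstoD) simp
  then have "\<forall>\<^sub>F n in sequentially. n \<ge> 1 \<and> prob (below D (real n)) > 3 / 4"
    using eventually_ge_at_top eventually_conj by blast
  then obtain n0 :: nat where "n0 \<ge> 1" "prob (below D (real n0)) > 3 / 4"
    using eventually_happens'[OF sequentially_bot] by blast
  then obtain s :: real where s: "s \<ge> 1" "prob (below D s) \<ge> 3 / 4"
    using that[of "real n0"] by auto
  let ?q = "\<lambda>n. exp (p * level s (Suc n))"
  define h where "h n \<omega> = ennreal (?q n) * indicator (space M - below D (level s n)) \<omega>" for n \<omega>
  have pw: "ennreal (exp (p * Z \<omega>)) \<le> ennreal (exp (p * s))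
      + (\<Sum>n. h n \<omega>)"
    if \<omega>: "\<omega> \<in> space M" for \<omega>
  proof -
    obtain k where "Z \<omega> \<le> real k" using real_arch_simple by blast
    also have "\<dots> \<le> s * (1 + real k)" using s mult_mono[of 1 s "real k" "1 + real k"] by simp
    also have "\<dots> \<le> level s k" using s by (intro level_ge) simp
    finally have "\<exists>k. Z \<omega> \<le> level s k" by blast
    then obtain k where k: "Z \<omega> \<le> level s k" and k_min: "\<And>m. m < k \<Longrightarrow> \<not> Z \<omega> \<le> level s m"
      using exists_least_iff[of "\<lambda>k. Z \<omega> \<le> level s k"] by blast
    have e: "ennreal (exp (p * Z \<omega>)) \<le> ennreal (exp (p * level s k))"
      using k \<open>0 \<le> p\<close> by (intro ennreal_leI) (auto intro: mult_left_mono)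
    show ?thesis
    proof (cases k)
      case 0
      then show ?thesis using e by (intro add_increasing2) auto
    next
      case (Suc m)
      then have "\<omega> \<in> space M - below D (level s m)" using k_min[of m] \<omega> by (auto simp: below_Z)
      then have "ennreal (exp (p * level s k)) = ennreal (?q m) * indicator (space M - below D (level s m)) \<omega>"
        using Suc by simp
      also have "\<dots> = h m \<omega>" by (simp only: h_def)
      also have "\<dots> \<le> (\<Sum>n. h n \<omega>)"
        using sum_le_suminf[of "\<lambda>n. h n \<omega>" "{m}"] by simp
      finally show ?thesis using e by (intro add_increasing order_trans[OF e]) simp_all
    qed
  qed
  have [measurable]: "below D t \<in> sets M" for t using D by (rule below_sets)
  have "(\<integral>\<^sup>+\<omega>. ennreal (exp (p * Z \<omega>)) \<partial>M) \<le> (\<integral>\<^sup>+\<omega>. (ennreal (exp (p * s))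
      + (\<Sum>n. h n \<omega>)) \<partial>M)"
    using pw by (rule nn_integral_mono)
  also have "\<dots> = ennreal (exp (p * s)) + (\<Sum>n. ennreal (?q n) * emeasure M (space M - below D (level s n)))"
    unfolding h_def
    by (subst nn_integral_add) (auto simp: nn_integral_suminf nn_integral_cmult_indicator emeasure_space_1)
  also have "(\<Sum>n. ennreal (?q n) * emeasure M (space M - below D (level s n)))
      \<le> (\<Sum>n. ennreal (?q n * (1 / 3) ^ (2 ^ n)))"
    using level_tail[OF D s(2)]
    by (intro suminf_le summableI) (auto simp: emeasure_eq_measure ennreal_mult'[symmetric] intro!: ennreal_leI mult_left_mono)
  also have "\<dots> < \<infinity>"
    using summable_level[of s p] s \<open>0 \<le> p\<close> by (subst suminf_ennreal2) auto
  finally have "(\<integral>\<^sup>+\<omega>. ennreal (exp (p * Z \<omega>)) \<partial>M) < \<infinity>" by (simp add: ennreal_add_left_cancel_less)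
  then show ?thesis by (intro integrableI_bounded) auto
qed

end

section \<open>The supremum of the random field\<close>

text \<open>The rotations act transitively on the sphere.\<close>

lemma isotropic_mean_const:
  assumes iso: "isotropic_gaussian_random_field M T" and "x \<in> S2" "y \<in> S2"
  shows "(LINT \<omega>|M. T \<omega> x) = (LINT \<omega>|M. T \<omega> y)"
proof -
  have "norm x = 1" "norm y = 1" using assms by auto
  then obtain f :: "real^3 \<Rightarrow> real^3" where f: "orthogonal_transformation f" "det (matrix f) = 1" "f x = y"
    using rotation_exists_1[of x y] by auto
  then have "rotation_matrix (matrix f)"
    by (simp add: rotation_matrix_def orthogonal_transformation_matrix)
  moreover have "matrix f *v x = y"
    using f by (simp add: orthogonal_transformation_linear)
  ultimately show ?thesis using iso \<open>x \<in> S2\<close>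
    unfolding isotropic_gaussian_random_field_def by metis
qed

lemma abs_le_on_dense_iff:
  fixes h :: "'a::topological_space \<Rightarrow> real"
  assumes "continuous_on S h" "D \<subseteq> S" "S \<subseteq> closure D" "closed S"
  shows "(\<forall>x\<in>D. \<bar>h x\<bar> \<le> t) \<longleftrightarrow> (\<forall>x\<in>S. \<bar>h x\<bar> \<le> t)"
proof -
  have "closure D = S" using assms closure_minimal[of D S] by auto
  then show ?thesis
    using continuous_le_on_closure[of D "\<lambda>x. \<bar>h x\<bar>" _ t] assms
    by (auto intro: continuous_on_rabs)
qed

lemma SUP_abs_le_iff:
  fixes h :: "'a::topological_space \<Rightarrow> real"
  assumes "continuous_on S h" "compact S" "S \<noteq> {}"
  shows "(SUP x\<in>S. \<bar>h x\<bar>) \<le> t \<longleftrightarrow> (\<forall>x\<in>S. \<bar>h x\<bar> \<le> t)"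
proof -
  have "compact ((\<lambda>x. \<bar>h x\<bar>) ` S)"
    using assms by (intro compact_continuous_image continuous_on_rabs)
  then have "bdd_above ((\<lambda>x. \<bar>h x\<bar>) ` S)" by (intro bounded_imp_bdd_above compact_imp_bounded)
  then show ?thesis using assms by (intro cSUP_le_iff) auto
qed

definition sup_abs :: "(real^3 \<Rightarrow> real) \<Rightarrow> real" where
  "sup_abs h = (SUP x\<in>S2. \<bar>h x\<bar>)"

lemma S2_nonempty: "S2 \<noteq> {}"
  using norm_axis_1[of 1] by (metis dist_0_norm empty_iff mem_sphere)

lemma sup_abs_le_iff: "continuous_on S2 h \<Longrightarrow> sup_abs h \<le> t \<longleftrightarrow> (\<forall>x\<in>S2. \<bar>h x\<bar> \<le> t)"
  unfolding sup_abs_def using S2_nonempty by (intro SUP_abs_le_iff) auto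

lemma abs_le_sup_abs: "continuous_on S2 h \<Longrightarrow> x \<in> S2 \<Longrightarrow> \<bar>h x\<bar> \<le> sup_abs h"
  using sup_abs_le_iff[of h "sup_abs h"] by simp

text \<open>Continuity replaces the supremum over the sphere by one over a countable dense subset.\<close>

lemma sup_abs_measurable:
  assumes cont: "\<And>\<omega>. \<omega> \<in> space M \<Longrightarrow> continuous_on S2 (H \<omega>)"
    and meas: "\<And>x. x \<in> S2 \<Longrightarrow> (\<lambda>\<omega>. H \<omega> x) \<in> borel_measurable M"
  shows "(\<lambda>\<omega>. sup_abs (H \<omega>)) \<in> borel_measurable M"
proof -
  obtain D :: "(real^3) set" where D: "countable D" "D \<subseteq> S2" "S2 \<subseteq> closure D"
    using separable by blast
  show ?thesis
  proof (rule borel_measurable_iff_le[THEN iffD2], rule)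
    fix t
    have "{\<omega> \<in> space M. sup_abs (H \<omega>) \<le> t} = {\<omega> \<in> space M. \<forall>x\<in>D. \<bar>H \<omega> x\<bar> \<le> t}"
      using sup_abs_le_iff[OF cont, where t=t] abs_le_on_dense_iff[OF cont D(2,3) closed_sphere, where t=t]
      by (simp cong: conj_cong)
    moreover have "Measurable.pred M (\<lambda>\<omega>. \<forall>x\<in>D. \<bar>H \<omega> x\<bar> \<le> t)"
      using D meas by (intro measurable_pred_countable borel_measurable_le) auto
    ultimately show "{\<omega> \<in> space M. sup_abs (H \<omega>) \<le> t} \<in> sets M" by (simp add: pred_def)
  qed
qed

context
  fixes M :: "'w measure" and T :: "'w \<Rightarrow> real^3 \<Rightarrow> real"
  assumes prob: "prob_space M" and iso: "isotropic_gaussian_random_field M T"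
    and cont: "continuous_random_field M T"
begin

lemma random_field_normal_law:
  "finite F \<Longrightarrow> F \<subseteq> S2 \<Longrightarrow> \<exists>\<mu> v. has_normal_law M (\<lambda>\<omega>. \<Sum>x\<in>F. c x * T \<omega> x) \<mu> v"
  using iso by (auto simp: isotropic_gaussian_random_field_def gaussian_random_field_def)

lemma random_field_sq_integrable: "x \<in> S2 \<Longrightarrow> (\<lambda>\<omega>. T \<omega> x) \<in> sq_integrable M"
  using random_field_normal_law[of "{x}" "\<lambda>_. 1"] has_normal_law_cos(1)[OF prob] by auto

lemma random_field_measurable: "x \<in> S2 \<Longrightarrow> (\<lambda>\<omega>. T \<omega> x) \<in> borel_measurable M"
  using random_field_sq_integrable by (auto dest: sq_integrable_measurable)

lemma centred_gaussian_family_random_field: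
  assumes "x0 \<in> S2"
  shows "centred_gaussian_family M (\<lambda>x \<omega>. T \<omega> x - (LINT \<omega>|M. T \<omega> x0)) S2"
proof -
  interpret prob_space M by (rule prob)
  define m where "m = (LINT \<omega>|M. T \<omega> x0)"
  have mean: "(LINT \<omega>|M. T \<omega> x) = m" if "x \<in> S2" for x
    unfolding m_def by (rule isotropic_mean_const[OF iso that \<open>x0 \<in> S2\<close>])
  have int: "integrable M (\<lambda>\<omega>. T \<omega> x)" if "x \<in> S2" for x
    by (rule integrable_sq_integrable[OF finite_measure_axioms random_field_sq_integrable[OF that]])
  show ?thesis unfolding m_def[symmetric]
  proof unfold_locales
    fix x assume "x \<in> S2"
    then show "(\<lambda>\<omega>. T \<omega> x - m) \<in> sq_integrable M"
      by (intro sq_integrable_diff random_field_sq_integrable sq_integrable_const finite_measure_axioms)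
  next
    fix F :: "(real^3) set" and c :: "real^3 \<Rightarrow> real" and \<theta> :: real
    assume F: "finite F" "F \<subseteq> S2"
    define R where "R \<omega> = (\<Sum>x\<in>F. c x * T \<omega> x)" for \<omega>
    obtain \<mu> v where law: "has_normal_law M R \<mu> v"
      unfolding R_def using random_field_normal_law[OF F] by blast
    note R = has_normal_law_cos[OF prob law]
    have "\<mu> = (LINT \<omega>|M. R \<omega>)" using R(2) by simp
    also have "\<dots> = (\<Sum>x\<in>F. (LINT \<omega>|M. c x * T \<omega> x))"
      unfolding R_def using int F by (intro Bochner_Integration.integral_sum) auto
    also have "\<dots> = (\<Sum>x\<in>F. c x * m)" using mean F by (intro sum.cong) auto
    finally have sum_eq: "(\<Sum>x\<in>F. c x * (T \<omega> x - m)) = R \<omega> - \<mu>" for \<omega>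
      by (simp add: R_def right_diff_distrib sum_subtractf)
    show "(LINT \<omega>|M. cos ((\<Sum>x\<in>F. c x * (T \<omega> x - m)) + \<theta>))
        = cos \<theta> * exp (- (LINT \<omega>|M. (\<Sum>x\<in>F. c x * (T \<omega> x - m))\<^sup>2) / 2)"
      unfolding sum_eq using R(3,4) by simp
  qed
qed

lemma random_field_continuous: "\<omega> \<in> space M \<Longrightarrow> continuous_on S2 (T \<omega>)"
  using cont by (simp add: continuous_random_field_def)

lemma sup_abs_random_field_measurable: "(\<lambda>\<omega>. sup_abs (T \<omega>)) \<in> borel_measurable M"
  by (rule sup_abs_measurable[OF random_field_continuous random_field_measurable])

text \<open>The mean of the field is a constant \<open>m\<close>, so Fernique's theorem applies to \<open>T - m\<close>, and \<open>\<bar>m\<bar>\<close> changes the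
  supremum by a bounded amount only.\<close>

theorem exp_sup_abs_integrable:
  assumes "0 \<le> p"
  shows "integrable M (\<lambda>\<omega>. exp (p * sup_abs (T \<omega>)))"
proof -
  obtain x0 where x0: "x0 \<in> S2" using S2_nonempty by blast
  define m where "m = (LINT \<omega>|M. T \<omega> x0)"
  interpret centred_gaussian_family M "\<lambda>x \<omega>. T \<omega> x - m" S2
    unfolding m_def by (rule centred_gaussian_family_random_field[OF x0])
  define Z where "Z \<omega> = sup_abs (\<lambda>x. T \<omega> x - m)" for \<omega>
  have cont': "continuous_on S2 (\<lambda>x. T \<omega> x - m)" if "\<omega> \<in> space M" for \<omega>
    using random_field_continuous[OF that] by (intro continuous_intros)
  have [measurable]: "Z \<in> borel_measurable M"
    unfolding Z_def using random_field_measurable by (intro sup_abs_measurable cont') auto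
  note [measurable] = sup_abs_random_field_measurable
  obtain D :: "(real^3) set" where D: "countable D" "D \<subseteq> S2" "S2 \<subseteq> closure D"
    using separable by blast
  have "integrable M (\<lambda>\<omega>. exp (p * Z \<omega>))"
  proof (rule fernique[OF D(1,2) _ _ assms])
    show "Z \<omega> \<le> t \<longleftrightarrow> (\<forall>x\<in>D. \<bar>T \<omega> x - m\<bar> \<le> t)" if "\<omega> \<in> space M" for \<omega> t
      unfolding Z_def sup_abs_le_iff[OF cont'[OF that]]
      using abs_le_on_dense_iff[OF cont'[OF that] D(2,3)] by auto
  qed simp
  then have "integrable M (\<lambda>\<omega>. exp (p * \<bar>m\<bar>) * exp (p * Z \<omega>))" by simp
  then show ?thesis
  proof (rule Bochner_Integration.integrable_bound)
    show "AE \<omega> in M. norm (exp (p * sup_abs (T \<omega>))) \<le> norm (exp (p * \<bar>m\<bar>) * exp (p * Z \<omega>))"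
    proof (rule AE_I2)
      fix \<omega> assume \<omega>: "\<omega> \<in> space M"
      have "\<bar>T \<omega> x\<bar> \<le> \<bar>m\<bar> + Z \<omega>" if "x \<in> S2" for x
        using abs_le_sup_abs[OF cont'[OF \<omega>] that] unfolding Z_def by linarith
      then have "sup_abs (T \<omega>) \<le> \<bar>m\<bar> + Z \<omega>"
        using sup_abs_le_iff[OF random_field_continuous[OF \<omega>]] by blast
      then have "p * sup_abs (T \<omega>) \<le> p * (\<bar>m\<bar> + Z \<omega>)" using assms by (rule mult_left_mono)
      then show "norm (exp (p * sup_abs (T \<omega>))) \<le> norm (exp (p * \<bar>m\<bar>) * exp (p * Z \<omega>))"
        by (simp add: exp_add[symmetric] distrib_left)
    qed
  qed simp
qed

end

section \<open>Spherical coordinates\<close>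

lemma sph_coord_axis:
  "sph_coord (\<theta>, \<phi>) = (sin \<theta> * cos \<phi>) *\<^sub>R axis 1 1 + (sin \<theta> * sin \<phi>) *\<^sub>R axis 2 1 + cos \<theta> *\<^sub>R axis 3 1"
  by (simp add: sph_coord_def vec_eq_iff forall_3 axis_def)

lemma sph_coord_nth [simp]:
  "sph_coord (\<theta>, \<phi>) $ 1 = sin \<theta> * cos \<phi>" "sph_coord (\<theta>, \<phi>) $ 2 = sin \<theta> * sin \<phi>"
  "sph_coord (\<theta>, \<phi>) $ 3 = cos \<theta>"
  by (simp_all add: sph_coord_def)

lemma sum_squares_S2: "x \<in> S2 \<Longrightarrow> (x $ 1)\<^sup>2 + (x $ 2)\<^sup>2 + (x $ 3)\<^sup>2 = 1"
proof -
  assume "x \<in> S2"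
  then have "x \<bullet> x = 1" by (simp add: dot_square_norm)
  then show ?thesis by (simp add: inner_vec_def sum_3 power2_eq_square)
qed

lemma sph_coord_in_S2: "sph_coord p \<in> S2"
proof -
  obtain \<theta> \<phi> where p: "p = (\<theta>, \<phi>)" by (cases p)
  have "sph_coord p \<bullet> sph_coord p = (sin \<theta>)\<^sup>2 * ((cos \<phi>)\<^sup>2 + (sin \<phi>)\<^sup>2) + (cos \<theta>)\<^sup>2"
    unfolding p inner_vec_def sum_3 sph_coord_nth inner_real_def
    by (simp only: power2_eq_square algebra_simps)
  then have "norm (sph_coord p) = 1" by (simp add: norm_eq_sqrt_inner)
  then show ?thesis by simp
qed

lemma continuous_on_sph_coord: "continuous_on UNIV sph_coord"
proof -
  have "sph_coord = (\<lambda>p. (sin (fst p) * cos (snd p)) *\<^sub>R axis 1 1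
      + (sin (fst p) * sin (snd p)) *\<^sub>R axis 2 1 + cos (fst p) *\<^sub>R axis 3 1)"
    using sph_coord_axis by (auto simp: fun_eq_iff)
  then show ?thesis by (rule ssubst) (intro continuous_intros)
qed

definition sph_density :: "real \<times> real \<Rightarrow> real" where
  "sph_density p = sin (fst p) * indicator {0..pi} (fst p) * indicator {0..<2 * pi} (snd p)"

lemma sph_density_nonneg: "0 \<le> sph_density p"
  by (auto simp: sph_density_def indicator_def intro!: sin_ge_zero)

lemma sph_density_measurable [measurable]: "sph_density \<in> borel_measurable borel"
  unfolding sph_density_def borel_prod[symmetric] by measurable

lemma surf_eq:
  "surf = distr (density lborel (\<lambda>p. ennreal (sph_density p))) (restrict_space borel S2) sph_coord"
proof -
  have "(\<lambda>(\<theta>, \<phi>). ennreal (sin \<theta>) * indicator ({0..pi} \<times> {0..<2 * pi}) (\<theta>, \<phi>))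
      = (\<lambda>p. ennreal (sph_density p))"
    by (auto simp: sph_density_def fun_eq_iff indicator_def)
  then show ?thesis by (simp add: surf_def)
qed

lemma sph_coord_measurable:
  "sph_coord \<in> density lborel (\<lambda>p. ennreal (sph_density p)) \<rightarrow>\<^sub>M restrict_space borel S2"
  using sph_coord_in_S2
  by (intro measurable_restrict_space2) (auto intro: borel_measurable_continuous_onI continuous_on_sph_coord)

lemma finite_measure_surf: "finite_measure surf"
proof (rule finite_measureI)
  have "emeasure surf (space surf) = (\<integral>\<^sup>+p. ennreal (sph_density p) \<partial>lborel)"
    unfolding surf_eq
    by (subst emeasure_distr[OF sph_coord_measurable])
      (use sph_coord_in_S2 in \<open>auto simp: space_restrict_space sets_restrict_space_iff emeasure_density vimage_def\<close>)
  also have "\<dots> \<le> (\<integral>\<^sup>+p. indicator (cbox (0, 0) (pi, 2 * pi)) p \<partial>lborel)"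
  proof (intro nn_integral_mono)
    fix p :: "real \<times> real"
    have "sph_density p \<le> indicator (cbox (0, 0) (pi, 2 * pi)) p"
    proof (cases "p \<in> cbox (0, 0) (pi, 2 * pi)")
      case True
      then show ?thesis by (simp add: sph_density_def indicator_def)
    next
      case False
      then have "sph_density p = 0" by (cases p) (auto simp: sph_density_def cbox_Pair_eq)
      then show ?thesis by simp
    qed
    then show "ennreal (sph_density p) \<le> indicator (cbox (0, 0) (pi, 2 * pi)) p"
      by (metis ennreal_indicator ennreal_leI)
  qed
  also have "\<dots> < \<infinity>" using emeasure_bounded_finite[OF bounded_cbox[of "(0::real, 0::real)" "(pi, 2 * pi)"]] by simp
  finally show "emeasure surf (space surf) \<noteq> \<infinity>" by simp
qed

interpretation surf: finite_measure_on_compact surf S2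
  using finite_measure_surf sets_surf
  by (intro finite_measure_on_compact.intro) (auto intro!: finite_measure_on_compact_axioms.intro)

lemma sq_integrable_surf_eq_L2: "sq_integrable surf = L2"
  by (simp add: sq_integrable_def L2_def)

lemma integrable_surf_continuous: "continuous_on UNIV F \<Longrightarrow> integrable surf (F :: real^3 \<Rightarrow> real)"
  by (intro integrable_sq_integrable finite_measure_surf surf.sq_integrable_continuous)

lemma surf_integral_lborel:
  assumes F: "continuous_on UNIV (F :: real^3 \<Rightarrow> real)"
  shows "integrable (lborel \<Otimes>\<^sub>M lborel) (\<lambda>p. sph_density p * F (sph_coord p))"
    and "(LINT x|surf. F x) = (LINT p|(lborel \<Otimes>\<^sub>M lborel). sph_density p * F (sph_coord p))"
proof -
  have Fm: "F \<in> borel_measurable (restrict_space borel S2)"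
    using F by (intro measurable_restrict_space1 borel_measurable_continuous_onI)
  have FS: "(\<lambda>p. F (sph_coord p)) \<in> borel_measurable lborel"
    using F continuous_on_sph_coord
    by (auto intro!: borel_measurable_continuous_onI continuous_on_compose2[of UNIV F UNIV sph_coord])
  have "integrable surf F" by (rule integrable_surf_continuous[OF F])
  then have "integrable lborel (\<lambda>p. sph_density p * F (sph_coord p))"
    unfolding surf_eq integrable_distr_eq[OF sph_coord_measurable Fm]
    using FS sph_density_nonneg by (subst (asm) integrable_density) auto
  then show "integrable (lborel \<Otimes>\<^sub>M lborel) (\<lambda>p. sph_density p * F (sph_coord p))"
    by (simp add: lborel_prod)
  show "(LINT x|surf. F x) = (LINT p|(lborel \<Otimes>\<^sub>M lborel). sph_density p * F (sph_coord p))"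
    unfolding surf_eq integral_distr[OF sph_coord_measurable Fm] lborel_prod
    using FS sph_density_nonneg by (subst integral_density) auto
qed

lemma integral_half_open_Icc:
  fixes g :: "real \<Rightarrow> real"
  assumes [measurable]: "g \<in> borel_measurable borel"
  shows "(LINT t|lborel. g t * indicator {a..<b} t) = (LINT t|lborel. g t * indicator {a..b} t)"
proof (rule integral_cong_AE)
  show "AE t in lborel. g t * indicator {a..<b} t = g t * indicator {a..b} t"
    using AE_lborel_singleton[of b] by eventually_elim (auto simp: indicator_def)
qed auto

lemma continuous_sph_coord_slice:
  assumes "continuous_on UNIV (F :: real^3 \<Rightarrow> real)"
  shows "continuous_on UNIV (\<lambda>\<phi>. F (sph_coord (\<theta>, \<phi>)))" "continuous_on UNIV (\<lambda>\<theta>. F (sph_coord (\<theta>, \<phi>)))"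
  unfolding sph_coord_axis
  by (intro continuous_on_compose2[OF assms] continuous_intros subset_UNIV)+

lemma surf_integral_circles:
  assumes F: "continuous_on UNIV (F :: real^3 \<Rightarrow> real)"
  defines "I \<equiv> \<lambda>\<theta>. sin \<theta> * indicator {0..pi} \<theta> * (LINT \<phi>|lborel. F (sph_coord (\<theta>, \<phi>)) * indicator {0..2 * pi} \<phi>)"
  shows "integrable lborel I" "(LINT x|surf. F x) = (LINT \<theta>|lborel. I \<theta>)"
proof -
  have [measurable]: "(\<lambda>\<phi>. F (sph_coord (\<theta>, \<phi>))) \<in> borel_measurable borel" for \<theta>
    by (intro borel_measurable_continuous_onI continuous_sph_coord_slice F)
  have I: "(LINT \<phi>|lborel. sph_density (\<theta>, \<phi>) * F (sph_coord (\<theta>, \<phi>))) = I \<theta>" for \<theta>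
  proof -
    have "(LINT \<phi>|lborel. sph_density (\<theta>, \<phi>) * F (sph_coord (\<theta>, \<phi>)))
        = (LINT \<phi>|lborel. (sin \<theta> * indicator {0..pi} \<theta>) * (F (sph_coord (\<theta>, \<phi>)) * indicator {0..<2 * pi} \<phi>))"
      by (intro Bochner_Integration.integral_cong refl) (simp add: sph_density_def)
    also have "\<dots> = I \<theta>" unfolding I_def by (simp add: integral_half_open_Icc)
    finally show ?thesis .
  qed
  note int = surf_integral_lborel[OF F]
  show "integrable lborel I"
    using lborel_pair.integrable_fst'[OF int(1)] by (simp add: I)
  show "(LINT x|surf. F x) = (LINT \<theta>|lborel. I \<theta>)"
    unfolding int(2) using lborel_pair.integral_fst'[OF int(1)] by (simp add: I)
qed

text \<open>Two one-dimensional facts about the surface measure carry the Poincare inequality: this comparison along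
  the circles of latitude, and the integration along the meridians that follows.\<close>

lemma surf_integral_mono_circles:
  assumes F: "continuous_on UNIV F" and G: "continuous_on UNIV (G :: real^3 \<Rightarrow> real)"
    and le: "\<And>\<theta>. 0 \<le> \<theta> \<Longrightarrow> \<theta> \<le> pi \<Longrightarrow> (LINT \<phi>|lborel. F (sph_coord (\<theta>, \<phi>)) * indicator {0..2 * pi} \<phi>)
       \<le> (LINT \<phi>|lborel. G (sph_coord (\<theta>, \<phi>)) * indicator {0..2 * pi} \<phi>)"
  shows "(LINT x|surf. F x) \<le> (LINT x|surf. G x)"
  unfolding surf_integral_circles(2)[OF F] surf_integral_circles(2)[OF G]
proof (rule integral_mono)
  fix \<theta>
  show "sin \<theta> * indicator {0..pi} \<theta> * (LINT \<phi>|lborel. F (sph_coord (\<theta>, \<phi>)) * indicator {0..2 * pi} \<phi>)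
      \<le> sin \<theta> * indicator {0..pi} \<theta> * (LINT \<phi>|lborel. G (sph_coord (\<theta>, \<phi>)) * indicator {0..2 * pi} \<phi>)"
    using le by (cases "0 \<le> \<theta> \<and> \<theta> \<le> pi") (auto intro!: mult_left_mono sin_ge_zero)
qed (rule surf_integral_circles(1)[OF F] surf_integral_circles(1)[OF G])+

text \<open>On a meridian the integrand, weighted by \<open>sin \<theta>\<close>, is the derivative of \<open>- P (cos \<theta>)\<close>.\<close>

lemma surf_integral_zonal:
  fixes P :: "real poly"
  assumes P: "poly P 1 = poly P (- 1)"
  shows "(LINT x|surf. poly (pderiv P) (x $ 3)) = 0"
proof -
  let ?F = "\<lambda>x::real^3. poly (pderiv P) (x $ 3)"
  have F: "continuous_on UNIV ?F" by (intro continuous_intros)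
  note int = surf_integral_lborel[OF F]
  define G where "G p = sph_density p * ?F (sph_coord p)" for p
  have swap: "(LINT x|surf. ?F x) = (LINT \<phi>|lborel. LINT \<theta>|lborel. G (\<theta>, \<phi>))"
    using int lborel_pair.integral_snd[of "\<lambda>\<theta> \<phi>. G (\<theta>, \<phi>)"]
    by (simp add: G_def[symmetric])
  have "(LINT \<theta>|lborel. G (\<theta>, \<phi>)) = 0" for \<phi>
  proof -
    have "(LINT \<theta>|lborel. G (\<theta>, \<phi>))
        = (LINT \<theta>|lborel. indicator {0..<2 * pi} \<phi> * ((poly (pderiv P) (cos \<theta>) * sin \<theta>) * indicator {0..pi} \<theta>))"
      by (intro Bochner_Integration.integral_cong refl) (simp add: G_def sph_density_def)
    also have "\<dots> = indicator {0..<2 * pi} \<phi> * (LINT \<theta>|lborel. (poly (pderiv P) (cos \<theta>) * sin \<theta>) * indicator {0..pi} \<theta>)"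
      by simp
    also have "(LINT \<theta>|lborel. (poly (pderiv P) (cos \<theta>) * sin \<theta>) * indicator {0..pi} \<theta>)
        = - poly P (cos pi) - - poly P (cos 0)"
    proof (rule integral_FTC_Icc_real)
      show "DERIV (\<lambda>\<theta>. - poly P (cos \<theta>)) \<theta> :> poly (pderiv P) (cos \<theta>) * sin \<theta>" for \<theta>
        by (auto intro!: derivative_eq_intros DERIV_chain2[OF poly_DERIV])
      show "isCont (\<lambda>\<theta>. poly (pderiv P) (cos \<theta>) * sin \<theta>) \<theta>" for \<theta>
        by (intro continuous_intros)
    qed simp
    finally show ?thesis using P by simp
  qed
  then show ?thesis using swap by simp
qed

section \<open>Polynomial tangential fields\<close>

lemma real_polynomial_has_derivative:
  fixes p :: "'a::real_normed_vector \<Rightarrow> real"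
  assumes "real_polynomial_function p"
  shows "\<exists>D. (\<forall>x. (p has_derivative D x) (at x)) \<and> (\<forall>h. real_polynomial_function (\<lambda>x. D x h))"
  using assms
proof (induction rule: real_polynomial_function.induct)
  case (linear f)
  then show ?case
    by (intro exI[of _ "\<lambda>x. f"]) (auto intro: bounded_linear_imp_has_derivative real_polynomial_function.intros)
next
  case (const c)
  then show ?case
    by (intro exI[of _ "\<lambda>x h. 0"]) (auto intro: real_polynomial_function.intros)
next
  case (add f g)
  then obtain D E where "\<forall>x. (f has_derivative D x) (at x)" "\<forall>h. real_polynomial_function (\<lambda>x. D x h)"
    "\<forall>x. (g has_derivative E x) (at x)" "\<forall>h. real_polynomial_function (\<lambda>x. E x h)" by blast
  then show ?case
    by (intro exI[of _ "\<lambda>x h. D x h + E x h"]) (auto intro: has_derivative_add real_polynomial_function.intros)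
next
  case (mult f g)
  then obtain D E where "\<forall>x. (f has_derivative D x) (at x)" "\<forall>h. real_polynomial_function (\<lambda>x. D x h)"
    "\<forall>x. (g has_derivative E x) (at x)" "\<forall>h. real_polynomial_function (\<lambda>x. E x h)" by blast
  then show ?case using mult.hyps
    by (intro exI[of _ "\<lambda>x h. f x * E x h + D x h * g x"] conjI allI
        real_polynomial_function.intros(3,4) has_derivative_mult) simp_all
qed

lemma real_polynomial_frechet_derivative:
  assumes "real_polynomial_function p"
  shows "(p has_derivative frechet_derivative p (at x)) (at x)"
    and "real_polynomial_function (\<lambda>x. frechet_derivative p (at x) h)"
proof -
  obtain D where D: "\<And>x. (p has_derivative D x) (at x)" "\<And>h. real_polynomial_function (\<lambda>x. D x h)"
    using real_polynomial_has_derivative[OF assms] by blast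
  have eq: "frechet_derivative p (at x) = D x" for x using frechet_derivative_at[OF D(1)] by simp
  show "(p has_derivative frechet_derivative p (at x)) (at x)"
    "real_polynomial_function (\<lambda>x. frechet_derivative p (at x) h)"
    unfolding eq using D by auto
qed

lemma polynomial_function_vec_iff:
  "polynomial_function (\<Phi> :: 'a::real_normed_vector \<Rightarrow> real^'n) \<longleftrightarrow> (\<forall>i. real_polynomial_function (\<lambda>x. \<Phi> x $ i))"
  unfolding polynomial_function_iff_Basis_inner by (auto simp: Basis_vec_def inner_axis)

lemma has_derivative_vec_nth:
  "(\<Phi> has_derivative D) F \<Longrightarrow> ((\<lambda>x. \<Phi> x $ i) has_derivative (\<lambda>h. D h $ i)) F"
  by (rule bounded_linear.has_derivative[OF bounded_linear_vec_nth])

lemma polynomial_function_frechet_derivative: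
  fixes \<Phi> :: "real^3 \<Rightarrow> real^3"
  assumes "polynomial_function \<Phi>"
  shows "(\<Phi> has_derivative frechet_derivative \<Phi> (at x)) (at x)"
    and "polynomial_function (\<lambda>x. frechet_derivative \<Phi> (at x) h)"
proof -
  show der: "(\<Phi> has_derivative frechet_derivative \<Phi> (at x)) (at x)" for x
    using differentiable_at_polynomial_function[OF assms] frechet_derivative_works by blast
  have "real_polynomial_function (\<lambda>x. frechet_derivative \<Phi> (at x) h $ i)" for i
  proof -
    have p: "real_polynomial_function (\<lambda>x. \<Phi> x $ i)" using assms by (simp add: polynomial_function_vec_iff)
    have "frechet_derivative (\<lambda>x. \<Phi> x $ i) (at x) = (\<lambda>h. frechet_derivative \<Phi> (at x) h $ i)" for x
      using frechet_derivative_at[OF has_derivative_vec_nth[OF der]] by simp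
    then show ?thesis using real_polynomial_frechet_derivative(2)[OF p, of h] by simp
  qed
  then show "polynomial_function (\<lambda>x. frechet_derivative \<Phi> (at x) h)"
    by (simp add: polynomial_function_vec_iff)
qed

text \<open>Polynomial maps are closed under partial derivatives.\<close>

lemma C_k_polynomial_function: "polynomial_function \<Phi> \<Longrightarrow> C_k k \<Phi>"
proof (induction k arbitrary: \<Phi>)
  case 0
  then show ?case by (simp add: continuous_on_polymonial_function)
next
  case (Suc k)
  then show ?case
    by (auto intro: polynomial_function_frechet_derivative differentiable_on_polynomial_function)
qed

lemma tangential_test_fieldsI:
  "polynomial_function \<Phi> \<Longrightarrow> (\<And>x. x \<in> S2 \<Longrightarrow> \<Phi> x \<bullet> x = 0) \<Longrightarrow> \<Phi> \<in> tangential_test_fields"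
  by (simp add: tangential_test_fields_def C_k_polynomial_function)

lemma sum_Basis_3: "(\<Sum>b\<in>(Basis :: (real^3) set). g b) = g (axis 1 1) + g (axis 2 1) + g (axis 3 1)"
proof -
  have B: "(Basis :: (real^3) set) = range (\<lambda>i. axis i 1)" by (auto simp: Basis_vec_def)
  have inj: "inj (\<lambda>i::3. axis i (1::real))" by (auto simp: inj_on_def axis_eq_axis)
  have "(\<Sum>b\<in>(Basis :: (real^3) set). g b) = (\<Sum>i\<in>UNIV. g (axis i 1))"
    unfolding B sum.reindex[OF inj] by simp
  then show ?thesis by (simp add: sum_3)
qed

lemma surf_div_eq:
  assumes "(\<Phi> has_derivative D) (at x)"
  shows "surf_div \<Phi> x = D (axis 1 1) $ 1 + D (axis 2 1) $ 2 + D (axis 3 1) $ 3 - D x \<bullet> x"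
  using frechet_derivative_at[OF assms]
  by (simp add: surf_div_def sum_Basis_3 inner_axis)

text \<open>The velocity field of the rotations about the third axis.\<close>

definition rot :: "real^3 \<Rightarrow> real^3" where
  "rot x = x $ 1 *\<^sub>R axis 2 1 - x $ 2 *\<^sub>R axis 1 1"

definition rot_deriv :: "(real^3 \<Rightarrow> real) \<Rightarrow> real^3 \<Rightarrow> real" where
  "rot_deriv \<psi> x = frechet_derivative \<psi> (at x) (rot x)"

lemma rot_nth [simp]: "rot x $ 1 = - (x $ 2)" "rot x $ 2 = x $ 1" "rot x $ 3 = 0"
  by (simp_all add: rot_def axis_def)

lemma bounded_linear_rot: "bounded_linear rot"
  unfolding rot_def[abs_def]
  by (intro bounded_linear_sub bounded_linear_scaleR_const bounded_linear_vec_nth)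

lemma rot_inner_self: "rot x \<bullet> x = 0"
  by (simp add: inner_vec_def sum_3)

lemma linear_decompose_3:
  assumes "linear (D :: real^3 \<Rightarrow> real)"
  shows "D v = v $ 1 * D (axis 1 1) + v $ 2 * D (axis 2 1) + v $ 3 * D (axis 3 1)"
proof -
  have "v = v $ 1 *\<^sub>R axis 1 1 + v $ 2 *\<^sub>R axis 2 1 + v $ 3 *\<^sub>R axis 3 1"
    by (simp add: vec_eq_iff forall_3 axis_def)
  then have "D v = D (v $ 1 *\<^sub>R axis 1 1 + v $ 2 *\<^sub>R axis 2 1 + v $ 3 *\<^sub>R axis 3 1)" by simp
  then show ?thesis using assms by (simp add: linear_add linear_scale)
qed

lemma rot_deriv_eq:
  assumes "(\<psi> has_derivative D) (at x)"
  shows "rot_deriv \<psi> x = x $ 1 * D (axis 2 1) - x $ 2 * D (axis 1 1)"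
proof -
  have "rot_deriv \<psi> x = D (rot x)" unfolding rot_deriv_def using frechet_derivative_at[OF assms] by simp
  then show ?thesis
    using linear_decompose_3[of D "rot x"] has_derivative_linear[OF assms] by simp
qed

lemma polynomial_coordinate [intro]: "real_polynomial_function (\<lambda>x::real^'n. x $ i)"
  by (intro real_polynomial_function.intros(1) bounded_linear_vec_nth)

lemma rot_deriv_polynomial:
  assumes "real_polynomial_function \<psi>"
  shows "real_polynomial_function (rot_deriv \<psi>)"
proof -
  have "rot_deriv \<psi> = (\<lambda>x. x $ 1 * frechet_derivative \<psi> (at x) (axis 2 1) - x $ 2 * frechet_derivative \<psi> (at x) (axis 1 1))"
    using rot_deriv_eq[OF real_polynomial_frechet_derivative(1)[OF assms]] by auto
  moreover have "real_polynomial_function \<dots>"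
    using real_polynomial_frechet_derivative(2)[OF assms]
    by (intro real_polynomial_function_diff real_polynomial_function.intros(4) polynomial_coordinate) auto
  ultimately show ?thesis by simp
qed

lemma polynomial_function_rot: "polynomial_function rot"
  by (rule polynomial_function_bounded_linear[OF bounded_linear_rot])

text \<open>Rotations preserve area, so the divergence of a multiple of their velocity field is the derivative of the
  factor alone.\<close>

lemma rot_field:
  assumes \<psi>: "real_polynomial_function \<psi>"
  shows "(\<lambda>x. \<psi> x *\<^sub>R rot x) \<in> tangential_test_fields"
    and "surf_div (\<lambda>x. \<psi> x *\<^sub>R rot x) x = rot_deriv \<psi> x"
proof -
  have "polynomial_function (\<lambda>x. \<psi> x *\<^sub>R rot x)"
    using \<psi> polynomial_function_rot by (intro polynomial_function_mult) (simp_all add: real_polynomial_function_eq)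
  then show "(\<lambda>x. \<psi> x *\<^sub>R rot x) \<in> tangential_test_fields"
    by (rule tangential_test_fieldsI) (simp add: rot_inner_self)
  let ?D = "frechet_derivative \<psi> (at x)"
  note der = real_polynomial_frechet_derivative(1)[OF \<psi>, of x]
  have "((\<lambda>x. \<psi> x *\<^sub>R rot x) has_derivative (\<lambda>h. \<psi> x *\<^sub>R rot h + ?D h *\<^sub>R rot x)) (at x)"
    by (rule has_derivative_scaleR[OF der bounded_linear_imp_has_derivative[OF bounded_linear_rot]])
  from surf_div_eq[OF this] show "surf_div (\<lambda>x. \<psi> x *\<^sub>R rot x) x = rot_deriv \<psi> x"
    by (simp add: inner_add_left rot_inner_self rot_deriv_eq[OF der]) (simp add: axis_def)
qed

lemma real_polynomial_function_poly_nth [intro]: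
  "real_polynomial_function (\<lambda>x::real^'n. poly q (x $ i))"
proof (induction q)
  case (pCons a q)
  then show ?case
    unfolding poly_pCons
    by (intro real_polynomial_function.intros(3,4) polynomial_coordinate) (simp_all add: real_polynomial_function.intros(2))
qed (simp add: real_polynomial_function.intros(2))

text \<open>The field is a multiple of the gradient \<open>e\<^sub>3 - x\<^sub>3 x\<close> of the height, and \<open>[:1, 0, -1:]\<close> is \<open>1 - z\<^sup>2\<close>, the
  squared length of that gradient at height \<open>z\<close>.\<close>

lemma zonal_field:
  fixes q :: "real poly"
  defines "\<Phi> \<equiv> \<lambda>x::real^3. poly q (x $ 3) *\<^sub>R (axis 3 1 - x $ 3 *\<^sub>R x)"
  shows "\<Phi> \<in> tangential_test_fields"
    and "x \<in> S2 \<Longrightarrow> surf_div \<Phi> x = poly (pderiv ([:1, 0, -1:] * q)) (x $ 3)"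
proof -
  have "real_polynomial_function (\<lambda>x. \<Phi> x $ i)" for i
    unfolding \<Phi>_def
    by (auto intro!: real_polynomial_function.intros(3,4) real_polynomial_function_diff)
  then have "polynomial_function \<Phi>" by (simp add: polynomial_function_vec_iff)
  then show "\<Phi> \<in> tangential_test_fields"
  proof (rule tangential_test_fieldsI)
    fix x :: "real^3" assume "x \<in> S2"
    then have "x \<bullet> x = 1" by (simp add: dot_square_norm)
    then show "\<Phi> x \<bullet> x = 0" by (simp add: \<Phi>_def inner_diff_left inner_axis')
  qed
  assume x: "x \<in> S2"
  have xx: "x \<bullet> x = 1" using x by (simp add: dot_square_norm)
  define z where "z = x $ 3"
  have "((\<lambda>x. x $ 3) has_derivative (\<lambda>h. h $ 3)) (at x)"
    by (intro bounded_linear_imp_has_derivative bounded_linear_vec_nth)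
  then have q: "((\<lambda>x. poly q (x $ 3)) has_derivative (\<lambda>h. h $ 3 * poly (pderiv q) z)) (at x)"
    using DERIV_compose_FDERIV[OF poly_DERIV] by (simp add: z_def)
  have "((\<lambda>x. axis 3 1 - x $ 3 *\<^sub>R x) has_derivative (\<lambda>h. - (z *\<^sub>R h + h $ 3 *\<^sub>R x))) (at x)"
    unfolding z_def
    by (auto intro!: derivative_eq_intros bounded_linear_imp_has_derivative bounded_linear_vec_nth)
  from has_derivative_scaleR[OF q this]
  have "(\<Phi> has_derivative (\<lambda>h. poly q z *\<^sub>R (- (z *\<^sub>R h + h $ 3 *\<^sub>R x))
      + (h $ 3 * poly (pderiv q) z) *\<^sub>R (axis 3 1 - z *\<^sub>R x))) (at x)"
    by (simp add: \<Phi>_def z_def)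
  note div = surf_div_eq[OF this]
  have "(poly q z *\<^sub>R (- (z *\<^sub>R x + x $ 3 *\<^sub>R x)) + (x $ 3 * poly (pderiv q) z) *\<^sub>R (axis 3 1 - z *\<^sub>R x)) \<bullet> x
      = - 2 * z * poly q z"
    by (simp only: inner_add_left inner_minus_left inner_diff_left inner_scaleR_left inner_axis' xx z_def[symmetric])
      (simp add: z_def[symmetric] algebra_simps)
  note div = div[unfolded this]
  have pd: "poly (pderiv ([:1, 0, -1:] * q)) z = (1 - z\<^sup>2) * poly (pderiv q) z - 2 * z * poly q z"
    by (simp only: pderiv_mult) (simp add: pderiv_pCons power2_eq_square algebra_simps)
  show "surf_div \<Phi> x = poly (pderiv ([:1, 0, -1:] * q)) (x $ 3)"
    unfolding z_def[symmetric] pd div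
    by (simp add: axis_def z_def[symmetric] power2_eq_square algebra_simps)
qed

text \<open>Tangential parts of polynomial fields; a tangential field is tested with them as with the coordinate
  fields themselves.\<close>

lemma projected_field:
  assumes "real_polynomial_function p"
  shows "(\<lambda>x. p x *\<^sub>R (axis i 1 - x $ i *\<^sub>R x)) \<in> tangential_test_fields"
proof (rule tangential_test_fieldsI)
  show "polynomial_function (\<lambda>x. p x *\<^sub>R (axis i 1 - x $ i *\<^sub>R x))"
    unfolding polynomial_function_vec_iff using assms
    by (auto intro!: real_polynomial_function.intros(3,4) real_polynomial_function_diff)
  fix x :: "real^3" assume "x \<in> S2"
  then have "x \<bullet> x = 1" by (simp add: dot_square_norm)
  then show "(p x *\<^sub>R (axis i 1 - x $ i *\<^sub>R x)) \<bullet> x = 0" by (simp add: inner_diff_left inner_axis')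
qed

lemma continuous_on_surf_div:
  assumes "\<Phi> \<in> tangential_test_fields"
  shows "continuous_on UNIV (surf_div \<Phi>)"
proof -
  have "C_k 1 \<Phi>" using assms unfolding tangential_test_fields_def by blast
  then have diff: "\<Phi> differentiable (at x)" and cont: "continuous_on UNIV (\<lambda>x. frechet_derivative \<Phi> (at x) (axis i 1))" for x i
    by (auto simp: differentiable_on_def)
  have "frechet_derivative \<Phi> (at x) x = (\<Sum>i\<in>UNIV. x $ i *\<^sub>R frechet_derivative \<Phi> (at x) (axis i 1))" for x
  proof -
    have "linear (frechet_derivative \<Phi> (at x))" using diff by (rule linear_frechet_derivative)
    moreover have "x = (\<Sum>i\<in>UNIV. x $ i *\<^sub>R axis i 1)" by (simp add: basis_expansion[symmetric] scalar_mult_eq_scaleR[symmetric])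
    ultimately show ?thesis by (metis (no_types, lifting) linear_sum linear_scale sum.cong)
  qed
  then have "surf_div \<Phi> = (\<lambda>x. (\<Sum>i\<in>UNIV. frechet_derivative \<Phi> (at x) (axis i 1) \<bullet> axis i 1)
      - (\<Sum>i\<in>UNIV. x $ i *\<^sub>R frechet_derivative \<Phi> (at x) (axis i 1)) \<bullet> x)"
    by (simp add: surf_div_def sum_Basis_3 sum_3 fun_eq_iff)
  moreover have "continuous_on UNIV \<dots>" by (intro continuous_intros cont)
  ultimately show ?thesis by simp
qed

lemma continuous_on_test_field: "\<Phi> \<in> tangential_test_fields \<Longrightarrow> continuous_on UNIV \<Phi>"
  unfolding tangential_test_fields_def by (metis (no_types, lifting) C_k.simps(1) mem_Collect_eq)

section \<open>Polynomials as divergences\<close>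

definition mono3 :: "nat \<Rightarrow> nat \<Rightarrow> nat \<Rightarrow> real^3 \<Rightarrow> real" where
  "mono3 i j k x = (x $ 1) ^ i * (x $ 2) ^ j * (x $ 3) ^ k"

inductive mono_sum :: "(real^3 \<Rightarrow> real) \<Rightarrow> bool" where
  "mono_sum (\<lambda>x. c * mono3 i j k x)"
| "mono_sum f \<Longrightarrow> mono_sum g \<Longrightarrow> mono_sum (\<lambda>x. f x + g x)"

lemma mono_sum_mult_mono: "mono_sum f \<Longrightarrow> mono_sum (\<lambda>x. f x * (c * mono3 i j k x))"
proof (induction rule: mono_sum.induct)
  case (1 d i' j' k')
  have "(\<lambda>x. d * mono3 i' j' k' x * (c * mono3 i j k x)) = (\<lambda>x. (d * c) * mono3 (i' + i) (j' + j) (k' + k) x)"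
    by (auto simp: mono3_def power_add)
  then show ?case by (simp only: mono_sum.intros(1))
next
  case (2 f g)
  then show ?case by (simp only: distrib_right mono_sum.intros(2))
qed

lemma mono_sum_mult: "mono_sum g \<Longrightarrow> mono_sum f \<Longrightarrow> mono_sum (\<lambda>x. f x * g x)"
proof (induction rule: mono_sum.induct)
  case (1 c i j k)
  then show ?case by (rule mono_sum_mult_mono)
next
  case (2 g h)
  then show ?case by (simp only: distrib_left mono_sum.intros(2))
qed

lemma real_polynomial_mono_sum: "real_polynomial_function f \<Longrightarrow> mono_sum f"
proof (induction rule: real_polynomial_function.induct)
  case (linear f)
  have "f = (\<lambda>x. (f (axis 1 1) * mono3 1 0 0 x + f (axis 2 1) * mono3 0 1 0 x) + f (axis 3 1) * mono3 0 0 1 x)"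
    by (rule ext, subst linear_decompose_3[OF bounded_linear.linear[OF linear]])
      (simp add: mono3_def mult.commute)
  moreover have "mono_sum \<dots>" by (intro mono_sum.intros)
  ultimately show ?case by simp
next
  case (const c)
  then show ?case using mono_sum.intros(1)[of c 0 0 0] by (simp add: mono3_def)
next
  case (add f g)
  then show ?case by (intro mono_sum.intros)
next
  case (mult f g)
  then show ?case by (intro mono_sum_mult)
qed

text \<open>On the sphere, \<open>f\<close> is a derivative along the rotations up to a function of the height.\<close>

definition rot_decomposable :: "(real^3 \<Rightarrow> real) \<Rightarrow> bool" where
  "rot_decomposable f \<longleftrightarrow>
     (\<exists>\<psi> q. real_polynomial_function \<psi> \<and> (\<forall>x\<in>S2. f x = rot_deriv \<psi> x + poly q (x $ 3)))"

lemma rot_deriv_add: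
  assumes f: "real_polynomial_function f" and g: "real_polynomial_function g"
  shows "rot_deriv (\<lambda>x. f x + g x) x = rot_deriv f x + rot_deriv g x"
proof -
  note D = real_polynomial_frechet_derivative(1)
  show ?thesis
    unfolding rot_deriv_eq[OF has_derivative_add[OF D[OF f] D[OF g]]] rot_deriv_eq[OF D[OF f]] rot_deriv_eq[OF D[OF g]]
    by (simp add: algebra_simps)
qed

lemma rot_deriv_mult:
  assumes f: "real_polynomial_function f" and g: "real_polynomial_function g"
  shows "rot_deriv (\<lambda>x. f x * g x) x = f x * rot_deriv g x + rot_deriv f x * g x"
proof -
  note D = real_polynomial_frechet_derivative(1)
  show ?thesis
    unfolding rot_deriv_eq[OF has_derivative_mult[OF D[OF f] D[OF g]]] rot_deriv_eq[OF D[OF f]] rot_deriv_eq[OF D[OF g]]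
    by (simp add: algebra_simps)
qed

lemma rot_deriv_cmult:
  assumes f: "real_polynomial_function f"
  shows "rot_deriv (\<lambda>x. c * f x) x = c * rot_deriv f x"
proof -
  note D = real_polynomial_frechet_derivative(1)
  show ?thesis
    unfolding rot_deriv_eq[OF has_derivative_mult_right[OF D[OF f]]] rot_deriv_eq[OF D[OF f]]
    by (simp add: algebra_simps)
qed

lemma rot_deriv_zonal: "rot_deriv (\<lambda>x. poly q (x $ 3)) x = 0"
proof -
  have "((\<lambda>x::real^3. x $ 3) has_derivative (\<lambda>h. h $ 3)) (at x)"
    by (intro bounded_linear_imp_has_derivative bounded_linear_vec_nth)
  then have "((\<lambda>x::real^3. poly q (x $ 3)) has_derivative (\<lambda>h. h $ 3 * poly (pderiv q) (x $ 3))) (at x)"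
    by (rule DERIV_compose_FDERIV[OF poly_DERIV])
  from rot_deriv_eq[OF this] show ?thesis by (simp add: axis_def)
qed

lemma mono3_polynomial: "real_polynomial_function (mono3 i j k)"
  unfolding mono3_def[abs_def]
  by (intro real_polynomial_function.intros(4) real_polynomial_function_power polynomial_coordinate)

lemma rot_deriv_mono3:
  "rot_deriv (mono3 i j k) x
     = real j * ((x $ 1) ^ (i + 1) * (x $ 2) ^ (j - 1) * (x $ 3) ^ k)
     - real i * ((x $ 1) ^ (i - 1) * (x $ 2) ^ (j + 1) * (x $ 3) ^ k)"
proof -
  have c: "((\<lambda>x. x $ l) has_derivative (\<lambda>h. h $ l)) (at x)" for l :: 3
    by (intro bounded_linear_imp_has_derivative bounded_linear_vec_nth)
  have "(mono3 i j k has_derivative (\<lambda>h.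
      (x $ 1) ^ i * (x $ 2) ^ j * (real k * h $ 3 * (x $ 3) ^ (k - 1))
      + ((x $ 1) ^ i * (real j * h $ 2 * (x $ 2) ^ (j - 1)) + real i * h $ 1 * (x $ 1) ^ (i - 1) * (x $ 2) ^ j) * (x $ 3) ^ k)) (at x)"
    unfolding mono3_def[abs_def]
    by (rule derivative_eq_intros c refl | simp add: fun_eq_iff algebra_simps)+
  from rot_deriv_eq[OF this] show ?thesis
    by (simp add: axis_def)
qed

lemma rot_decomposable_add:
  assumes "rot_decomposable f" "rot_decomposable g"
  shows "rot_decomposable (\<lambda>x. f x + g x)"
proof -
  obtain \<psi> q \<psi>' q' where "real_polynomial_function \<psi>" "\<forall>x\<in>S2. f x = rot_deriv \<psi> x + poly q (x $ 3)"
    "real_polynomial_function \<psi>'" "\<forall>x\<in>S2. g x = rot_deriv \<psi>' x + poly q' (x $ 3)"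
    using assms unfolding rot_decomposable_def by blast
  then show ?thesis unfolding rot_decomposable_def
    by (intro exI[of _ "\<lambda>x. \<psi> x + \<psi>' x"] exI[of _ "q + q'"])
      (auto simp: rot_deriv_add intro: real_polynomial_function.intros)
qed

lemma rot_decomposable_cmult:
  assumes "rot_decomposable f"
  shows "rot_decomposable (\<lambda>x. c * f x)"
proof -
  obtain \<psi> q where "real_polynomial_function \<psi>" "\<forall>x\<in>S2. f x = rot_deriv \<psi> x + poly q (x $ 3)"
    using assms unfolding rot_decomposable_def by blast
  then show ?thesis unfolding rot_decomposable_def
    by (intro exI[of _ "\<lambda>x. c * \<psi> x"] exI[of _ "smult c q"])
      (auto simp: rot_deriv_cmult algebra_simps intro: real_polynomial_function.intros)
qed

lemma rot_decomposable_cong: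
  "rot_decomposable f \<Longrightarrow> (\<And>x. x \<in> S2 \<Longrightarrow> g x = f x) \<Longrightarrow> rot_decomposable g"
  unfolding rot_decomposable_def by metis

lemma rot_decomposable_rot_deriv: "real_polynomial_function \<psi> \<Longrightarrow> rot_decomposable (rot_deriv \<psi>)"
  unfolding rot_decomposable_def by (intro exI[of _ \<psi>] exI[of _ 0]) auto

text \<open>The rotational derivative of \<open>x\<^sub>1\<^bsup>m+1\<^esup> x\<^sub>2 x\<^sub>3\<^sup>k\<close> is \<open>x\<^sub>1\<^bsup>m+2\<^esup> x\<^sub>3\<^sup>k - (m + 1) x\<^sub>1\<^sup>m x\<^sub>2\<^sup>2 x\<^sub>3\<^sup>k\<close>. Eliminating
  \<open>x\<^sub>2\<^sup>2\<close> by the equation of the sphere leaves \<open>(m + 2) x\<^sub>1\<^bsup>m+2\<^esup> x\<^sub>3\<^sup>k\<close> and monomials with exponent \<open>m\<close> of \<open>x\<^sub>1\<close>.\<close>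

lemma rot_decomposable_mono_0: "rot_decomposable (mono3 i 0 k)"
proof (induction i arbitrary: k rule: less_induct)
  case (less i)
  consider "i = 0" | "i = 1" | m where "i = Suc (Suc m)" by (metis One_nat_def not0_implies_Suc)
  then show ?case
  proof cases
    case 1
    have "mono3 0 0 k x = rot_deriv (\<lambda>x. poly 0 (x $ 3)) x + poly (monom 1 k) (x $ 3)" for x
      unfolding rot_deriv_zonal by (simp add: mono3_def poly_monom)
    then show ?thesis unfolding rot_decomposable_def 1
      by (intro exI[of _ "\<lambda>x. poly 0 (x $ 3)"] exI[of _ "monom 1 k"]) auto
  next
    case 2
    have "rot_decomposable (rot_deriv (mono3 0 1 k))" by (intro rot_decomposable_rot_deriv mono3_polynomial)
    then show ?thesis unfolding 2
      by (rule rot_decomposable_cong) (simp add: rot_deriv_mono3, simp add: mono3_def)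
  next
    case (3 m)
    have "rot_decomposable (\<lambda>x. 1 / real (m + 2) * ((rot_deriv (mono3 (m + 1) 1 k) x + real (m + 1) * mono3 m 0 k x)
        + (- real (m + 1)) * mono3 m 0 (k + 2) x))"
      using less.IH[of m] unfolding 3
      by (intro rot_decomposable_cmult rot_decomposable_add rot_decomposable_rot_deriv mono3_polynomial) auto
    then show ?thesis unfolding 3
    proof (rule rot_decomposable_cong)
      fix x :: "real^3" assume "x \<in> S2"
      then have 2: "(x $ 2)\<^sup>2 = 1 - (x $ 1)\<^sup>2 - (x $ 3)\<^sup>2" using sum_squares_S2[of x] by simp
      define a b c where "a = x $ 1" and "b = x $ 2" and "c = x $ 3"
      have "rot_deriv (mono3 (m + 1) 1 k) x = a ^ (m + 2) * c ^ k - real (m + 1) * (a ^ m * b\<^sup>2 * c ^ k)"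
        unfolding rot_deriv_mono3 a_def b_def c_def by (simp add: power2_eq_square)
      also have "b\<^sup>2 = 1 - a\<^sup>2 - c\<^sup>2" using 2 by (simp add: a_def b_def c_def)
      finally have r: "rot_deriv (mono3 (m + 1) 1 k) x = a ^ (m + 2) * c ^ k - real (m + 1) * (a ^ m * (1 - a\<^sup>2 - c\<^sup>2) * c ^ k)" .
      have "(rot_deriv (mono3 (m + 1) 1 k) x + real (m + 1) * mono3 m 0 k x) + (- real (m + 1)) * mono3 m 0 (k + 2) x
          = real (m + 2) * (a ^ (m + 2) * c ^ k)"
        unfolding r unfolding mono3_def a_def[symmetric] b_def[symmetric] c_def[symmetric]
        by (simp add: power_add power2_eq_square) (simp add: algebra_simps)
      then show "mono3 (Suc (Suc m)) 0 k x = 1 / real (m + 2) * ((rot_deriv (mono3 (m + 1) 1 k) x + real (m + 1) * mono3 m 0 k x)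
        + (- real (m + 1)) * mono3 m 0 (k + 2) x)"
        by (simp only:) (simp add: mono3_def a_def c_def)
    qed
  qed
qed

text \<open>The equation of the sphere lowers the exponent of \<open>x\<^sub>2\<close> to zero or one.\<close>

lemma rot_decomposable_mono: "rot_decomposable (mono3 i j k)"
proof (induction j arbitrary: i k rule: less_induct)
  case (less j)
  consider "j = 0" | "j = 1" | n where "j = Suc (Suc n)" by (metis One_nat_def not0_implies_Suc)
  then show ?case
  proof cases
    case 1
    then show ?thesis by (simp add: rot_decomposable_mono_0)
  next
    case 2
    have "rot_decomposable (\<lambda>x. - (1 / real (i + 1)) * rot_deriv (mono3 (i + 1) 0 k) x)"
      by (intro rot_decomposable_cmult rot_decomposable_rot_deriv mono3_polynomial)
    then show ?thesis unfolding 2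
      by (rule rot_decomposable_cong) (simp add: rot_deriv_mono3, simp add: mono3_def field_simps)
  next
    case (3 n)
    have "rot_decomposable (\<lambda>x. (mono3 i n k x + (- 1) * mono3 (i + 2) n k x) + (- 1) * mono3 i n (k + 2) x)"
      using less.IH[of n] unfolding 3 by (intro rot_decomposable_add rot_decomposable_cmult) auto
    then show ?thesis unfolding 3
    proof (rule rot_decomposable_cong)
      fix x :: "real^3" assume "x \<in> S2"
      then have 2: "(x $ 2)\<^sup>2 = 1 - (x $ 1)\<^sup>2 - (x $ 3)\<^sup>2" using sum_squares_S2[of x] by simp
      have "mono3 i (Suc (Suc n)) k x = (x $ 1) ^ i * ((x $ 2) ^ n * (x $ 2)\<^sup>2) * (x $ 3) ^ k"
        by (simp add: mono3_def power2_eq_square)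
      then show "mono3 i (Suc (Suc n)) k x = (mono3 i n k x + (- 1) * mono3 (i + 2) n k x) + (- 1) * mono3 i n (k + 2) x"
        unfolding 2 by (simp add: mono3_def power_add power2_eq_square algebra_simps)
    qed
  qed
qed

lemma rot_decomposable_polynomial:
  assumes "real_polynomial_function f"
  shows "rot_decomposable f"
proof -
  have "mono_sum f" using assms by (rule real_polynomial_mono_sum)
  then show ?thesis
    by (induction rule: mono_sum.induct)
      (auto intro: rot_decomposable_cmult rot_decomposable_mono rot_decomposable_add)
qed

text \<open>Decomposing \<open>\<psi>\<close> once more and subtracting its zonal part, which rotations do not see, makes \<open>\<psi>\<close> itself
  a rotational derivative. Hence \<open>\<psi>\<close> has mean zero on each circle of latitude, as the bound of \<open>\<psi>\<close>
  by its derivative requires.\<close>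

lemma polynomial_rot_decomposition:
  assumes f: "real_polynomial_function f"
  obtains \<psi> \<eta> q where "real_polynomial_function \<psi>" "real_polynomial_function \<eta>"
    "\<And>x. x \<in> S2 \<Longrightarrow> f x = rot_deriv \<psi> x + poly q (x $ 3)" "\<And>x. x \<in> S2 \<Longrightarrow> \<psi> x = rot_deriv \<eta> x"
proof -
  obtain \<psi> q where \<psi>: "real_polynomial_function \<psi>" "\<And>x. x \<in> S2 \<Longrightarrow> f x = rot_deriv \<psi> x + poly q (x $ 3)"
    using rot_decomposable_polynomial[OF f] unfolding rot_decomposable_def by blast
  obtain \<eta> r where \<eta>: "real_polynomial_function \<eta>" "\<And>x. x \<in> S2 \<Longrightarrow> \<psi> x = rot_deriv \<eta> x + poly r (x $ 3)"
    using rot_decomposable_polynomial[OF \<psi>(1)] unfolding rot_decomposable_def by blast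
  define \<psi>' where "\<psi>' x = \<psi> x + poly (- r) (x $ 3)" for x
  have "real_polynomial_function \<psi>'" unfolding \<psi>'_def
    using \<psi>(1) by (intro real_polynomial_function.intros(3) real_polynomial_function_poly_nth)
  moreover have "rot_deriv \<psi>' x = rot_deriv \<psi> x" for x
    unfolding \<psi>'_def rot_deriv_add[OF \<psi>(1) real_polynomial_function_poly_nth] rot_deriv_zonal by simp
  moreover have "\<psi>' x = rot_deriv \<eta> x" if "x \<in> S2" for x
    using \<eta>(2)[OF that] by (simp add: \<psi>'_def)
  ultimately show ?thesis using that[of \<psi>' \<eta> q] \<psi> \<eta> by simp
qed

lemma sph_coord_circle_derivative:
  "((\<lambda>\<phi>. sph_coord (\<theta>, \<phi>)) has_vector_derivative rot (sph_coord (\<theta>, \<phi>))) (at \<phi>)"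
proof -
  have "((\<lambda>\<phi>. sph_coord (\<theta>, \<phi>)) has_derivative
      (\<lambda>h. (sin \<theta> * (h * - sin \<phi>)) *\<^sub>R axis 1 1 + (sin \<theta> * (h * cos \<phi>)) *\<^sub>R axis 2 1)) (at \<phi>)"
    unfolding sph_coord_axis by (rule derivative_eq_intros refl | simp)+
  moreover have "(\<lambda>h. (sin \<theta> * (h * - sin \<phi>)) *\<^sub>R axis 1 1 + (sin \<theta> * (h * cos \<phi>)) *\<^sub>R axis 2 1)
      = (\<lambda>h. h *\<^sub>R rot (sph_coord (\<theta>, \<phi>)))"
    by (auto simp: fun_eq_iff vec_eq_iff forall_3 axis_def)
  ultimately show ?thesis by (simp add: has_vector_derivative_def)
qed

lemma polynomial_circle_derivative:
  assumes "real_polynomial_function \<psi>"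
  shows "((\<lambda>\<phi>. \<psi> (sph_coord (\<theta>, \<phi>))) has_real_derivative rot_deriv \<psi> (sph_coord (\<theta>, \<phi>))) (at \<phi>)"
proof -
  have "((\<lambda>\<phi>. \<psi> (sph_coord (\<theta>, \<phi>))) has_derivative (\<lambda>h. frechet_derivative \<psi> (at (sph_coord (\<theta>, \<phi>))) (h *\<^sub>R rot (sph_coord (\<theta>, \<phi>))))) (at \<phi>)"
    using has_derivative_compose[OF sph_coord_circle_derivative[unfolded has_vector_derivative_def]
        real_polynomial_frechet_derivative(1)[OF assms]] by simp
  moreover have "frechet_derivative \<psi> (at y) (h *\<^sub>R v) = h * frechet_derivative \<psi> (at y) v" for y h v
    using linear_scale[OF has_derivative_linear[OF real_polynomial_frechet_derivative(1)[OF assms]]] by simp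
  ultimately show ?thesis
    by (simp add: has_field_derivative_def rot_deriv_def mult.commute[of _ "frechet_derivative _ _ _"])
qed

lemma sph_coord_2pi: "sph_coord (\<theta>, 2 * pi) = sph_coord (\<theta>, 0)"
  by (simp add: sph_coord_axis)

lemma continuous_polynomial: "real_polynomial_function p \<Longrightarrow> continuous_on UNIV p"
  by (simp add: continuous_on_polymonial_function real_polynomial_function_eq)

lemma isCont_circle: "real_polynomial_function p \<Longrightarrow> isCont (\<lambda>\<phi>. p (sph_coord (\<theta>, \<phi>))) \<phi>"
  using continuous_sph_coord_slice(1)[OF continuous_polynomial, of p \<theta>]
  by (simp add: continuous_on_eq_continuous_at)

lemma surf_integral_rot_deriv:
  assumes "real_polynomial_function \<psi>"
  shows "(LINT x|surf. rot_deriv \<psi> x) = 0"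
proof -
  have c: "continuous_on UNIV (rot_deriv \<psi>)" "continuous_on UNIV (\<lambda>x::real^3. 0::real)"
    by (auto intro: continuous_polynomial rot_deriv_polynomial assms)
  have z: "(LINT \<phi>|lborel. rot_deriv \<psi> (sph_coord (\<theta>, \<phi>)) * indicator {0..2 * pi} \<phi>) = 0" for \<theta>
    using integral_FTC_Icc_real[OF _ polynomial_circle_derivative[OF assms] isCont_circle[OF rot_deriv_polynomial[OF assms]], of 0 "2 * pi" \<theta>]
    by (simp add: sph_coord_2pi)
  have "(LINT x|surf. rot_deriv \<psi> x) \<le> (LINT x|surf. 0)"
    by (rule surf_integral_mono_circles[OF c]) (simp add: z)
  moreover have "(LINT x|surf. 0) \<le> (LINT x|surf. rot_deriv \<psi> x)"
    by (rule surf_integral_mono_circles[OF c(2,1)]) (simp add: z)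
  ultimately show ?thesis by simp
qed

text \<open>Between the zero \<open>\<xi>\<close> and any other point the increment of \<open>g\<close> is controlled by Cauchy--Schwarz.\<close>

lemma real_wirtinger:
  fixes g g' :: "real \<Rightarrow> real"
  assumes der: "\<And>t. (g has_real_derivative g' t) (at t)" and cont: "\<And>t. isCont g' t"
    and z: "g \<xi> = 0" "0 \<le> \<xi>" "\<xi> \<le> L"
  shows "(LINT t|lborel. (g t)\<^sup>2 * indicator {0..L} t) \<le> L\<^sup>2 * (LINT t|lborel. (g' t)\<^sup>2 * indicator {0..L} t)"
proof -
  have contg: "isCont g t" for t using der by (rule DERIV_isCont)
  have int: "integrable lborel (\<lambda>t. (h t)\<^sup>2 * indicator {a..b} t)" "integrable lborel (\<lambda>t. h t * indicator {a..b} t)"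
    if "\<And>t. isCont h t" for h :: "real \<Rightarrow> real" and a b
    using borel_integrable_atLeastAtMost[of a b "\<lambda>t. (h t)\<^sup>2"] borel_integrable_atLeastAtMost[of a b h] that
    by (auto simp: if_distrib indicator_def mult_if_delta intro!: continuous_intros cong: if_cong)
  define E where "E = (LINT t|lborel. (g' t)\<^sup>2 * indicator {0..L} t)"
  have E: "E \<ge> 0" unfolding E_def by (intro Bochner_Integration.integral_nonneg) auto
  have ftc: "(g b - g a)\<^sup>2 \<le> L * E" if ab: "0 \<le> a" "a \<le> b" "b \<le> L" for a b
  proof -
    have eq: "(LINT t|lborel. g' t * indicator {a..b} t) = g b - g a"
      using ab der cont by (intro integral_FTC_Icc_real) auto
    have ind: "(norm (g' t * indicator {a..b} t))\<^sup>2 = (g' t)\<^sup>2 * indicator {a..b} t"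
      "(g' t * indicator {a..b} t)\<^sup>2 = (g' t)\<^sup>2 * indicator {a..b} t"
      "(norm (indicator {a..b} t :: real))\<^sup>2 = indicator {a..b} t"
      "(indicat_real {a..b} t)\<^sup>2 = indicator {a..b} t"
      "g' t * indicator {a..b} t * indicator {a..b} t = g' t * indicator {a..b} t" for t
      by (simp_all add: power_mult_distrib indicator_def)
    have sq: "(\<lambda>t. g' t * indicator {a..b} t) \<in> sq_integrable lborel" "(\<lambda>t. indicator {a..b} t :: real) \<in> sq_integrable lborel"
    proof -
      have [measurable]: "g' \<in> borel_measurable borel"
        using cont by (intro borel_measurable_continuous_onI continuous_at_imp_continuous_on) auto
      show "(\<lambda>t. g' t * indicator {a..b} t) \<in> sq_integrable lborel" "(\<lambda>t. indicator {a..b} t :: real) \<in> sq_integrable lborel"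
        using int(1)[OF cont, of a b] int(2)[of "\<lambda>_. 1" a b] by (simp_all add: sq_integrable_def ind)
    qed
    have "\<bar>g b - g a\<bar> \<le> l2_norm lborel (\<lambda>t. g' t * indicator {a..b} t) * l2_norm lborel (\<lambda>t. indicator {a..b} t :: real)"
      using l2_norm_cauchy_schwarz_real[OF sq] unfolding ind eq .
    then have "\<bar>g b - g a\<bar>\<^sup>2 \<le> (l2_norm lborel (\<lambda>t. g' t * indicator {a..b} t) * l2_norm lborel (\<lambda>t. indicator {a..b} t :: real))\<^sup>2"
      by (rule power_mono) simp
    also have "\<dots> = (LINT t|lborel. (g' t)\<^sup>2 * indicator {a..b} t) * (b - a)"
      using ab unfolding power_mult_distrib[of "l2_norm _ _"] l2_norm_power2 ind by simp
    also have "\<dots> \<le> E * L"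
      unfolding E_def using ab int(1)[OF cont]
      by (intro mult_mono integral_mono) (auto simp: indicator_def)
    finally show ?thesis by (simp add: mult.commute)
  qed
  have pw: "(g t)\<^sup>2 \<le> L * E" if "0 \<le> t" "t \<le> L" for t
    using ftc[of t \<xi>] ftc[of \<xi> t] z that by (cases "t \<le> \<xi>") auto
  have "(LINT t|lborel. (g t)\<^sup>2 * indicator {0..L} t) \<le> (LINT t|lborel. L * E * indicator {0..L} t)"
  proof (rule integral_mono)
    show "integrable lborel (\<lambda>t. (g t)\<^sup>2 * indicator {0..L} t)" by (rule int(1)[OF contg])
    show "integrable lborel (\<lambda>t. L * E * indicator {0..L} t)" by (rule int(2)) simp
    show "(g t)\<^sup>2 * indicator {0..L} t \<le> L * E * indicator {0..L} t" for t
      using pw[of t] by (simp add: indicator_def)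
  qed
  also have "\<dots> = L\<^sup>2 * E" using z by (simp add: power2_eq_square)
  finally show ?thesis by (simp add: E_def)
qed

text \<open>On each circle of latitude \<open>\<psi>\<close> is the derivative of the periodic function \<open>\<eta>\<close> and so has a zero by
  Rolle's theorem.\<close>

lemma circle_poincare:
  assumes \<psi>: "real_polynomial_function \<psi>" and \<eta>: "real_polynomial_function \<eta>"
    and eq: "\<And>x. x \<in> S2 \<Longrightarrow> \<psi> x = rot_deriv \<eta> x"
  shows "(LINT x|surf. (\<psi> x)\<^sup>2) \<le> (2 * pi)\<^sup>2 * (LINT x|surf. (rot_deriv \<psi> x)\<^sup>2)"
proof -
  have "(LINT x|surf. (\<psi> x)\<^sup>2) \<le> (LINT x|surf. (2 * pi)\<^sup>2 * (rot_deriv \<psi> x)\<^sup>2)"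
  proof (rule surf_integral_mono_circles)
    show "continuous_on UNIV (\<lambda>x. (\<psi> x)\<^sup>2)" "continuous_on UNIV (\<lambda>x. (2 * pi)\<^sup>2 * (rot_deriv \<psi> x)\<^sup>2)"
      using \<psi> by (auto intro!: continuous_intros continuous_polynomial rot_deriv_polynomial)
    fix \<theta> :: real
    define G where "G \<phi> = \<eta> (sph_coord (\<theta>, \<phi>))" for \<phi>
    define g where "g \<phi> = \<psi> (sph_coord (\<theta>, \<phi>))" for \<phi>
    have G: "(G has_real_derivative g \<phi>) (at \<phi>)" for \<phi>
      using polynomial_circle_derivative[OF \<eta>] eq[OF sph_coord_in_S2] by (simp add: G_def[abs_def] g_def)
    have "\<exists>\<xi>>0. \<xi> < 2 * pi \<and> (\<lambda>h. g \<xi> * h) = (\<lambda>v. 0)"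
    proof (rule Rolle_deriv)
      show "G 0 = G (2 * pi)" by (simp add: G_def sph_coord_2pi)
      show "continuous_on {0..2 * pi} G"
        using G by (intro continuous_at_imp_continuous_on) (auto intro: DERIV_isCont)
      show "(G has_derivative (*) (g \<phi>)) (at \<phi>)" for \<phi>
        using G by (simp add: has_field_derivative_def)
    qed simp
    then obtain \<xi> where \<xi>: "0 < \<xi>" "\<xi> < 2 * pi" "g \<xi> = 0" by (metis mult.right_neutral)
    have "(LINT \<phi>|lborel. (g \<phi>)\<^sup>2 * indicator {0..2 * pi} \<phi>)
        \<le> (2 * pi)\<^sup>2 * (LINT \<phi>|lborel. (rot_deriv \<psi> (sph_coord (\<theta>, \<phi>)))\<^sup>2 * indicator {0..2 * pi} \<phi>)"
      using polynomial_circle_derivative[OF \<psi>] isCont_circle[OF rot_deriv_polynomial[OF \<psi>]] \<xi>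
      by (intro real_wirtinger[of g _ \<xi>]) (auto simp: g_def[abs_def])
    then show "(LINT \<phi>|lborel. (\<psi> (sph_coord (\<theta>, \<phi>)))\<^sup>2 * indicator {0..2 * pi} \<phi>)
        \<le> (LINT \<phi>|lborel. (2 * pi)\<^sup>2 * (rot_deriv \<psi> (sph_coord (\<theta>, \<phi>)))\<^sup>2 * indicator {0..2 * pi} \<phi>)"
      by (simp add: g_def mult.assoc)
  qed
  then show ?thesis by simp
qed

section \<open>Weak gradients and the Poincare inequality\<close>

lemma poly_antiderivative: "\<exists>P :: real poly. pderiv P = q"
proof -
  define P where "P = (\<Sum>i\<le>degree q. monom (coeff q i / real (Suc i)) (Suc i))"
  have "pderiv (\<Sum>i\<in>A. f i) = (\<Sum>i\<in>A. pderiv (f i))" for f :: "nat \<Rightarrow> real poly" and A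
    by (induction A rule: infinite_finite_induct) (auto simp: pderiv_add)
  then have "pderiv P = (\<Sum>i\<le>degree q. monom (coeff q i) i)"
    unfolding P_def by (simp only:, intro sum.cong refl) (simp add: pderiv_monom del: of_nat_Suc)
  then show ?thesis using poly_as_sum_of_monoms[of q] by auto
qed

text \<open>Subtracting from an antiderivative of \<open>q\<close> its affine interpolation at \<open>1\<close> and \<open>- 1\<close> leaves a multiple of
  \<open>1 - z\<^sup>2\<close>; the slope of the interpolation is \<open>m\<close>.\<close>

lemma poly_zonal_divergence: "\<exists>m Q. (q :: real poly) = [:m:] + pderiv ([:1, 0, -1:] * Q)"
proof -
  obtain P where P: "pderiv P = q" using poly_antiderivative by blast
  define m where "m = (poly P 1 - poly P (-1)) / 2"
  define b where "b = (poly P 1 + poly P (-1)) / 2"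
  define H where "H = P - [:b, m:]"
  have "poly H 1 = 0" "poly H (-1) = 0" by (simp_all add: H_def m_def b_def field_simps)
  then obtain K where K: "H = [:-1, 1:] * K" using poly_eq_0_iff_dvd[of H 1] by auto
  then have "poly K (-1) = 0" using \<open>poly H (-1) = 0\<close> by simp
  then obtain L where L: "K = [:1, 1:] * L" using poly_eq_0_iff_dvd[of K "-1"] by auto
  have "H = ([:-1, 1:] * [:1, 1:]) * L" unfolding K L by (simp only: mult.assoc)
  also have "[:-1, 1:] * [:1, 1:] = - [:1, 0, -1 :: real:]" by simp
  also have "- [:1, 0, -1:] * L = [:1, 0, -1:] * (- L)" by (simp only: minus_mult_commute)
  finally have H: "H = [:1, 0, -1:] * (- L)" .
  have "q = [:m:] + pderiv H" using P by (simp add: H_def pderiv_diff pderiv_pCons)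
  then show ?thesis unfolding H by blast
qed

lemma test_field_sq_integrable:
  assumes "\<Phi> \<in> tangential_test_fields"
  shows "\<Phi> \<in> sq_integrable surf" "surf_div \<Phi> \<in> sq_integrable surf"
  using continuous_on_test_field[OF assms] continuous_on_surf_div[OF assms]
  by (auto intro: surf.sq_integrable_continuous)

lemma weak_grad_sq_integrable: "is_weak_grad v G \<Longrightarrow> G \<in> sq_integrable surf"
  by (simp add: is_weak_grad_def sq_integrable_surf_eq_L2)

lemma sq_integrable_vec_nth:
  assumes "G \<in> sq_integrable M"
  shows "(\<lambda>x. (G x :: real^'n) $ i) \<in> sq_integrable M"
proof -
  have [measurable]: "G \<in> borel_measurable M" using assms by (rule sq_integrable_measurable)
  have m: "(\<lambda>x. G x $ i) \<in> borel_measurable M"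
    by (rule measurable_compose[OF sq_integrable_measurable[OF assms]
          borel_measurable_continuous_onI[OF linear_continuous_on[OF bounded_linear_vec_nth]]])
  have "integrable M (\<lambda>x. (norm (G x $ i))\<^sup>2)"
    by (rule Bochner_Integration.integrable_bound[OF sq_integrable_integrable[OF assms]])
      (use m component_le_norm_cart[of "G _" i] in \<open>auto simp: abs_le_square_iff[symmetric]\<close>)
  then show ?thesis using m by (simp add: sq_integrable_def)
qed

text \<open>Testing with the tangential part of \<open>p e\<^sub>i\<close> shows that the \<open>i\<close>-th component of the difference, which is
  tangential, is orthogonal to every polynomial \<open>p\<close>.\<close>

lemma weak_grad_unique:
  assumes G: "is_weak_grad v G" and G': "is_weak_grad v G'"
  shows "AE x in surf. G x = G' x"
proof -
  define H where "H x = G x - G' x" for x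
  have H: "H \<in> sq_integrable surf"
    unfolding H_def using G G' by (intro sq_integrable_diff weak_grad_sq_integrable)
  have tang: "AE x in surf. H x \<bullet> x = 0"
  proof -
    have "AE x in surf. G x \<bullet> x = 0" "AE x in surf. G' x \<bullet> x = 0"
      using G G' by (auto simp: is_weak_grad_def)
    then show ?thesis by eventually_elim (simp add: H_def inner_diff_left)
  qed
  have zero: "(LINT x|surf. H x \<bullet> \<Phi> x) = 0" if \<Phi>: "\<Phi> \<in> tangential_test_fields" for \<Phi>
  proof -
    have "(LINT x|surf. H x \<bullet> \<Phi> x) = (LINT x|surf. G x \<bullet> \<Phi> x) - (LINT x|surf. G' x \<bullet> \<Phi> x)"
      unfolding H_def inner_diff_left
      by (rule Bochner_Integration.integral_diff[OF
            integrable_inner_sq_integrable[OF weak_grad_sq_integrable[OF G] test_field_sq_integrable(1)[OF \<Phi>]]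
            integrable_inner_sq_integrable[OF weak_grad_sq_integrable[OF G'] test_field_sq_integrable(1)[OF \<Phi>]]])
    then show ?thesis using G G' \<Phi> by (simp add: is_weak_grad_def)
  qed
  have comp: "AE x in surf. H x $ i = 0" for i
  proof (rule surf.AE_zero_by_polynomials[OF sq_integrable_vec_nth[OF H]])
    fix p :: "real^3 \<Rightarrow> real" assume p: "real_polynomial_function p"
    let ?\<Phi> = "\<lambda>x. p x *\<^sub>R (axis i 1 - x $ i *\<^sub>R x)"
    have \<Phi>: "?\<Phi> \<in> tangential_test_fields" by (rule projected_field[OF p])
    have "(LINT x|surf. H x $ i * p x) = (LINT x|surf. H x \<bullet> ?\<Phi> x)"
    proof (rule integral_cong_AE)
      show "AE x in surf. H x $ i * p x = H x \<bullet> ?\<Phi> x"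
        using tang by eventually_elim (simp add: inner_diff_right inner_axis)
      show "(\<lambda>x. H x $ i * p x) \<in> borel_measurable surf"
        using sq_integrable_measurable[OF sq_integrable_vec_nth[OF H]]
          sq_integrable_measurable[OF surf.sq_integrable_polynomial[OF p]] by simp
      show "(\<lambda>x. H x \<bullet> ?\<Phi> x) \<in> borel_measurable surf"
        using integrable_inner_sq_integrable[OF H test_field_sq_integrable(1)[OF \<Phi>]] by (rule borel_measurable_integrable)
    qed
    then show "(LINT x|surf. H x $ i * p x) = 0" using zero[OF \<Phi>] by simp
  qed
  have "AE x in surf. H x $ 1 = 0 \<and> H x $ 2 = 0 \<and> H x $ 3 = 0"
    using comp[of 1] comp[of 2] comp[of 3] by simp
  then show ?thesis by eventually_elim (simp add: H_def vec_eq_iff forall_3)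
qed

lemma weak_grad_combination:
  assumes v: "v \<in> sq_integrable surf" "is_weak_grad v G" and w: "w \<in> sq_integrable surf" "is_weak_grad w H"
  shows "is_weak_grad (\<lambda>x. v x + c * w x) (\<lambda>x. G x + c *\<^sub>R H x)"
  unfolding is_weak_grad_def
proof (intro conjI ballI)
  note GH = weak_grad_sq_integrable[OF v(2)] sq_integrable_scaleR[OF weak_grad_sq_integrable[OF w(2)], of c]
  show "(\<lambda>x. G x + c *\<^sub>R H x) \<in> L2"
    using sq_integrable_add[OF GH] by (simp add: sq_integrable_surf_eq_L2)
  have "AE x in surf. G x \<bullet> x = 0" "AE x in surf. H x \<bullet> x = 0" using v w by (auto simp: is_weak_grad_def)
  then show "AE x in surf. (G x + c *\<^sub>R H x) \<bullet> x = 0" by eventually_elim (simp add: inner_add_left)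
  fix \<Phi> assume \<Phi>: "\<Phi> \<in> tangential_test_fields"
  note \<Phi>' = test_field_sq_integrable[OF \<Phi>]
  have "(LINT x|surf. (G x + c *\<^sub>R H x) \<bullet> \<Phi> x) = (LINT x|surf. G x \<bullet> \<Phi> x) + c * (LINT x|surf. H x \<bullet> \<Phi> x)"
    using integrable_inner_sq_integrable[OF weak_grad_sq_integrable[OF v(2)] \<Phi>'(1)]
      integrable_inner_sq_integrable[OF weak_grad_sq_integrable[OF w(2)] \<Phi>'(1)]
    by (simp add: inner_add_left)
  also have "\<dots> = - ((LINT x|surf. v x * surf_div \<Phi> x) + c * (LINT x|surf. w x * surf_div \<Phi> x))"
    using v w \<Phi> by (simp add: is_weak_grad_def)
  also have "(LINT x|surf. v x * surf_div \<Phi> x) + c * (LINT x|surf. w x * surf_div \<Phi> x)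
      = (LINT x|surf. (v x + c * w x) * surf_div \<Phi> x)"
    using integrable_mult_sq_integrable[OF v(1) \<Phi>'(2)] integrable_mult_sq_integrable[OF w(1) \<Phi>'(2)]
    by (simp add: distrib_right mult.assoc)
  finally show "(LINT x|surf. (G x + c *\<^sub>R H x) \<bullet> \<Phi> x) = - (LINT x|surf. (v x + c * w x) * surf_div \<Phi> x)" .
qed

text \<open>The defining identities involve \<open>v\<close> and \<open>G\<close> only through integrals against fixed square-integrable functions.\<close>

lemma weak_grad_limit:
  fixes v :: "nat \<Rightarrow> real^3 \<Rightarrow> real"
  assumes v: "\<And>n. v n \<in> sq_integrable surf" and G: "\<And>n. is_weak_grad (v n) (G n)"
    and w: "w \<in> sq_integrable surf" and H: "H \<in> sq_integrable surf"
    and vw: "(\<lambda>n. l2_norm surf (\<lambda>x. v n x - w x)) \<longlonglongrightarrow> 0"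
    and GH: "(\<lambda>n. l2_norm surf (\<lambda>x. G n x - H x)) \<longlonglongrightarrow> 0"
  shows "is_weak_grad w H"
  unfolding is_weak_grad_def
proof (intro conjI ballI)
  note Gs = weak_grad_sq_integrable[OF G]
  show "H \<in> L2" using H by (simp add: sq_integrable_surf_eq_L2)
  have x_meas [measurable]: "(\<lambda>x. x) \<in> borel_measurable surf" by (rule surf.borel_measurable_restrict) simp
  have [measurable]: "H \<in> borel_measurable surf" using H by (rule sq_integrable_measurable)
  have normal: "(\<lambda>x. H x \<bullet> x) \<in> sq_integrable surf"
  proof -
    have "integrable surf (\<lambda>x. (norm (H x \<bullet> x))\<^sup>2)"
      using sq_integrable_integrable[OF H]
    proof (rule Bochner_Integration.integrable_bound)
      show "AE x in surf. norm ((norm (H x \<bullet> x))\<^sup>2) \<le> norm ((norm (H x))\<^sup>2)"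
      proof (rule AE_I2)
        fix x assume "x \<in> space surf"
        then show "norm ((norm (H x \<bullet> x))\<^sup>2) \<le> norm ((norm (H x))\<^sup>2)"
          using Cauchy_Schwarz_ineq2[of "H x" x] by (simp add: abs_le_square_iff[symmetric])
      qed
    qed measurable
    then show ?thesis by (simp add: sq_integrable_def)
  qed
  have "l2_norm surf (\<lambda>x. H x \<bullet> x) \<le> l2_norm surf (\<lambda>x. G n x - H x)" for n
  proof -
    have "(LINT x|surf. (norm (H x \<bullet> x))\<^sup>2) \<le> (LINT x|surf. (norm (G n x - H x))\<^sup>2)"
    proof (rule integral_mono_AE)
      have "AE x in surf. G n x \<bullet> x = 0" using G by (simp add: is_weak_grad_def)
      then show "AE x in surf. (norm (H x \<bullet> x))\<^sup>2 \<le> (norm (G n x - H x))\<^sup>2"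
        using AE_space
      proof eventually_elim
        case (elim x)
        then have "\<bar>H x \<bullet> x\<bar> \<le> norm (G n x - H x)"
          using Cauchy_Schwarz_ineq2[of "G n x - H x" x] by (simp add: inner_diff_left)
        then show ?case by (simp add: abs_le_square_iff[symmetric])
      qed
    qed (rule sq_integrable_integrable[OF normal] sq_integrable_integrable[OF sq_integrable_diff[OF Gs H]])+
    then show ?thesis by (simp add: l2_norm_def)
  qed
  then have "l2_norm surf (\<lambda>x. H x \<bullet> x) \<le> 0"
    by (intro LIMSEQ_le_const[OF GH]) auto
  then show "AE x in surf. H x \<bullet> x = 0"
    using l2_norm_eq_0_AE[OF normal] l2_norm_nonneg[of surf "\<lambda>x. H x \<bullet> x"] by linarith
  fix \<Phi> assume \<Phi>: "\<Phi> \<in> tangential_test_fields"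
  note \<Phi>' = test_field_sq_integrable[OF \<Phi>]
  have 1: "(\<lambda>n. LINT x|surf. G n x \<bullet> \<Phi> x) \<longlonglongrightarrow> (LINT x|surf. H x \<bullet> \<Phi> x)"
  proof (rule LIM_zero_cancel, rule Lim_null_comparison[OF always_eventually], rule allI)
    fix n
    have "(LINT x|surf. G n x \<bullet> \<Phi> x) - (LINT x|surf. H x \<bullet> \<Phi> x) = (LINT x|surf. (G n x - H x) \<bullet> \<Phi> x)"
      using integrable_inner_sq_integrable[OF Gs \<Phi>'(1)] integrable_inner_sq_integrable[OF H \<Phi>'(1)]
      by (simp add: inner_diff_left)
    then show "norm ((LINT x|surf. G n x \<bullet> \<Phi> x) - (LINT x|surf. H x \<bullet> \<Phi> x))
        \<le> l2_norm surf (\<lambda>x. G n x - H x) * l2_norm surf \<Phi>"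
      using l2_norm_cauchy_schwarz[OF sq_integrable_diff[OF Gs H] \<Phi>'(1)] by simp
    show "(\<lambda>n. l2_norm surf (\<lambda>x. G n x - H x) * l2_norm surf \<Phi>) \<longlonglongrightarrow> 0"
      using tendsto_mult_left_zero[OF GH] .
  qed
  have 2: "(\<lambda>n. LINT x|surf. v n x * surf_div \<Phi> x) \<longlonglongrightarrow> (LINT x|surf. w x * surf_div \<Phi> x)"
  proof (rule LIM_zero_cancel, rule Lim_null_comparison[OF always_eventually], rule allI)
    fix n
    have "(LINT x|surf. v n x * surf_div \<Phi> x) - (LINT x|surf. w x * surf_div \<Phi> x) = (LINT x|surf. (v n x - w x) * surf_div \<Phi> x)"
      using integrable_mult_sq_integrable[OF v \<Phi>'(2)] integrable_mult_sq_integrable[OF w \<Phi>'(2)]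
      by (simp add: left_diff_distrib)
    then show "norm ((LINT x|surf. v n x * surf_div \<Phi> x) - (LINT x|surf. w x * surf_div \<Phi> x))
        \<le> l2_norm surf (\<lambda>x. v n x - w x) * l2_norm surf (surf_div \<Phi>)"
      using l2_norm_cauchy_schwarz_real[OF sq_integrable_diff[OF v w] \<Phi>'(2)] by simp
    show "(\<lambda>n. l2_norm surf (\<lambda>x. v n x - w x) * l2_norm surf (surf_div \<Phi>)) \<longlonglongrightarrow> 0"
      using tendsto_mult_left_zero[OF vw] .
  qed
  have "(LINT x|surf. G n x \<bullet> \<Phi> x) = - (LINT x|surf. v n x * surf_div \<Phi> x)" for n
    using G \<Phi> by (simp add: is_weak_grad_def)
  then show "(LINT x|surf. H x \<bullet> \<Phi> x) = - (LINT x|surf. w x * surf_div \<Phi> x)"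
    using LIMSEQ_unique[OF 1] tendsto_minus[OF 2] by simp
qed

text \<open>On the sphere \<open>p = m + surf_div (A + B)\<close> with \<open>A = \<psi> rot\<close> and \<open>B = Q(x\<^sub>3) (e\<^sub>3 - x\<^sub>3 x)\<close>. The constant
  \<open>m\<close>, the rotational part \<open>R = surf_div A\<close> and the zonal part \<open>h = surf_div B\<close> are mutually orthogonal, so
  the norms of \<open>R\<close> and \<open>h\<close> are at most that of \<open>p\<close>; it remains to bound \<open>A\<close> by \<open>R\<close> and \<open>B\<close> by \<open>h\<close>.\<close>

lemma polynomial_poincare_dual:
  assumes p: "real_polynomial_function p" and v: "v \<in> sq_integrable surf" "is_weak_grad v G"
    and mean: "(LINT x|surf. v x) = 0"
  shows "(LINT x|surf. v x * p x) \<le> (2 * pi + 1) * l2_norm surf G * l2_norm surf p"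
proof -
  obtain \<psi> \<eta> q where \<psi>: "real_polynomial_function \<psi>" and \<eta>: "real_polynomial_function \<eta>"
    and pq: "\<And>x. x \<in> S2 \<Longrightarrow> p x = rot_deriv \<psi> x + poly q (x $ 3)"
    and \<psi>\<eta>: "\<And>x. x \<in> S2 \<Longrightarrow> \<psi> x = rot_deriv \<eta> x"
    using polynomial_rot_decomposition[OF p] by metis
  obtain m Q where q: "q = [:m:] + pderiv ([:1, 0, -1:] * Q)" using poly_zonal_divergence by blast
  define hp where "hp = pderiv ([:1, 0, -1:] * Q)"
  define h where "h x = poly hp (x $ 3)" for x :: "real^3"
  define R where "R = rot_deriv \<psi>"
  have p_eq: "p x = R x + (m + h x)" if "x \<in> S2" for x
    using pq[OF that] q by (simp add: R_def h_def hp_def)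
  have R_poly: "real_polynomial_function R" unfolding R_def using \<psi> by (rule rot_deriv_polynomial)
  have h_poly: "real_polynomial_function h" unfolding h_def[abs_def] by (rule real_polynomial_function_poly_nth)
  note sq = surf.sq_integrable_polynomial
  define A where "A x = \<psi> x *\<^sub>R rot x" for x
  define B where "B x = poly Q (x $ 3) *\<^sub>R (axis 3 1 - x $ 3 *\<^sub>R x)" for x :: "real^3"
  have A: "A \<in> tangential_test_fields" "surf_div A x = R x" for x
    unfolding A_def[abs_def] R_def using rot_field[OF \<psi>] by auto
  have B: "B \<in> tangential_test_fields" "x \<in> S2 \<Longrightarrow> surf_div B x = h x" for x
    unfolding B_def[abs_def] h_def hp_def using zonal_field[where q = Q] by auto
  note G = weak_grad_sq_integrable[OF v(2)]

  have h_mean: "(LINT x|surf. h x) = 0"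
    unfolding h_def hp_def by (rule surf_integral_zonal) simp
  have R_orth: "(LINT x|surf. R x * (m + h x)) = 0"
  proof -
    have "R x * (m + h x) = rot_deriv (\<lambda>x. \<psi> x * poly q (x $ 3)) x" for x
      unfolding rot_deriv_mult[OF \<psi> real_polynomial_function_poly_nth] rot_deriv_zonal
      by (simp add: R_def h_def hp_def q)
    then show ?thesis
      using surf_integral_rot_deriv[OF real_polynomial_function.intros(4)[OF \<psi> real_polynomial_function_poly_nth]] by simp
  qed
  have int: "integrable surf (\<lambda>x. (R x)\<^sup>2)" "integrable surf (\<lambda>x. (h x)\<^sup>2)" "integrable surf h"
    "integrable surf (\<lambda>x. R x * (m + h x))"
    by (intro integrable_surf_continuous continuous_intros continuous_polynomial R_poly h_poly)+
  have "(LINT x|surf. (p x)\<^sup>2) = (LINT x|surf. (R x)\<^sup>2 + 2 * (R x * (m + h x)) + (m\<^sup>2 + 2 * m * h x + (h x)\<^sup>2))"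
    by (intro Bochner_Integration.integral_cong refl) (simp add: p_eq power2_sum power2_eq_square algebra_simps)
  also have "\<dots> = (LINT x|surf. (R x)\<^sup>2) + m\<^sup>2 * measure surf (space surf) + (LINT x|surf. (h x)\<^sup>2)"
    using int by (simp add: h_mean R_orth)
  finally have pyth: "(LINT x|surf. (p x)\<^sup>2) = (LINT x|surf. (R x)\<^sup>2) + m\<^sup>2 * measure surf (space surf) + (LINT x|surf. (h x)\<^sup>2)" .
  have R_le: "(LINT x|surf. (R x)\<^sup>2) \<le> (LINT x|surf. (p x)\<^sup>2)"
    and h_le: "(LINT x|surf. (h x)\<^sup>2) \<le> (LINT x|surf. (p x)\<^sup>2)"
    unfolding pyth by simp_all

  have "(LINT x|surf. (norm (A x))\<^sup>2) \<le> (LINT x|surf. (\<psi> x)\<^sup>2)"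
  proof (rule integral_mono)
    fix x assume "x \<in> space surf"
    then have "(x $ 1)\<^sup>2 + (x $ 2)\<^sup>2 \<le> 1" using sum_squares_S2[of x] zero_le_power2[of "x $ 3"] unfolding space_surf by linarith
    moreover have "(norm (rot x))\<^sup>2 = (x $ 1)\<^sup>2 + (x $ 2)\<^sup>2"
      by (simp only: power2_norm_eq_inner inner_vec_def sum_3) (simp add: power2_eq_square)
    ultimately show "(norm (A x))\<^sup>2 \<le> (\<psi> x)\<^sup>2"
      unfolding A_def norm_scaleR power_mult_distrib by (simp add: mult_left_le)
  qed (use test_field_sq_integrable(1)[OF A(1)] sq[OF \<psi>] in \<open>auto dest: sq_integrable_integrable\<close>)
  also have "\<dots> \<le> (2 * pi)\<^sup>2 * (LINT x|surf. (R x)\<^sup>2)"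
    unfolding R_def by (rule circle_poincare[OF \<psi> \<eta> \<psi>\<eta>])
  also have "\<dots> \<le> (2 * pi)\<^sup>2 * (LINT x|surf. (p x)\<^sup>2)" by (intro mult_left_mono R_le) simp
  finally have "(l2_norm surf A)\<^sup>2 \<le> (2 * pi * l2_norm surf p)\<^sup>2"
    by (simp add: l2_norm_power2 power_mult_distrib)
  then have A_le: "l2_norm surf A \<le> 2 * pi * l2_norm surf p" by (rule power2_le_imp_le) simp

  have "(LINT x|surf. (norm (B x))\<^sup>2) \<le> (LINT x|surf. (h x)\<^sup>2)"
  proof -
    \<comment> \<open>With \<open>P = - 2 z (1 - z\<^sup>2) Q\<^sup>2\<close> one has \<open>h\<^sup>2 - P' = 2 (1 - z\<^sup>2) Q\<^sup>2 + ((1 - z\<^sup>2) Q')\<^sup>2\<close>,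
      and \<open>P\<close> vanishes at \<open>1\<close> and \<open>- 1\<close>.\<close>
    define P where "P = [:0, -2:] * [:1, 0, -1:] * (Q * Q)"
    have "(LINT x|surf. 2 * (norm (B x))\<^sup>2) \<le> (LINT x|surf. (h x)\<^sup>2 - poly (pderiv P) (x $ 3))"
    proof (rule integral_mono)
      fix x assume "x \<in> space surf"
      define z where "z = x $ 3"
      have xx: "x \<bullet> x = 1" using \<open>x \<in> space surf\<close> by (simp add: dot_square_norm)
      have "(norm (axis 3 1 - x $ 3 *\<^sub>R x))\<^sup>2 = 1 - z\<^sup>2"
        unfolding power2_norm_eq_inner z_def
        by (simp add: inner_diff_left inner_diff_right inner_axis inner_axis' xx power2_eq_square)
      then have "2 * (norm (B x))\<^sup>2 = 2 * (1 - z\<^sup>2) * (poly Q z)\<^sup>2"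
        unfolding B_def norm_scaleR power_mult_distrib by (simp add: z_def)
      also have "\<dots> \<le> 2 * (1 - z\<^sup>2) * (poly Q z)\<^sup>2 + ((1 - z\<^sup>2) * poly (pderiv Q) z)\<^sup>2" by simp
      also have "\<dots> = (h x)\<^sup>2 - poly (pderiv P) (x $ 3)"
        unfolding h_def hp_def P_def z_def[symmetric] pderiv_mult
        by (simp add: pderiv_pCons power2_eq_square algebra_simps)
      finally show "2 * (norm (B x))\<^sup>2 \<le> (h x)\<^sup>2 - poly (pderiv P) (x $ 3)" .
    next
      show "integrable surf (\<lambda>x. 2 * (norm (B x))\<^sup>2)"
        using sq_integrable_integrable[OF test_field_sq_integrable(1)[OF B(1)]] by simp
      show "integrable surf (\<lambda>x. (h x)\<^sup>2 - poly (pderiv P) (x $ 3))"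
        using h_poly by (auto intro!: integrable_surf_continuous continuous_intros continuous_polynomial)
    qed
    also have "\<dots> = (LINT x|surf. (h x)\<^sup>2) - (LINT x|surf. poly (pderiv P) (x $ 3))"
      by (rule Bochner_Integration.integral_diff[OF int(2)])
        (intro integrable_surf_continuous continuous_intros)
    also have "(LINT x|surf. poly (pderiv P) (x $ 3)) = 0"
      by (rule surf_integral_zonal) (simp add: P_def)
    finally have "2 * (LINT x|surf. (norm (B x))\<^sup>2) \<le> (LINT x|surf. (h x)\<^sup>2)" by simp
    moreover have "0 \<le> (LINT x|surf. (norm (B x))\<^sup>2)" by simp
    ultimately show ?thesis by linarith
  qed
  then have B_le: "l2_norm surf B \<le> l2_norm surf p"
    unfolding l2_norm_def using h_le by (simp del: real_sqrt_le_iff add: real_sqrt_le_mono)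

  have "(LINT x|surf. v x * p x) = (LINT x|surf. v x * surf_div A x + v x * surf_div B x + m * v x)"
    by (intro Bochner_Integration.integral_cong refl) (simp add: p_eq A B algebra_simps)
  also have "\<dots> = (LINT x|surf. v x * surf_div A x) + (LINT x|surf. v x * surf_div B x) + m * (LINT x|surf. v x)"
    using integrable_mult_sq_integrable[OF v(1) test_field_sq_integrable(2)] A(1) B(1)
      integrable_sq_integrable[OF finite_measure_surf v(1)] by simp
  also have "\<dots> = - (LINT x|surf. G x \<bullet> A x) - (LINT x|surf. G x \<bullet> B x)"
    using v(2) A(1) B(1) mean by (simp add: is_weak_grad_def)
  also have "\<dots> \<le> l2_norm surf G * l2_norm surf A + l2_norm surf G * l2_norm surf B"
    using l2_norm_cauchy_schwarz[OF G test_field_sq_integrable(1)[OF A(1)]]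
      l2_norm_cauchy_schwarz[OF G test_field_sq_integrable(1)[OF B(1)]] by linarith
  also have "\<dots> \<le> l2_norm surf G * (2 * pi * l2_norm surf p) + l2_norm surf G * l2_norm surf p"
    by (intro add_mono mult_left_mono A_le B_le) auto
  finally show ?thesis by (simp add: algebra_simps)
qed

theorem poincare_inequality:
  assumes v: "v \<in> sq_integrable surf" "is_weak_grad v G" and mean: "(LINT x|surf. v x) = 0"
  shows "l2_norm surf v \<le> (2 * pi + 1) * l2_norm surf G"
  by (rule surf.l2_norm_le_by_polynomials[OF v(1)])
    (use polynomial_poincare_dual[OF _ v mean] in \<open>simp_all add: add_nonneg_nonneg\<close>)

section \<open>The solution operator\<close>

lemma H1_iff: "v \<in> H1 \<longleftrightarrow> v \<in> sq_integrable surf \<and> (\<exists>G. is_weak_grad v G)"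
  by (auto simp: H1_def sq_integrable_surf_eq_L2)

lemma H1_sq_integrable: "v \<in> H1 \<Longrightarrow> v \<in> sq_integrable surf"
  by (simp add: H1_iff)

lemma weak_grad_sph_grad:
  assumes "v \<in> H1"
  shows "is_weak_grad v (sph_grad v)"
proof -
  have "\<exists>G. is_weak_grad v G" using assms by (simp add: H1_iff)
  then show ?thesis unfolding sph_grad_def by (rule someI_ex)
qed

lemma sph_grad_sq_integrable: "v \<in> H1 \<Longrightarrow> sph_grad v \<in> sq_integrable surf"
  by (rule weak_grad_sq_integrable[OF weak_grad_sph_grad])

lemma sph_grad_AE: "is_weak_grad v G \<Longrightarrow> v \<in> sq_integrable surf \<Longrightarrow> AE x in surf. sph_grad v x = G x"
  by (rule weak_grad_unique[OF weak_grad_sph_grad]) (auto simp: H1_iff)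

lemma H1_combination:
  assumes "v \<in> H1" "w \<in> H1"
  shows "(\<lambda>x. v x + c * w x) \<in> H1"
    and "AE x in surf. sph_grad (\<lambda>x. v x + c * w x) x = sph_grad v x + c *\<^sub>R sph_grad w x"
proof -
  have G: "is_weak_grad (\<lambda>x. v x + c * w x) (\<lambda>x. sph_grad v x + c *\<^sub>R sph_grad w x)"
    using assms by (intro weak_grad_combination H1_sq_integrable weak_grad_sph_grad)
  have sq: "(\<lambda>x. v x + c * w x) \<in> sq_integrable surf"
    using assms by (intro sq_integrable_add sq_integrable_cmult H1_sq_integrable)
  show "(\<lambda>x. v x + c * w x) \<in> H1" using G sq by (auto simp: H1_iff)
  show "AE x in surf. sph_grad (\<lambda>x. v x + c * w x) x = sph_grad v x + c *\<^sub>R sph_grad w x"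
    by (rule sph_grad_AE[OF G sq])
qed

lemma H1R_iff: "v \<in> H1R \<longleftrightarrow> v \<in> H1 \<and> (LINT x|surf. v x) = 0"
  by (simp add: H1R_def)

lemma H1R_H1: "v \<in> H1R \<Longrightarrow> v \<in> H1"
  by (simp add: H1R_iff)

lemma H1R_combination:
  assumes "v \<in> H1R" "w \<in> H1R"
  shows "(\<lambda>x. v x + c * w x) \<in> H1R"
  using assms H1_combination(1)[of v w c]
    integrable_sq_integrable[OF finite_measure_surf H1_sq_integrable] by (simp add: H1R_iff)

lemma H1R_zero: "(\<lambda>_. 0) \<in> H1R"
proof -
  have "is_weak_grad (\<lambda>_. 0) (\<lambda>_. 0)"
    by (simp add: is_weak_grad_def sq_integrable_surf_eq_L2[symmetric])
  then show ?thesis by (auto simp: H1R_iff H1_iff)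
qed

lemma H1R_diff: "v \<in> H1R \<Longrightarrow> w \<in> H1R \<Longrightarrow> (\<lambda>x. v x - w x) \<in> H1R"
  using H1R_combination[of v w "-1"] by simp

lemma H1R_norm_eq: "H1R_norm v = l2_norm surf (sph_grad v)"
  by (simp add: H1R_norm_def l2_norm_def)

lemma H1R_norm_nonneg: "0 \<le> H1R_norm v"
  by (simp add: H1R_norm_eq)

lemma H1R_norm_diff_eq:
  assumes "v \<in> H1" "w \<in> H1"
  shows "H1R_norm (\<lambda>x. v x - w x) = l2_norm surf (\<lambda>x. sph_grad v x - sph_grad w x)"
proof -
  have "AE x in surf. sph_grad (\<lambda>x. v x - w x) x = sph_grad v x - sph_grad w x"
    using H1_combination(2)[OF assms, of "-1"] by simp
  moreover have "(\<lambda>x. v x - w x) \<in> H1" using H1_combination(1)[OF assms, of "-1"] by simp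
  ultimately show ?thesis unfolding H1R_norm_eq using assms
    by (intro l2_norm_cong_AE sq_integrable_measurable sq_integrable_diff sph_grad_sq_integrable)
qed

lemma H1R_norm_triangle_diff:
  assumes "v \<in> H1" "w \<in> H1"
  shows "\<bar>H1R_norm v - H1R_norm w\<bar> \<le> H1R_norm (\<lambda>x. v x - w x)"
  unfolding H1R_norm_diff_eq[OF assms] unfolding H1R_norm_eq
  using assms by (intro l2_norm_triangle_diff sph_grad_sq_integrable)

lemma H1R_poincare: "v \<in> H1R \<Longrightarrow> l2_norm surf v \<le> (2 * pi + 1) * H1R_norm v"
  unfolding H1R_norm_eq H1R_iff
  by (intro poincare_inequality H1_sq_integrable weak_grad_sph_grad) auto

lemma H1R_norm_0_AE: "v \<in> H1R \<Longrightarrow> H1R_norm v = 0 \<Longrightarrow> AE x in surf. v x = 0"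
  using H1R_poincare[of v] l2_norm_nonneg[of surf v]
  by (intro l2_norm_eq_0_AE) (auto simp: H1R_iff H1_iff)

text \<open>By the Poincare inequality a Cauchy sequence of gradients comes from a Cauchy sequence of functions, and
  the weak gradient is closed.\<close>

lemma H1R_complete:
  fixes s :: "nat \<Rightarrow> real^3 \<Rightarrow> real"
  assumes s: "\<And>n. s n \<in> H1R"
    and cauchy: "\<And>e. e > 0 \<Longrightarrow> \<exists>N. \<forall>m\<ge>N. \<forall>n\<ge>N. H1R_norm (\<lambda>x. s m x - s n x) < e"
  shows "\<exists>u\<in>H1R. (\<lambda>n. H1R_norm (\<lambda>x. s n x - u x)) \<longlonglongrightarrow> 0"
proof -
  note sH = s[THEN H1R_H1]
  note sq = sH[THEN H1_sq_integrable]
  have "\<exists>G\<in>sq_integrable surf. (\<lambda>n. l2_norm surf (\<lambda>x. sph_grad (s n) x - G x)) \<longlonglongrightarrow> 0"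
  proof (rule L2_complete[OF finite_measure_surf])
    show "sph_grad (s n) \<in> sq_integrable surf" for n using sH by (rule sph_grad_sq_integrable)
    show "\<exists>N. \<forall>m\<ge>N. \<forall>n\<ge>N. l2_norm surf (\<lambda>x. sph_grad (s m) x - sph_grad (s n) x) < e" if "e > 0" for e
      using cauchy[OF that] by (simp add: H1R_norm_diff_eq[OF sH sH])
  qed
  then obtain G where G: "G \<in> sq_integrable surf"
    and G_lim: "(\<lambda>n. l2_norm surf (\<lambda>x. sph_grad (s n) x - G x)) \<longlonglongrightarrow> 0" by blast
  have "\<exists>u\<in>sq_integrable surf. (\<lambda>n. l2_norm surf (\<lambda>x. s n x - u x)) \<longlonglongrightarrow> 0"
  proof (rule L2_complete[OF finite_measure_surf])
    show "s n \<in> sq_integrable surf" for n by (rule sq)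
    fix e :: real assume "e > 0"
    have C: "2 * pi + 1 > 0" using pi_gt_zero by linarith
    then have "e / (2 * pi + 1) > 0" using \<open>e > 0\<close> by simp
    then obtain N where N: "\<forall>m\<ge>N. \<forall>n\<ge>N. H1R_norm (\<lambda>x. s m x - s n x) < e / (2 * pi + 1)"
      using cauchy by blast
    have "l2_norm surf (\<lambda>x. s m x - s n x) < e" if "m \<ge> N" "n \<ge> N" for m n
    proof -
      have "l2_norm surf (\<lambda>x. s m x - s n x) \<le> (2 * pi + 1) * H1R_norm (\<lambda>x. s m x - s n x)"
        by (intro H1R_poincare H1R_diff s)
      also have "\<dots> < (2 * pi + 1) * (e / (2 * pi + 1))"
        using N that C by (intro mult_strict_left_mono) auto
      finally show ?thesis using C by simp
    qed
    then show "\<exists>N. \<forall>m\<ge>N. \<forall>n\<ge>N. l2_norm surf (\<lambda>x. s m x - s n x) < e" by blast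
  qed
  then obtain u where u: "u \<in> sq_integrable surf"
    and u_lim: "(\<lambda>n. l2_norm surf (\<lambda>x. s n x - u x)) \<longlonglongrightarrow> 0" by blast
  \<comment> \<open>The limits of the functions and of their gradients were taken separately and are matched here.\<close>
  have weak: "is_weak_grad u G"
    by (rule weak_grad_limit[OF sq weak_grad_sph_grad[OF sH] u G u_lim G_lim])
  have uH: "u \<in> H1" using u weak by (auto simp: H1_iff)
  have one: "(\<lambda>x. 1::real) \<in> sq_integrable surf" by (rule sq_integrable_const[OF finite_measure_surf])
  have "(\<lambda>n. LINT x|surf. s n x) \<longlonglongrightarrow> (LINT x|surf. u x)"
  proof (rule LIM_zero_cancel, rule Lim_null_comparison[OF always_eventually], rule allI)
    fix n
    have "(LINT x|surf. s n x) - (LINT x|surf. u x) = (LINT x|surf. (s n x - u x) * 1)"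
      using integrable_sq_integrable[OF finite_measure_surf] sq u by simp
    then show "norm ((LINT x|surf. s n x) - (LINT x|surf. u x)) \<le> l2_norm surf (\<lambda>x. s n x - u x) * l2_norm surf (\<lambda>x. 1::real)"
      using l2_norm_cauchy_schwarz_real[OF sq_integrable_diff[OF sq u] one] by simp
    show "(\<lambda>n. l2_norm surf (\<lambda>x. s n x - u x) * l2_norm surf (\<lambda>x. 1::real)) \<longlonglongrightarrow> 0"
      using tendsto_mult_left_zero[OF u_lim] .
  qed
  then have "(LINT x|surf. u x) = 0" using s by (simp add: H1R_iff LIMSEQ_const_iff)
  then have uR: "u \<in> H1R" using uH by (simp add: H1R_iff)
  have "H1R_norm (\<lambda>x. s n x - u x) = l2_norm surf (\<lambda>x. sph_grad (s n) x - G x)" for n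
    unfolding H1R_norm_diff_eq[OF sH uH]
  proof (rule l2_norm_cong_AE)
    show "AE x in surf. sph_grad (s n) x - sph_grad u x = sph_grad (s n) x - G x"
      using sph_grad_AE[OF weak u] by eventually_elim simp
  qed (intro sq_integrable_measurable sq_integrable_diff sph_grad_sq_integrable sH uH G)+
  then have "(\<lambda>n. H1R_norm (\<lambda>x. s n x - u x)) \<longlonglongrightarrow> 0" using G_lim by (simp only:)
  then show ?thesis using uR by blast
qed

text \<open>On functions of mean zero the Poincare inequality controls the full Sobolev norm by the gradient norm.\<close>

lemma H1_dual_bound:
  assumes "f \<in> H1_dual"
  shows "\<exists>F\<ge>0. \<forall>v\<in>H1R. \<bar>f v\<bar> \<le> F * H1R_norm v"
proof -
  obtain C where C: "\<forall>v\<in>H1. \<bar>f v\<bar> \<le> C * H1_norm v" using assms unfolding H1_dual_def by blast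
  have "\<bar>f v\<bar> \<le> (\<bar>C\<bar> * (2 * pi + 2)) * H1R_norm v" if v: "v \<in> H1R" for v
  proof -
    have "H1_norm v = sqrt ((l2_norm surf v)\<^sup>2 + (H1R_norm v)\<^sup>2)"
      by (simp add: H1_norm_def H1R_norm_eq l2_norm_power2)
    also have "\<dots> \<le> l2_norm surf v + H1R_norm v"
      by (rule sqrt_sum_squares_le_sum) (simp_all add: H1R_norm_nonneg)
    also have "\<dots> \<le> (2 * pi + 2) * H1R_norm v" using H1R_poincare[OF v] by (simp add: algebra_simps)
    finally have n: "H1_norm v \<le> (2 * pi + 2) * H1R_norm v" .
    have "0 \<le> H1_norm v" by (simp add: H1_norm_def)
    have "\<bar>f v\<bar> \<le> C * H1_norm v" using C v by (simp add: H1R_iff)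
    also have "\<dots> \<le> \<bar>C\<bar> * H1_norm v" using \<open>0 \<le> H1_norm v\<close> by (intro mult_right_mono) auto
    also have "\<dots> \<le> \<bar>C\<bar> * ((2 * pi + 2) * H1R_norm v)" by (intro mult_left_mono n) auto
    finally show ?thesis by (simp add: mult.assoc)
  qed
  then show ?thesis by (intro exI[of _ "\<bar>C\<bar> * (2 * pi + 2)"]) auto
qed

lemma H1_dual_combination:
  assumes f: "f \<in> H1_dual" and "v \<in> H1R" "w \<in> H1R"
  shows "f (\<lambda>x. v x + c * w x) = f v + c * f w"
proof -
  have "v \<in> H1" "w \<in> H1" using assms by (auto dest: H1R_H1)
  moreover have "(\<lambda>x. c * w x) \<in> H1" using H1_combination(1)[OF H1R_H1[OF H1R_zero] \<open>w \<in> H1\<close>, of c] by simp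
  ultimately show ?thesis using f by (simp add: H1_dual_def)
qed

definition diffusion_form :: "(real^3 \<Rightarrow> real) \<Rightarrow> (real^3 \<Rightarrow> real) \<Rightarrow> (real^3 \<Rightarrow> real) \<Rightarrow> real" where
  "diffusion_form a u v = (LINT x|surf. (a x *\<^sub>R sph_grad u x) \<bullet> sph_grad v x)"

lemma weak_solution_iff: "weak_solution a f u \<longleftrightarrow> (\<forall>v\<in>H1R. diffusion_form a u v = f v)"
  by (simp add: weak_solution_def diffusion_form_def)

text \<open>The coefficient may be discontinuous, as are the approximations by which measurability in \<open>\<omega>\<close> is shown.\<close>

locale elliptic_coefficient =
  fixes a :: "real^3 \<Rightarrow> real" and lo hi :: real
  assumes a_measurable [measurable]: "a \<in> borel_measurable surf"
    and lo_pos: "0 < lo" and a_ge: "\<And>x. x \<in> S2 \<Longrightarrow> lo \<le> a x" and a_le: "\<And>x. x \<in> S2 \<Longrightarrow> a x \<le> hi"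
begin

lemma a_scaleR_sq_integrable:
  assumes G: "G \<in> sq_integrable surf"
  shows "(\<lambda>x. a x *\<^sub>R G x) \<in> sq_integrable surf"
proof -
  note [measurable] = sq_integrable_measurable[OF G]
  have "integrable surf (\<lambda>x. hi\<^sup>2 * (norm (G x))\<^sup>2)" using sq_integrable_integrable[OF G] by simp
  then have "integrable surf (\<lambda>x. (norm (a x *\<^sub>R G x))\<^sup>2)"
  proof (rule Bochner_Integration.integrable_bound)
    show "AE x in surf. norm ((norm (a x *\<^sub>R G x))\<^sup>2) \<le> norm (hi\<^sup>2 * (norm (G x))\<^sup>2)"
    proof (rule AE_I2)
      fix x assume "x \<in> space surf"
      then have "0 \<le> a x" "a x \<le> hi" using a_ge[of x] a_le[of x] lo_pos by auto
      then have "(a x)\<^sup>2 * (norm (G x))\<^sup>2 \<le> hi\<^sup>2 * (norm (G x))\<^sup>2"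
        by (intro mult_right_mono power_mono) auto
      then show "norm ((norm (a x *\<^sub>R G x))\<^sup>2) \<le> norm (hi\<^sup>2 * (norm (G x))\<^sup>2)"
        by (simp add: power_mult_distrib)
    qed
  qed measurable
  then show ?thesis by (simp add: sq_integrable_def)
qed

lemma form_integrable:
  "G \<in> sq_integrable surf \<Longrightarrow> H \<in> sq_integrable surf \<Longrightarrow> integrable surf (\<lambda>x. (a x *\<^sub>R G x) \<bullet> (H x :: real^3))"
  by (intro integrable_inner_sq_integrable a_scaleR_sq_integrable)

lemma form_coercive:
  assumes "v \<in> H1"
  shows "lo * (H1R_norm v)\<^sup>2 \<le> diffusion_form a v v" "diffusion_form a v v \<le> hi * (H1R_norm v)\<^sup>2"
proof -
  note G = sph_grad_sq_integrable[OF assms]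
  have b: "lo * (norm (sph_grad v x))\<^sup>2 \<le> (a x *\<^sub>R sph_grad v x) \<bullet> sph_grad v x"
    "(a x *\<^sub>R sph_grad v x) \<bullet> sph_grad v x \<le> hi * (norm (sph_grad v x))\<^sup>2" if "x \<in> space surf" for x
    using a_ge[of x] a_le[of x] that
    by (auto simp: power2_norm_eq_inner[symmetric] intro!: mult_right_mono)
  have "(LINT x|surf. lo * (norm (sph_grad v x))\<^sup>2) \<le> diffusion_form a v v"
    unfolding diffusion_form_def using b sq_integrable_integrable[OF G]
    by (intro integral_mono form_integrable G) auto
  then show "lo * (H1R_norm v)\<^sup>2 \<le> diffusion_form a v v" by (simp add: H1R_norm_eq l2_norm_power2)
  have "diffusion_form a v v \<le> (LINT x|surf. hi * (norm (sph_grad v x))\<^sup>2)"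
    unfolding diffusion_form_def using b sq_integrable_integrable[OF G]
    by (intro integral_mono form_integrable G) auto
  then show "diffusion_form a v v \<le> hi * (H1R_norm v)\<^sup>2" by (simp add: H1R_norm_eq l2_norm_power2)
qed

lemma form_combination_left:
  assumes "u \<in> H1" "v \<in> H1" "w \<in> H1"
  shows "diffusion_form a (\<lambda>x. v x + c * w x) u = diffusion_form a v u + c * diffusion_form a w u"
proof -
  note G = assms[THEN sph_grad_sq_integrable]
  note comb = H1_combination[OF assms(2,3), of c]
  have "diffusion_form a (\<lambda>x. v x + c * w x) u
      = (LINT x|surf. (a x *\<^sub>R sph_grad v x) \<bullet> sph_grad u x + c * ((a x *\<^sub>R sph_grad w x) \<bullet> sph_grad u x))"
    unfolding diffusion_form_def
  proof (rule integral_cong_AE)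
    show "AE x in surf. (a x *\<^sub>R sph_grad (\<lambda>x. v x + c * w x) x) \<bullet> sph_grad u x
        = (a x *\<^sub>R sph_grad v x) \<bullet> sph_grad u x + c * ((a x *\<^sub>R sph_grad w x) \<bullet> sph_grad u x)"
      using comb(2) by eventually_elim (simp add: inner_add_left distrib_left)
    show "(\<lambda>x. (a x *\<^sub>R sph_grad (\<lambda>x. v x + c * w x) x) \<bullet> sph_grad u x) \<in> borel_measurable surf"
      by (rule borel_measurable_integrable[OF form_integrable[OF sph_grad_sq_integrable[OF comb(1)] G(1)]])
    show "(\<lambda>x. (a x *\<^sub>R sph_grad v x) \<bullet> sph_grad u x + c * ((a x *\<^sub>R sph_grad w x) \<bullet> sph_grad u x)) \<in> borel_measurable surf"
      using borel_measurable_integrable[OF form_integrable[OF G(2,1)]]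
        borel_measurable_integrable[OF form_integrable[OF G(3,1)]] by simp
  qed
  also have "\<dots> = diffusion_form a v u + c * diffusion_form a w u"
    unfolding diffusion_form_def using form_integrable[OF G(2,1)] form_integrable[OF G(3,1)] by simp
  finally show ?thesis .
qed

lemma form_diff_left:
  assumes "u \<in> H1" "v \<in> H1" "w \<in> H1"
  shows "diffusion_form a (\<lambda>x. v x - w x) u = diffusion_form a v u - diffusion_form a w u"
  using form_combination_left[OF assms, of "-1"] by simp

lemma complete_form_H1R: "complete_form H1R (diffusion_form a)"
proof
  show "(\<lambda>_. 0) \<in> H1R" by (rule H1R_zero)
  show "(\<lambda>x. v x + c * w x) \<in> H1R" if "v \<in> H1R" "w \<in> H1R" for v w c using that by (rule H1R_combination)
  show "diffusion_form a v w = diffusion_form a w v" for v w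
    unfolding diffusion_form_def by (simp add: inner_commute)
  show "diffusion_form a (\<lambda>x. v x + c * w x) u = diffusion_form a v u + c * diffusion_form a w u"
    if "u \<in> H1R" "v \<in> H1R" "w \<in> H1R" for u v w c
    using that by (intro form_combination_left H1R_H1)
  show "0 \<le> diffusion_form a v v" if "v \<in> H1R" for v
    using form_coercive(1)[OF H1R_H1[OF that]] lo_pos
    by (meson order_trans mult_nonneg_nonneg less_imp_le zero_le_power2)
  fix s :: "nat \<Rightarrow> real^3 \<Rightarrow> real"
  assume s: "\<And>n. s n \<in> H1R"
    and cauchy: "\<And>e. e > 0 \<Longrightarrow> \<exists>N. \<forall>m\<ge>N. \<forall>n\<ge>N. diffusion_form a (\<lambda>x. s m x - s n x) (\<lambda>x. s m x - s n x) < e"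
  have "\<exists>u\<in>H1R. (\<lambda>n. H1R_norm (\<lambda>x. s n x - u x)) \<longlonglongrightarrow> 0"
  proof (rule H1R_complete[OF s])
    fix e :: real assume "e > 0"
    then obtain N where N: "\<forall>m\<ge>N. \<forall>n\<ge>N. diffusion_form a (\<lambda>x. s m x - s n x) (\<lambda>x. s m x - s n x) < lo * e\<^sup>2"
      using cauchy[of "lo * e\<^sup>2"] lo_pos by auto
    have "H1R_norm (\<lambda>x. s m x - s n x) < e" if "m \<ge> N" "n \<ge> N" for m n
    proof -
      have "lo * (H1R_norm (\<lambda>x. s m x - s n x))\<^sup>2 < lo * e\<^sup>2"
        using N that form_coercive(1)[OF H1R_H1[OF H1R_diff[OF s s]], of m n] by (meson le_less_trans)
      then have "(H1R_norm (\<lambda>x. s m x - s n x))\<^sup>2 < e\<^sup>2" using lo_pos by simp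
      then show ?thesis using \<open>e > 0\<close> by (intro power2_less_imp_less[of _ e]) auto
    qed
    then show "\<exists>N. \<forall>m\<ge>N. \<forall>n\<ge>N. H1R_norm (\<lambda>x. s m x - s n x) < e" by blast
  qed
  then obtain u where u: "u \<in> H1R" and lim: "(\<lambda>n. H1R_norm (\<lambda>x. s n x - u x)) \<longlonglongrightarrow> 0" by blast
  have "(\<lambda>n. diffusion_form a (\<lambda>x. s n x - u x) (\<lambda>x. s n x - u x)) \<longlonglongrightarrow> 0"
  proof (rule Lim_null_comparison[OF always_eventually], rule allI)
    fix n
    note d = H1R_H1[OF H1R_diff[OF s u], of n]
    have "0 \<le> lo * (H1R_norm (\<lambda>x. s n x - u x))\<^sup>2" using lo_pos by simp
    then show "norm (diffusion_form a (\<lambda>x. s n x - u x) (\<lambda>x. s n x - u x)) \<le> hi * (H1R_norm (\<lambda>x. s n x - u x))\<^sup>2"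
      using form_coercive[OF d] by simp
    show "(\<lambda>n. hi * (H1R_norm (\<lambda>x. s n x - u x))\<^sup>2) \<longlonglongrightarrow> 0"
      using tendsto_mult_right_zero[OF tendsto_null_power[OF lim, of 2], of hi] by simp
  qed
  then show "\<exists>u\<in>H1R. (\<lambda>n. diffusion_form a (\<lambda>x. s n x - u x) (\<lambda>x. s n x - u x)) \<longlonglongrightarrow> 0"
    using u by blast
qed

theorem weak_solution_exists:
  assumes f: "f \<in> H1_dual"
  shows "\<exists>u\<in>H1R. weak_solution a f u"
proof -
  interpret complete_form H1R "diffusion_form a" by (rule complete_form_H1R)
  obtain F where F: "F \<ge> 0" "\<And>v. v \<in> H1R \<Longrightarrow> \<bar>f v\<bar> \<le> F * H1R_norm v"
    using H1_dual_bound[OF f] by blast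
  show ?thesis unfolding weak_solution_iff
  proof (rule riesz_representation)
    show "f (\<lambda>x. v x + c * w x) = f v + c * f w" if "v \<in> H1R" "w \<in> H1R" for v w c
      using H1_dual_combination[OF f that] .
    show "\<bar>f v\<bar> \<le> (F / sqrt lo) * sqrt (diffusion_form a v v)" if v: "v \<in> H1R" for v
    proof -
      have "sqrt lo * H1R_norm v = sqrt (lo * (H1R_norm v)\<^sup>2)"
        by (simp add: real_sqrt_mult H1R_norm_nonneg)
      also have "\<dots> \<le> sqrt (diffusion_form a v v)"
        using form_coercive(1)[OF H1R_H1[OF v]] by (rule real_sqrt_le_mono)
      finally have "H1R_norm v \<le> sqrt (diffusion_form a v v) / sqrt lo"
        using lo_pos by (simp add: field_simps)
      then have "F * H1R_norm v \<le> F * (sqrt (diffusion_form a v v) / sqrt lo)" using F(1) by (rule mult_left_mono)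
      then show ?thesis using F(2)[OF v] by simp
    qed
  qed
qed

lemma weak_solution_bound:
  assumes u: "u \<in> H1R" "weak_solution a f u" and F: "\<And>v. v \<in> H1R \<Longrightarrow> \<bar>f v\<bar> \<le> F * H1R_norm v" "0 \<le> F"
  shows "H1R_norm u \<le> F / lo"
proof (cases "H1R_norm u = 0")
  case False
  then have pos: "H1R_norm u > 0" using H1R_norm_nonneg[of u] by linarith
  have "lo * (H1R_norm u)\<^sup>2 \<le> f u"
    using form_coercive(1)[OF H1R_H1[OF u(1)]] u by (simp add: weak_solution_iff)
  also have "\<dots> \<le> F * H1R_norm u" using F(1)[OF u(1)] by linarith
  finally have "lo * H1R_norm u \<le> F" using pos by (simp add: power2_eq_square)
  then show ?thesis using lo_pos by (simp add: field_simps)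
qed (use lo_pos F(2) in simp)

end

text \<open>For \<open>e = u - w\<close> both equations are tested with \<open>e\<close>: the form of \<open>a\<close> at \<open>(e, e)\<close> equals
  \<open>\<integral> (b - a) \<nabla>w \<bullet> \<nabla>e\<close>.\<close>

lemma weak_solution_perturbation:
  assumes a: "elliptic_coefficient a lo hi" and b: "elliptic_coefficient b lo' hi'"
    and u: "u \<in> H1R" "weak_solution a f u" and w: "w \<in> H1R" "weak_solution b f w"
    and d: "\<And>x. x \<in> S2 \<Longrightarrow> \<bar>a x - b x\<bar> \<le> d" "0 \<le> d"
  shows "H1R_norm (\<lambda>x. u x - w x) \<le> d * H1R_norm w / lo"
proof -
  interpret a: elliptic_coefficient a lo hi by fact
  interpret b: elliptic_coefficient b lo' hi' by fact
  let ?e = "\<lambda>x. u x - w x"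
  have e: "?e \<in> H1R" using u w by (intro H1R_diff)
  note H = H1R_H1[OF u(1)] H1R_H1[OF w(1)] H1R_H1[OF e]
  note G = H[THEN sph_grad_sq_integrable]
  have bG: "(\<lambda>x. (b x - a x) *\<^sub>R sph_grad w x) \<in> sq_integrable surf"
    using sq_integrable_diff[OF b.a_scaleR_sq_integrable[OF G(2)] a.a_scaleR_sq_integrable[OF G(2)]]
    by (simp add: scaleR_diff_left)
  have "lo * (H1R_norm ?e)\<^sup>2 \<le> diffusion_form a ?e ?e" by (rule a.form_coercive(1)[OF H(3)])
  also have "\<dots> = diffusion_form a u ?e - diffusion_form a w ?e" by (rule a.form_diff_left[OF H(3,1,2)])
  also have "diffusion_form a u ?e = diffusion_form b w ?e" using u w e by (simp add: weak_solution_iff)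
  also have "diffusion_form b w ?e - diffusion_form a w ?e
      = (LINT x|surf. ((b x - a x) *\<^sub>R sph_grad w x) \<bullet> sph_grad ?e x)"
    unfolding diffusion_form_def using a.form_integrable[OF G(2,3)] b.form_integrable[OF G(2,3)]
    by (simp add: left_diff_distrib)
  also have "\<dots> \<le> l2_norm surf (\<lambda>x. (b x - a x) *\<^sub>R sph_grad w x) * l2_norm surf (sph_grad ?e)"
    using l2_norm_cauchy_schwarz[OF bG G(3)] by linarith
  also have "\<dots> \<le> (d * H1R_norm w) * H1R_norm ?e"
    unfolding H1R_norm_eq
  proof (rule mult_right_mono)
    have "(LINT x|surf. (norm ((b x - a x) *\<^sub>R sph_grad w x))\<^sup>2) \<le> (LINT x|surf. d\<^sup>2 * (norm (sph_grad w x))\<^sup>2)"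
    proof (rule integral_mono)
      fix x assume "x \<in> space surf"
      then have "\<bar>b x - a x\<bar>\<^sup>2 \<le> d\<^sup>2" using d(1)[of x] by (intro power_mono) (auto simp: abs_minus_commute)
      then show "(norm ((b x - a x) *\<^sub>R sph_grad w x))\<^sup>2 \<le> d\<^sup>2 * (norm (sph_grad w x))\<^sup>2"
        by (simp add: power_mult_distrib mult_right_mono)
    qed (use sq_integrable_integrable[OF bG] sq_integrable_integrable[OF G(2)] in simp_all)
    then have "(l2_norm surf (\<lambda>x. (b x - a x) *\<^sub>R sph_grad w x))\<^sup>2 \<le> (d * l2_norm surf (sph_grad w))\<^sup>2"
      by (simp add: l2_norm_power2 power_mult_distrib)
    then show "l2_norm surf (\<lambda>x. (b x - a x) *\<^sub>R sph_grad w x) \<le> d * l2_norm surf (sph_grad w)"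
      by (rule power2_le_imp_le) (use d(2) in simp)
  qed simp
  finally have 1: "lo * (H1R_norm ?e)\<^sup>2 \<le> (d * H1R_norm w) * H1R_norm ?e" .
  show ?thesis
  proof (cases "H1R_norm ?e = 0")
    case True
    then show ?thesis using d(2) a.lo_pos H1R_norm_nonneg[of w] by simp
  next
    case False
    then have "H1R_norm ?e > 0" using H1R_norm_nonneg[of ?e] by linarith
    then have "lo * H1R_norm ?e \<le> d * H1R_norm w" using 1 by (simp add: power2_eq_square)
    then show ?thesis using a.lo_pos by (simp add: field_simps)
  qed
qed

lemma weak_solution_unique:
  assumes a: "elliptic_coefficient a lo hi"
    and u: "u \<in> H1R" "weak_solution a f u" and w: "w \<in> H1R" "weak_solution a f w"
  shows "AE x in surf. u x = w x"
proof -
  have "H1R_norm (\<lambda>x. u x - w x) = 0"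
    using weak_solution_perturbation[OF a a u w, of 0] H1R_norm_nonneg[of "\<lambda>x. u x - w x"] by simp
  from H1R_norm_0_AE[OF H1R_diff[OF u(1) w(1)] this] show ?thesis by simp
qed

section \<open>Measurable dependence on the coefficient\<close>

definition cell_index :: "nat \<Rightarrow> real^3 \<Rightarrow> int \<times> int \<times> int" where
  "cell_index n x = (\<lfloor>real (Suc n) * x $ 1\<rfloor>, \<lfloor>real (Suc n) * x $ 2\<rfloor>, \<lfloor>real (Suc n) * x $ 3\<rfloor>)"

text \<open>The chosen point depends only on the cell of the cubic grid of width \<open>1 / (n + 1)\<close> that contains \<open>x\<close>,
  so that finitely many points of the sphere are chosen.\<close>

definition cell_point :: "nat \<Rightarrow> real^3 \<Rightarrow> real^3" where
  "cell_point n x = (SOME y. y \<in> S2 \<and> cell_index n y = cell_index n x)"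

lemma cell_point:
  assumes "x \<in> S2"
  shows "cell_point n x \<in> S2" "cell_index n (cell_point n x) = cell_index n x"
  using someI[of "\<lambda>y. y \<in> S2 \<and> cell_index n y = cell_index n x" x] assms
  unfolding cell_point_def by blast+

lemma floor_eq_dist: "\<lfloor>c * s\<rfloor> = \<lfloor>c * t\<rfloor> \<Longrightarrow> 0 < c \<Longrightarrow> \<bar>s - t\<bar> < 1 / (c::real)"
proof -
  assume "\<lfloor>c * s\<rfloor> = \<lfloor>c * t\<rfloor>" "0 < c"
  then have "\<bar>c * s - c * t\<bar> < 1" by linarith
  also have "\<bar>c * s - c * t\<bar> = c * \<bar>s - t\<bar>" using \<open>0 < c\<close> by (simp add: abs_mult flip: right_diff_distrib)
  finally show ?thesis using \<open>0 < c\<close> by (simp add: field_simps)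
qed

lemma dist_cell_point:
  assumes "x \<in> S2"
  shows "dist (cell_point n x) x < 3 / real (Suc n)"
proof -
  let ?y = "cell_point n x"
  have "\<bar>?y $ i - x $ i\<bar> < 1 / real (Suc n)" for i
  proof (rule floor_eq_dist)
    show "\<lfloor>real (Suc n) * ?y $ i\<rfloor> = \<lfloor>real (Suc n) * x $ i\<rfloor>"
      using cell_point(2)[OF assms, of n] exhaust_3[of i] unfolding cell_index_def by auto
  qed simp
  from this[of 1] this[of 2] this[of 3]
  have "(\<Sum>i\<in>UNIV. \<bar>(?y - x) $ i\<bar>) < 3 * (1 / real (Suc n))" unfolding sum_3 vector_minus_component by linarith
  then show ?thesis using norm_le_l1_cart[of "?y - x"] by (simp add: dist_norm)
qed

lemma finite_cell_points: "finite (cell_point n ` S2)"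
proof -
  have "cell_index n x \<in> {- int (Suc n)..int (Suc n)} \<times> {- int (Suc n)..int (Suc n)} \<times> {- int (Suc n)..int (Suc n)}"
    if "x \<in> S2" for x
  proof -
    have "\<lfloor>real (Suc n) * x $ i\<rfloor> \<in> {- int (Suc n)..int (Suc n)}" for i
    proof -
      have "\<bar>x $ i\<bar> \<le> 1" using component_le_norm_cart[of x i] that by simp
      then have "\<bar>real (Suc n) * x $ i\<bar> \<le> real (Suc n) * 1"
        unfolding abs_mult by (intro mult_mono) auto
      then show ?thesis unfolding atLeastAtMost_iff by (auto simp: le_floor_iff floor_le_iff)
    qed
    then show ?thesis by (simp add: cell_index_def)
  qed
  then have "cell_index n ` S2
      \<subseteq> {- int (Suc n)..int (Suc n)} \<times> {- int (Suc n)..int (Suc n)} \<times> {- int (Suc n)..int (Suc n)}"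
    by (intro image_subsetI)
  then have "finite (cell_index n ` S2)" by (rule finite_subset) simp
  then have "finite ((\<lambda>k. SOME y. y \<in> S2 \<and> cell_index n y = k) ` cell_index n ` S2)" by (rule finite_imageI)
  then show ?thesis unfolding cell_point_def[abs_def] image_image .
qed

lemma cell_point_measurable:
  fixes h :: "real^3 \<Rightarrow> real"
  shows "(\<lambda>x. h (cell_point n x)) \<in> borel_measurable surf"
proof -
  have nth: "(\<lambda>x::real^3. real (Suc n) * x $ i) \<in> borel_measurable surf" for i
    by (intro surf.borel_measurable_restrict borel_measurable_continuous_onI continuous_intros)
  have fl: "(\<lambda>x::real^3. \<lfloor>real (Suc n) * x $ i\<rfloor>) \<in> surf \<rightarrow>\<^sub>M count_space UNIV" for i
    using measurable_compose[OF nth measurable_real_floor] .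
  have "cell_index n \<in> surf \<rightarrow>\<^sub>M count_space UNIV"
  proof -
    have "cell_index n \<in> surf \<rightarrow>\<^sub>M count_space UNIV \<Otimes>\<^sub>M (count_space UNIV \<Otimes>\<^sub>M count_space UNIV)"
      unfolding cell_index_def[abs_def] by (intro measurable_Pair fl)
    then show ?thesis by (simp add: pair_measure_countable)
  qed
  from measurable_compose[OF this, of "\<lambda>k. h (SOME y. y \<in> S2 \<and> cell_index n y = k)" borel]
  show ?thesis by (simp add: cell_point_def)
qed

text \<open>Clipping before rounding makes the range finite.\<close>

definition grid_round :: "nat \<Rightarrow> real \<Rightarrow> real" where
  "grid_round n t = real_of_int \<lfloor>real (Suc n) * max (- real (Suc n)) (min (real (Suc n)) t)\<rfloor> / real (Suc n)"

lemma grid_round_measurable [measurable]: "grid_round n \<in> borel_measurable borel"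
  unfolding grid_round_def by measurable

lemma finite_range_grid_round: "finite (range (grid_round n))"
proof -
  have "grid_round n t \<in> (\<lambda>k. real_of_int k / real (Suc n)) ` {- int (Suc n * Suc n)..int (Suc n * Suc n)}" for t
  proof -
    define m where "m = max (- real (Suc n)) (min (real (Suc n)) t)"
    have "\<bar>m\<bar> \<le> real (Suc n)" by (auto simp: m_def)
    then have "\<bar>real (Suc n) * m\<bar> \<le> real (Suc n) * real (Suc n)"
      unfolding abs_mult by (intro mult_mono) auto
    moreover have k: "real_of_int (int (Suc n * Suc n)) = real (Suc n) * real (Suc n)"
      by (simp add: algebra_simps)
    ultimately have "real_of_int (- int (Suc n * Suc n)) \<le> real (Suc n) * m"
      "real (Suc n) * m < real_of_int (int (Suc n * Suc n)) + 1"
      unfolding abs_le_iff of_int_minus k by linarith+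
    then have "\<lfloor>real (Suc n) * m\<rfloor> \<in> {- int (Suc n * Suc n)..int (Suc n * Suc n)}"
      unfolding atLeastAtMost_iff le_floor_iff floor_le_iff by blast
    then show ?thesis unfolding grid_round_def m_def by (rule imageI)
  qed
  then have "range (grid_round n)
      \<subseteq> (\<lambda>k. real_of_int k / real (Suc n)) ` {- int (Suc n * Suc n)..int (Suc n * Suc n)}"
    by (intro image_subsetI)
  then show ?thesis by (rule finite_subset) simp
qed

lemma grid_round_dist:
  assumes "\<bar>t\<bar> \<le> real (Suc n)"
  shows "\<bar>grid_round n t - t\<bar> \<le> 1 / real (Suc n)"
proof -
  have "max (- real (Suc n)) (min (real (Suc n)) t) = t" using assms by auto
  then have "\<bar>grid_round n t - t\<bar> = \<bar>real_of_int \<lfloor>real (Suc n) * t\<rfloor> - real (Suc n) * t\<bar> / real (Suc n)"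
    by (simp add: grid_round_def field_simps del: of_nat_Suc)
  also have "\<dots> \<le> 1 / real (Suc n)" by (intro divide_right_mono) linarith+
  finally show ?thesis .
qed

lemma grid_round_le: "\<bar>grid_round n t\<bar> \<le> \<bar>t\<bar> + 1"
proof -
  define m where "m = max (- real (Suc n)) (min (real (Suc n)) t)"
  have m: "\<bar>m\<bar> \<le> \<bar>t\<bar>" "\<bar>m\<bar> \<le> real (Suc n)" by (auto simp: m_def)
  have "grid_round n t = grid_round n m" by (simp add: grid_round_def m_def)
  moreover have "\<bar>grid_round n m - m\<bar> \<le> 1 / real (Suc n)" by (rule grid_round_dist[OF m(2)])
  moreover have "1 / real (Suc n) \<le> 1" by simp
  ultimately show ?thesis using m(1) by linarith
qed

lemma simple_function_family:
  assumes "finite Y" "\<And>y. y \<in> Y \<Longrightarrow> simple_function M (g y)"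
  shows "simple_function M (\<lambda>\<omega> y. if y \<in> Y then g y \<omega> else z)"
  using assms
proof (induction Y rule: finite_induct)
  case (insert y Y)
  define W where "W \<omega> = (\<lambda>y'. if y' \<in> Y then g y' \<omega> else z)" for \<omega>
  have "simple_function M W" unfolding W_def using insert by simp
  moreover have "simple_function M (g y)" using insert by simp
  ultimately have "simple_function M (\<lambda>\<omega>. (W \<omega>)(y := g y \<omega>))"
    by (rule simple_function_compose2)
  moreover have "(W \<omega>)(y := g y \<omega>) = (\<lambda>y'. if y' \<in> insert y Y then g y' \<omega> else z)" for \<omega>
    by (auto simp: fun_eq_iff W_def)
  ultimately show ?case by simp
qed simp

text \<open>\<open>exp t \<ge> exp s (1 + t - s)\<close> by convexity.\<close>

lemma abs_exp_diff_le:
  fixes s t c :: real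
  assumes "\<bar>s\<bar> \<le> c" "\<bar>t\<bar> \<le> c"
  shows "\<bar>exp s - exp t\<bar> \<le> exp c * \<bar>s - t\<bar>"
proof -
  have *: "exp s - exp t \<le> exp c * (s - t)" if "t \<le> s" "s \<le> c" for s t :: real
  proof -
    have "exp s * (1 + (t - s)) \<le> exp s * exp (t - s)" by (intro mult_left_mono exp_ge_add_one_self) auto
    also have "exp s * exp (t - s) = exp t" by (simp flip: exp_add)
    finally have "exp s - exp t \<le> exp s * (s - t)" by (simp add: algebra_simps)
    also have "\<dots> \<le> exp c * (s - t)" using that by (intro mult_right_mono) auto
    finally show ?thesis .
  qed
  have "s \<le> c" "t \<le> c" using assms by auto
  then show ?thesis using *[of t s] *[of s t] by (cases "t \<le> s") auto
qed

lemma elliptic_coefficient_exp: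
  assumes "h \<in> borel_measurable surf" "\<And>x. x \<in> S2 \<Longrightarrow> \<bar>h x\<bar> \<le> c"
  shows "elliptic_coefficient (\<lambda>x. exp (h x)) (exp (- c)) (exp c)"
proof
  show "(\<lambda>x. exp (h x)) \<in> borel_measurable surf" using assms(1) by measurable
  show "exp (- c) \<le> exp (h x)" "exp (h x) \<le> exp c" if "x \<in> S2" for x
    using assms(2)[OF that] by (auto simp: abs_le_iff)
qed simp

lemma continuous_on_S2_measurable:
  "continuous_on S2 (h :: real^3 \<Rightarrow> real) \<Longrightarrow> h \<in> borel_measurable surf"
  by (subst measurable_cong_sets[OF sets_surf refl]) (rule borel_measurable_continuous_on_restrict)

text \<open>The representative of the solution is chosen for each exponent \<open>h\<close> and not for each \<open>\<omega>\<close>, so that a random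
  exponent with finitely many values has a solution with finitely many values.\<close>

definition solution :: "((real^3 \<Rightarrow> real) \<Rightarrow> real) \<Rightarrow> (real^3 \<Rightarrow> real) \<Rightarrow> real^3 \<Rightarrow> real" where
  "solution f h = (SOME u. u \<in> H1R \<and> weak_solution (\<lambda>x. exp (h x)) f u)"

lemma solution:
  assumes "f \<in> H1_dual" "h \<in> borel_measurable surf" "\<And>x. x \<in> S2 \<Longrightarrow> \<bar>h x\<bar> \<le> c"
  shows "solution f h \<in> H1R" "weak_solution (\<lambda>x. exp (h x)) f (solution f h)"
proof -
  interpret elliptic_coefficient "\<lambda>x. exp (h x)" "exp (- c)" "exp c"
    using assms(2,3) by (rule elliptic_coefficient_exp)
  have "\<exists>u. u \<in> H1R \<and> weak_solution (\<lambda>x. exp (h x)) f u" using weak_solution_exists[OF assms(1)] by blast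
  then have "solution f h \<in> H1R \<and> weak_solution (\<lambda>x. exp (h x)) f (solution f h)"
    unfolding solution_def by (rule someI_ex)
  then show "solution f h \<in> H1R" "weak_solution (\<lambda>x. exp (h x)) f (solution f h)" by auto
qed

text \<open>The condition always holds on the sphere. It makes the discretised function a function of the rounded
  values on the finite net everywhere, so that it is determined by finitely many of the values of \<open>h\<close>.\<close>

definition discretised :: "nat \<Rightarrow> (real^3 \<Rightarrow> real) \<Rightarrow> real^3 \<Rightarrow> real" where
  "discretised n h x = (if cell_point n x \<in> cell_point n ` S2 then grid_round n (h (cell_point n x)) else 0)"

lemma discretised_eq: "x \<in> S2 \<Longrightarrow> discretised n h x = grid_round n (h (cell_point n x))"
  by (simp add: discretised_def)

lemma discretised_measurable: "discretised n h \<in> borel_measurable surf"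
  using cell_point_measurable[of "\<lambda>y. if y \<in> cell_point n ` S2 then grid_round n (h y) else 0" n]
  by (simp add: discretised_def[abs_def])

lemma discretised_bound:
  assumes "\<And>x. x \<in> S2 \<Longrightarrow> \<bar>h x\<bar> \<le> c" "x \<in> S2"
  shows "\<bar>discretised n h x\<bar> \<le> c + 1"
  using grid_round_le[of n "h (cell_point n x)"] assms(1)[OF cell_point(1)[OF assms(2)], of n] discretised_eq[OF assms(2)]
  by (simp del: of_nat_Suc)

text \<open>A continuous function on the sphere is uniformly continuous, and it is bounded, so that from some \<open>n\<close>
  on its values are not clipped.\<close>

lemma discretised_uniform_limit:
  assumes h: "continuous_on S2 h" and e: "e > 0"
  shows "\<exists>N. \<forall>n\<ge>N. \<forall>x\<in>S2. \<bar>discretised n h x - h x\<bar> \<le> e"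
proof -
  have "uniformly_continuous_on S2 h" using h by (intro compact_uniformly_continuous) auto
  then obtain d where d: "d > 0" "\<And>x y. x \<in> S2 \<Longrightarrow> y \<in> S2 \<Longrightarrow> dist y x < d \<Longrightarrow> dist (h y) (h x) < e / 2"
    unfolding uniformly_continuous_on_def using e by (metis half_gt_zero)
  have "(\<lambda>n. 3 / real (Suc n)) \<longlonglongrightarrow> 0" "(\<lambda>n. 1 / real (Suc n)) \<longlonglongrightarrow> 0"
    using LIMSEQ_Suc[OF lim_const_over_n[of "3::real"]] LIMSEQ_Suc[OF lim_const_over_n[of "1::real"]] by simp_all
  then have "\<forall>\<^sub>F n in sequentially. 3 / real (Suc n) < d" "\<forall>\<^sub>F n in sequentially. 1 / real (Suc n) < e / 2"
    using d(1) e by (auto simp del: of_nat_Suc dest: order_tendstoD(2)[of _ 0 _ d] order_tendstoD(2)[of _ 0 _ "e / 2"])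
  moreover obtain K :: nat where K: "sup_abs h \<le> real K" using real_arch_simple by blast
  have "\<forall>\<^sub>F n in sequentially. n \<ge> K" by (rule eventually_ge_at_top)
  ultimately have "\<forall>\<^sub>F n in sequentially. \<forall>x\<in>S2. \<bar>discretised n h x - h x\<bar> \<le> e"
  proof eventually_elim
    case (elim n)
    show ?case
    proof
      fix x assume x: "x \<in> S2"
      let ?y = "cell_point n x"
      have "\<bar>h ?y\<bar> \<le> sup_abs h" by (rule abs_le_sup_abs[OF h cell_point(1)[OF x]])
      also have "\<dots> \<le> real (Suc n)" using K elim(3) by linarith
      finally have "\<bar>grid_round n (h ?y) - h ?y\<bar> \<le> 1 / real (Suc n)" by (rule grid_round_dist)
      moreover have "\<bar>h ?y - h x\<bar> < e / 2"
        using d(2)[OF x cell_point(1)[OF x]] dist_cell_point[OF x, of n] elim(1) by (simp add: dist_real_def)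
      ultimately show "\<bar>discretised n h x - h x\<bar> \<le> e"
        unfolding discretised_eq[OF x] using elim(2) by linarith
    qed
  qed
  then show ?thesis by (simp only: eventually_sequentially)
qed

lemma solution_discretised_tendsto:
  assumes f: "f \<in> H1_dual" and h: "continuous_on S2 h"
  shows "(\<lambda>n. H1R_norm (\<lambda>x. solution f (discretised n h) x - solution f h x)) \<longlonglongrightarrow> 0"
proof (rule LIMSEQ_I)
  fix e :: real assume e: "e > 0"
  define c where "c = sup_abs h"
  have hc: "\<bar>h x\<bar> \<le> c" if "x \<in> S2" for x unfolding c_def by (rule abs_le_sup_abs[OF h that])
  note hm = continuous_on_S2_measurable[OF h]
  note dm = discretised_measurable[of _ h]
  have db: "\<bar>discretised n h x\<bar> \<le> c + 1" if "x \<in> S2" for n x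
    by (rule discretised_bound[OF _ that]) (rule hc)
  \<comment> \<open>One factor \<open>exp (c + 1)\<close> is the Lipschitz constant of \<open>exp\<close> on the values that occur, the other
    is the inverse of the lower bound of the discretised coefficient.\<close>
  define K where "K = exp (c + 1) * exp (c + 1) * H1R_norm (solution f h)"
  have K: "K \<ge> 0" by (simp add: K_def H1R_norm_nonneg)
  have "e / (K + 1) > 0" using e K by simp
  then obtain N where N: "\<forall>n\<ge>N. \<forall>x\<in>S2. \<bar>discretised n h x - h x\<bar> \<le> e / (K + 1)"
    using discretised_uniform_limit[OF h] by blast
  have "H1R_norm (\<lambda>x. solution f (discretised n h) x - solution f h x) < e" if n: "n \<ge> N" for n
  proof -
    have "H1R_norm (\<lambda>x. solution f (discretised n h) x - solution f h x)
        \<le> (exp (c + 1) * (e / (K + 1))) * H1R_norm (solution f h) / exp (- (c + 1))"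
    proof (rule weak_solution_perturbation)
      show "elliptic_coefficient (\<lambda>x. exp (discretised n h x)) (exp (- (c + 1))) (exp (c + 1))"
        using dm db by (rule elliptic_coefficient_exp)
      show "elliptic_coefficient (\<lambda>x. exp (h x)) (exp (- c)) (exp c)"
        using hm hc by (rule elliptic_coefficient_exp)
      show "solution f (discretised n h) \<in> H1R"
        "weak_solution (\<lambda>x. exp (discretised n h x)) f (solution f (discretised n h))"
        using solution[OF f dm db] by auto
      show "solution f h \<in> H1R" "weak_solution (\<lambda>x. exp (h x)) f (solution f h)"
        using solution[OF f hm hc] by auto
      show "0 \<le> exp (c + 1) * (e / (K + 1))" using e K by simp
      fix x assume x: "x \<in> S2"
      have "\<bar>exp (discretised n h x) - exp (h x)\<bar> \<le> exp (c + 1) * \<bar>discretised n h x - h x\<bar>"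
        using db[OF x, where n = n] hc[OF x] by (intro abs_exp_diff_le) auto
      also have "\<dots> \<le> exp (c + 1) * (e / (K + 1))" using N n x by (intro mult_left_mono) auto
      finally show "\<bar>exp (discretised n h x) - exp (h x)\<bar> \<le> exp (c + 1) * (e / (K + 1))" .
    qed
    also have "\<dots> = e * (K / (K + 1))"
      by (simp only: K_def exp_minus) (simp add: divide_inverse)
    also have "\<dots> < e * 1" using e K by (intro mult_strict_left_mono) auto
    finally show ?thesis by simp
  qed
  then show "\<exists>N. \<forall>n\<ge>N. norm (H1R_norm (\<lambda>x. solution f (discretised n h) x - solution f h x) - 0) < e"
    using H1R_norm_nonneg by auto
qed

section \<open>The lognormal diffusion problem\<close>

context
  fixes M :: "'w measure" and T :: "'w \<Rightarrow> real^3 \<Rightarrow> real" and f :: "(real^3 \<Rightarrow> real) \<Rightarrow> real"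
  assumes prob: "prob_space M" and iso: "isotropic_gaussian_random_field M T"
    and cont: "continuous_random_field M T" and f: "f \<in> H1_dual"
begin

lemmas T_continuous = random_field_continuous[OF prob iso cont]

lemma T_solution:
  assumes \<omega>: "\<omega> \<in> space M"
  shows "solution f (T \<omega>) \<in> H1R" "weak_solution (\<lambda>x. exp (T \<omega> x)) f (solution f (T \<omega>))"
  by (rule solution[OF f continuous_on_S2_measurable abs_le_sup_abs], (rule T_continuous[OF \<omega>])+, assumption)+

text \<open>The discretised field is a function of its rounded values at finitely many points, each of which is a
  simple random variable.\<close>

lemma simple_function_solution_discretised:
  "simple_function M (\<lambda>\<omega>. solution f (discretised n (T \<omega>)))"
proof -
  let ?Y = "cell_point n ` S2"
  define W where "W \<omega> = (\<lambda>y. if y \<in> ?Y then grid_round n (T \<omega> y) else 0)" for \<omega>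
  have "simple_function M W"
    unfolding W_def
  proof (rule simple_function_family[OF finite_cell_points])
    fix y assume "y \<in> ?Y"
    then have "y \<in> S2" using cell_point(1) by blast
    then have [measurable]: "(\<lambda>\<omega>. T \<omega> y) \<in> borel_measurable M"
      by (rule random_field_measurable[OF prob iso cont])
    show "simple_function M (\<lambda>\<omega>. grid_round n (T \<omega> y))"
    proof (rule simple_function_borel_measurable)
      show "finite ((\<lambda>\<omega>. grid_round n (T \<omega> y)) ` space M)"
        by (rule finite_subset[OF _ finite_range_grid_round[of n]]) auto
    qed measurable
  qed
  from simple_function_compose[OF this, of "\<lambda>w. solution f (\<lambda>x. w (cell_point n x))"]
  show ?thesis by (simp add: W_def discretised_def[abs_def] comp_def)
qed

lemma strongly_measurable_solution: "strongly_measurable_H1R M (\<lambda>\<omega>. solution f (T \<omega>))"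
  unfolding strongly_measurable_H1R_def
proof (intro conjI ballI exI[of _ "\<lambda>n \<omega>. solution f (discretised n (T \<omega>))"] allI)
  fix \<omega> assume \<omega>: "\<omega> \<in> space M"
  show "solution f (T \<omega>) \<in> H1R" by (rule T_solution(1)[OF \<omega>])
  show "(\<lambda>n. H1R_norm (\<lambda>x. solution f (discretised n (T \<omega>)) x - solution f (T \<omega>) x)) \<longlonglongrightarrow> 0"
    by (rule solution_discretised_tendsto[OF f T_continuous[OF \<omega>]])
  show "solution f (discretised n (T \<omega>)) \<in> H1R" for n
    by (rule solution(1)[OF f discretised_measurable
          discretised_bound[OF abs_le_sup_abs[OF T_continuous[OF \<omega>]]]])
next
  show "simple_function M (\<lambda>\<omega>. solution f (discretised n (T \<omega>)))" for n
    by (rule simple_function_solution_discretised)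
qed

end

text \<open>The norm is a pointwise limit of the norms of the simple approximations.\<close>

lemma strongly_measurable_H1R_norm:
  assumes "strongly_measurable_H1R M u"
  shows "(\<lambda>\<omega>. H1R_norm (u \<omega>)) \<in> borel_measurable M"
proof -
  obtain s :: "nat \<Rightarrow> _" where s: "\<And>n. simple_function M (s n)" "\<And>n \<omega>. \<omega> \<in> space M \<Longrightarrow> s n \<omega> \<in> H1R"
    and lim: "\<And>\<omega>. \<omega> \<in> space M \<Longrightarrow> (\<lambda>n. H1R_norm (\<lambda>x. s n \<omega> x - u \<omega> x)) \<longlonglongrightarrow> 0"
    and u: "\<And>\<omega>. \<omega> \<in> space M \<Longrightarrow> u \<omega> \<in> H1R"
    using assms unfolding strongly_measurable_H1R_def by blast
  show ?thesis
  proof (rule borel_measurable_LIMSEQ_real)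
    show "(\<lambda>\<omega>. H1R_norm (s n \<omega>)) \<in> borel_measurable M" for n
      using simple_function_compose[OF s(1)[of n], of H1R_norm]
      by (intro borel_measurable_simple_function) (simp add: comp_def)
    fix \<omega> assume \<omega>: "\<omega> \<in> space M"
    show "(\<lambda>n. H1R_norm (s n \<omega>)) \<longlonglongrightarrow> H1R_norm (u \<omega>)"
    proof (rule LIM_zero_cancel, rule Lim_null_comparison[OF always_eventually lim[OF \<omega>]], rule allI)
      show "norm (H1R_norm (s n \<omega>) - H1R_norm (u \<omega>)) \<le> H1R_norm (\<lambda>x. s n \<omega> x - u \<omega> x)" for n
        using H1R_norm_triangle_diff[OF H1R_H1[OF s(2)[OF \<omega>]] H1R_H1[OF u[OF \<omega>]]] by simp
    qed
  qed
qed

theorem theorem3p3: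
  fixes M :: "'w measure"
    and T :: "'w \<Rightarrow> real^3 \<Rightarrow> real"
    and a :: "'w \<Rightarrow> real^3 \<Rightarrow> real"
    and A :: "nat \<Rightarrow> real"
    and \<beta> :: real
    and f :: "(real^3 \<Rightarrow> real) \<Rightarrow> real"
  assumes "prob_space M"
    and "isotropic_gaussian_random_field M T"
    and "continuous_random_field M T"
    and "angular_power_spectrum M T A"
    and "\<beta> > 0"
    and "summable (\<lambda>l. A l * real l powr (1 + \<beta>))"
    and "a = (\<lambda>\<omega> x. exp (T \<omega> x))"
    and "f \<in> H1_dual"
    and "f (\<lambda>_. 1) = 0"
  shows "\<exists>u :: 'w \<Rightarrow> real^3 \<Rightarrow> real.
    strongly_measurable_H1R M u \<and>
    (AE \<omega> in M. weak_solution (a \<omega>) f (u \<omega>)) \<and>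
    (\<forall>w :: 'w \<Rightarrow> real^3 \<Rightarrow> real.
       strongly_measurable_H1R M w \<and> (AE \<omega> in M. weak_solution (a \<omega>) f (w \<omega>)) \<longrightarrow>
       (AE \<omega> in M. AE x in surf. w \<omega> x = u \<omega> x)) \<and>
    (\<forall>p::real. 1 \<le> p \<longrightarrow> u \<in> Lp_H1R p M)"
proof -
  note prob = assms(1) and iso = assms(2) and cont = assms(3) and f = assms(8)
  define u where "u \<omega> = solution f (T \<omega>)" for \<omega>
  have a_eq: "a \<omega> = (\<lambda>x. exp (T \<omega> x))" for \<omega> using assms(7) by simp
  note u_sol = T_solution[OF prob iso cont f, folded u_def a_eq]
  have ell: "elliptic_coefficient (a \<omega>) (exp (- sup_abs (T \<omega>))) (exp (sup_abs (T \<omega>)))"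
    if "\<omega> \<in> space M" for \<omega>
    unfolding a_eq using random_field_continuous[OF prob iso cont that]
    by (intro elliptic_coefficient_exp continuous_on_S2_measurable abs_le_sup_abs)
  have meas: "strongly_measurable_H1R M u"
    unfolding u_def by (rule strongly_measurable_solution[OF prob iso cont f])
  have sol: "AE \<omega> in M. weak_solution (a \<omega>) f (u \<omega>)"
    using u_sol(2) by (intro AE_I2) auto
  have unique: "AE \<omega> in M. AE x in surf. w \<omega> x = u \<omega> x"
    if w: "strongly_measurable_H1R M w" "AE \<omega> in M. weak_solution (a \<omega>) f (w \<omega>)" for w
    using w(2) AE_space
  proof eventually_elim
    case (elim \<omega>)
    then have "w \<omega> \<in> H1R" using w(1) by (simp add: strongly_measurable_H1R_def)
    then show ?case using weak_solution_unique[OF ell] u_sol elim by blast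
  qed
  obtain F where F: "F \<ge> 0" "\<And>v. v \<in> H1R \<Longrightarrow> \<bar>f v\<bar> \<le> F * H1R_norm v"
    using H1_dual_bound[OF f] by blast
  have bound: "H1R_norm (u \<omega>) \<le> F * exp (sup_abs (T \<omega>))" if \<omega>: "\<omega> \<in> space M" for \<omega>
  proof -
    interpret elliptic_coefficient "a \<omega>" "exp (- sup_abs (T \<omega>))" "exp (sup_abs (T \<omega>))"
      by (rule ell[OF \<omega>])
    show ?thesis
      using weak_solution_bound[OF u_sol[OF \<omega>] F(2,1)] by (simp add: exp_minus divide_inverse)
  qed
  have "u \<in> Lp_H1R p M" if p: "1 \<le> p" for p
  proof -
    have [measurable]: "(\<lambda>\<omega>. H1R_norm (u \<omega>)) \<in> borel_measurable M"
      by (rule strongly_measurable_H1R_norm[OF meas])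
    have "integrable M (\<lambda>\<omega>. F powr p * exp (p * sup_abs (T \<omega>)))"
      using exp_sup_abs_integrable[OF prob iso cont] p by simp
    then have "integrable M (\<lambda>\<omega>. H1R_norm (u \<omega>) powr p)"
    proof (rule Bochner_Integration.integrable_bound)
      show "AE \<omega> in M. norm (H1R_norm (u \<omega>) powr p) \<le> norm (F powr p * exp (p * sup_abs (T \<omega>)))"
      proof (rule AE_I2)
        fix \<omega> assume "\<omega> \<in> space M"
        then have "H1R_norm (u \<omega>) powr p \<le> (F * exp (sup_abs (T \<omega>))) powr p"
          using bound p by (intro powr_mono2) (auto simp: H1R_norm_nonneg)
        also have "\<dots> = F powr p * exp (p * sup_abs (T \<omega>))"
          using F(1) by (simp add: powr_mult exp_powr_real mult.commute)
        finally show "norm (H1R_norm (u \<omega>) powr p) \<le> norm (F powr p * exp (p * sup_abs (T \<omega>)))"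
          by simp
      qed
    qed measurable
    then show ?thesis using meas by (simp add: Lp_H1R_def)
  qed
  then show ?thesis using meas sol unique by blast
qed

end
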